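(* Let $r,c$ be positive integers with $c<r<3c/2$. Then the moduli space $\mathcal M^f(\mathbb P^3;r,c)$ of framed torsion free $(r,c)$-instantons on $\mathbb P^3$ is either singular or reducible.
   Context: $k$ is an algebraically closed field; $l_\infty\subset\mathbb P^3$ is a fixed line. An $(r,c)$-instanton on $\mathbb P^3$ is a torsion free sheaf $E$ of rank $r$ with $c_2(E)=c$, $H^1(\mathbb P^3,E(-2))=H^2(\mathbb P^3,E(-2))=0$, such that $E|_l\simeq\mathcal O_l^r$ for some line $l\subset\mathbb P^3$. A framed $(r,c)$-instanton is a pair $(E,\Phi)$ with $\Phi:E|_{l_\infty}\xrightarrow{\simeq}\mathcal O_{l_\infty}^r$ an isomorphism. $\mathcal M^f(\mathbb P^3;r,c)$ is the scheme representing the functor which sends a $k$-scheme $S$ to the set of isomorphism classes of $S$-flat families of framed $(r,c)$-instantons. Equivalently, let $V,W$ be vector spaces of dimensions $c,r$ and let an ADHM $(r,c)$-datum for $\mathbb P^1$ be a quadruple $x=(\tilde B_1,\tilde B_2,\tilde i,\tilde j)\in(\mathrm{Hom}(V,V)^{\oplus2}\oplus\mathrm{Hom}(W,V)\oplus\mathrm{Hom}(V,W))\otimes H^0(\mathbb P^1,\mathcal O(1))$ with $[\tilde B_1,\tilde B_2]+\tilde i\tilde j=0$ in $\mathrm{End}(V)\otimes H^0(\mathbb P^1,\mathcal O(2))$. It is FJ-stable if for every $p\in\mathbb P^1$ the evaluation $(B_1,B_2,i,j)$ of $x$ at $p$ has the property that no proper subspace $S\subsetneq V$ satisfies $B_1(S)\subset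 S$, $B_2(S)\subset S$ and $\mathrm{im}\,i\subset S$. Then $\mathcal M^f(\mathbb P^3;r,c)$ is the quotient of the scheme of FJ-stable ADHM $(r,c)$-data for $\mathbb P^1$ by $\mathrm{GL}(V)$ acting by $g\cdot(\tilde B_1,\tilde B_2,\tilde i,\tilde j)=(g\tilde B_1g^{-1},g\tilde B_2g^{-1},g\tilde i,\tilde jg^{-1})$. *)

theory Defs
  imports "HOL-Analysis.Analysis" "HOL-Algebra.Ring_Divisibility"
begin

section \<open>Regular local rings\<close>

definition krull_dim :: "('a, 'm) ring_scheme \<Rightarrow> enat" where
  "krull_dim R = Sup {enat n | n. \<exists>P. (\<forall>i\<le>n. primeideal (P i) R) \<and> (\<forall>i<n. P i \<subset> P (Suc i))}"

definition regular_local_ring :: "('a, 'm) ring_scheme \<Rightarrow> bool" where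
  "regular_local_ring R \<longleftrightarrow>
     cring R \<and> noetherian_ring R \<and> (\<exists>!m. maximalideal m R) \<and>
     (\<exists>S \<subseteq> carrier R. finite S \<and> enat (card S) = krull_dim R \<and> maximalideal (Idl\<^bsub>R\<^esub> S) R)"


section \<open>Ringed spaces\<close>

text \<open>The values of \<open>sections\<close> and \<open>restr\<close> are only meaningful on open sets.\<close>

record ('p, 's) ringed_space =
  top_of :: "'p topology"
  sections :: "'p set \<Rightarrow> 's ring"
  restr :: "'p set \<Rightarrow> 'p set \<Rightarrow> 's \<Rightarrow> 's"

definition germ :: "('p, 's) ringed_space \<Rightarrow> 'p \<Rightarrow> 'p set \<Rightarrow> 's \<Rightarrow> ('p set \<times> 's) set" where
  "germ X p U s = {(V, t). openin (top_of X) V \<and> p \<in> V \<and> t \<in> carrier (sections X V) \<and>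
     (\<exists>W. openin (top_of X) W \<and> p \<in> W \<and> W \<subseteq> U \<inter> V \<and> restr X U W s = restr X V W t)}"

definition stalk :: "('p, 's) ringed_space \<Rightarrow> 'p \<Rightarrow> ('p set \<times> 's) set ring" where
  "stalk X p = \<lparr>
     carrier = {germ X p U s | U s. openin (top_of X) U \<and> p \<in> U \<and> s \<in> carrier (sections X U)},
     mult = (\<lambda>a b. \<Union>(U, s)\<in>a. \<Union>(V, t)\<in>b. germ X p (U \<inter> V)
        (restr X U (U \<inter> V) s \<otimes>\<^bsub>sections X (U \<inter> V)\<^esub> restr X V (U \<inter> V) t)),
     one = germ X p (topspace (top_of X)) \<one>\<^bsub>sections X (topspace (top_of X))\<^esub>,
     zero = germ X p (topspace (top_of X)) \<zero>\<^bsub>sections X (topspace (top_of X))\<^esub>,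
     add = (\<lambda>a b. \<Union>(U, s)\<in>a. \<Union>(V, t)\<in>b. germ X p (U \<inter> V)
        (restr X U (U \<inter> V) s \<oplus>\<^bsub>sections X (U \<inter> V)\<^esub> restr X V (U \<inter> V) t)) \<rparr>"

text \<open>
  A scheme of finite type over an algebraically closed field is represented by the ringed
  space of its closed points. Passing to closed points changes neither irreducibility nor
  regularity: closed points are very dense, the singular locus is closed, and a localization
  of a regular local ring is regular. Over a perfect field, regular means smooth. The empty
  space is neither singular nor reducible.
\<close>

definition singular :: "('p, 's) ringed_space \<Rightarrow> bool" where
  "singular X \<longleftrightarrow> (\<exists>p \<in> topspace (top_of X). \<not> regular_local_ring (stalk X p))"

definition reducible :: "('p, 's) ringed_space \<Rightarrow> bool" where
  "reducible X \<longleftrightarrow> (\<exists>C D. closedin (top_of X) C \<and> closedin (top_of X) D \<and>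
     C \<noteq> topspace (top_of X) \<and> D \<noteq> topspace (top_of X) \<and> C \<union> D = topspace (top_of X))"


section \<open>ADHM data for the projective line\<close>

text \<open>
  \<open>V = 'k ^ 'v\<close> and \<open>W = 'k ^ 'w\<close>. An element of \<open>Hom \<otimes> H\<^sup>0(O(1))\<close> is the pair of matrices
  \<open>(M\<^sub>0, M\<^sub>1)\<close> standing for \<open>M\<^sub>0 z\<^sub>0 + M\<^sub>1 z\<^sub>1\<close>, where \<open>z\<^sub>0, z\<^sub>1\<close> are the homogeneous coordinates.
\<close>

record ('k, 'v, 'w) adhm =
  adhm_B1 :: "('k ^ 'v::finite ^ 'v) \<times> ('k ^ 'v ^ 'v)"
  adhm_B2 :: "('k ^ 'v ^ 'v) \<times> ('k ^ 'v ^ 'v)"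
  adhm_i :: "('k ^ 'w::finite ^ 'v) \<times> ('k ^ 'w ^ 'v)"
  adhm_j :: "('k ^ 'v ^ 'w) \<times> ('k ^ 'v ^ 'w)"

text \<open>The product of linear forms; the result lists the coefficients of
  \<open>z\<^sub>0\<^sup>2\<close>, \<open>z\<^sub>0 z\<^sub>1\<close> and \<open>z\<^sub>1\<^sup>2\<close>.\<close>

definition sec_mult :: "('k::field ^ 'b ^ 'a) \<times> ('k ^ 'b ^ 'a) \<Rightarrow>
    ('k ^ 'd ^ 'b) \<times> ('k ^ 'd ^ 'b) \<Rightarrow> ('k ^ 'd ^ 'a) \<times> ('k ^ 'd ^ 'a) \<times> ('k ^ 'd ^ 'a)" where
  "sec_mult M N =
     (fst M ** fst N, fst M ** snd N + snd M ** fst N, snd M ** snd N)"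

definition adhm_moment :: "('k::field, 'v::finite, 'w::finite) adhm \<Rightarrow>
    ('k ^ 'v ^ 'v) \<times> ('k ^ 'v ^ 'v) \<times> ('k ^ 'v ^ 'v)" where
  "adhm_moment x = sec_mult (adhm_B1 x) (adhm_B2 x) - sec_mult (adhm_B2 x) (adhm_B1 x)
     + sec_mult (adhm_i x) (adhm_j x)"

definition sec_eval :: "'k \<times> 'k \<Rightarrow> ('k::field ^ 'b ^ 'a) \<times> ('k ^ 'b ^ 'a) \<Rightarrow> 'k ^ 'b ^ 'a" where
  "sec_eval p M = (\<chi> a b. fst p * fst M $ a $ b + snd p * snd M $ a $ b)"

text \<open>Here \<open>p\<close> runs over homogeneous coordinates of points of the projective line; rescaling \<open>p\<close>
  rescales all evaluations and does not affect the condition.\<close>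

definition fj_stable :: "('k::field, 'v::finite, 'w::finite) adhm \<Rightarrow> bool" where
  "fj_stable x \<longleftrightarrow> (\<forall>p. p \<noteq> (0, 0) \<longrightarrow>
     \<not> (\<exists>S. vec.subspace S \<and> S \<noteq> UNIV \<and>
        (\<lambda>u. sec_eval p (adhm_B1 x) *v u) ` S \<subseteq> S \<and>
        (\<lambda>u. sec_eval p (adhm_B2 x) *v u) ` S \<subseteq> S \<and>
        range (\<lambda>w. sec_eval p (adhm_i x) *v w) \<subseteq> S))"

definition gl_act :: "'k::field ^ 'v ^ 'v \<Rightarrow> ('k, 'v::finite, 'w::finite) adhm \<Rightarrow> ('k, 'v, 'w) adhm"
  where
  "gl_act g x = \<lparr>
     adhm_B1 = map_prod (\<lambda>M. g ** M ** matrix_inv g) (\<lambda>M. g ** M ** matrix_inv g) (adhm_B1 x),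
     adhm_B2 = map_prod (\<lambda>M. g ** M ** matrix_inv g) (\<lambda>M. g ** M ** matrix_inv g) (adhm_B2 x),
     adhm_i = map_prod (\<lambda>M. g ** M) (\<lambda>M. g ** M) (adhm_i x),
     adhm_j = map_prod (\<lambda>M. M ** matrix_inv g) (\<lambda>M. M ** matrix_inv g) (adhm_j x) \<rparr>"


section \<open>The scheme of FJ-stable ADHM data\<close>

definition adhm_coords :: "(('k::field, 'v::finite, 'w::finite) adhm \<Rightarrow> 'k) set" where
  "adhm_coords =
     (\<Union>a b. {\<lambda>x. fst (adhm_B1 x) $ a $ b, \<lambda>x. snd (adhm_B1 x) $ a $ b,
              \<lambda>x. fst (adhm_B2 x) $ a $ b, \<lambda>x. snd (adhm_B2 x) $ a $ b}) \<union>
     (\<Union>a b. {\<lambda>x. fst (adhm_i x) $ a $ b, \<lambda>x. snd (adhm_i x) $ a $ b}) \<union>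
     (\<Union>a b. {\<lambda>x. fst (adhm_j x) $ a $ b, \<lambda>x. snd (adhm_j x) $ a $ b})"

text \<open>The coordinate ring of the affine space of all quadruples. It is realized as the ring of
  polynomial functions, which is the polynomial ring in the coordinates because an algebraically
  closed field is infinite.\<close>

inductive_set adhm_polys :: "(('k::field, 'v::finite, 'w::finite) adhm \<Rightarrow> 'k) set" where
  const: "(\<lambda>x. a) \<in> adhm_polys"
| coord: "f \<in> adhm_coords \<Longrightarrow> f \<in> adhm_polys"
| add: "f \<in> adhm_polys \<Longrightarrow> g \<in> adhm_polys \<Longrightarrow> (\<lambda>x. f x + g x) \<in> adhm_polys"
| mult: "f \<in> adhm_polys \<Longrightarrow> g \<in> adhm_polys \<Longrightarrow> (\<lambda>x. f x * g x) \<in> adhm_polys"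

definition adhm_poly_ring :: "(('k::field, 'v::finite, 'w::finite) adhm \<Rightarrow> 'k) ring" where
  "adhm_poly_ring = \<lparr> carrier = adhm_polys, mult = (\<lambda>f g x. f x * g x), one = (\<lambda>x. 1),
     zero = (\<lambda>x. 0), add = (\<lambda>f g x. f x + g x) \<rparr>"

text \<open>The ideal of the ADHM equation. It need not be radical, so the structure sheaf below
  may have nilpotents and its sections are not functions with values in \<open>'k\<close>.\<close>

definition adhm_ideal :: "(('k::field, 'v::finite, 'w::finite) adhm \<Rightarrow> 'k) set" where
  "adhm_ideal = Idl\<^bsub>adhm_poly_ring\<^esub>
     (\<Union>a b. {\<lambda>x. fst (adhm_moment x) $ a $ b, \<lambda>x. fst (snd (adhm_moment x)) $ a $ b,
             \<lambda>x. snd (snd (adhm_moment x)) $ a $ b})"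

text \<open>The fraction \<open>f / h\<close> in the localization of \<open>adhm_poly_ring / adhm_ideal\<close> at the maximal
  ideal of \<open>x\<close>, as an equivalence class of pairs of representatives.\<close>

definition adhm_frac :: "('k::field, 'v::finite, 'w::finite) adhm \<Rightarrow>
    (('k, 'v, 'w) adhm \<Rightarrow> 'k) \<Rightarrow> (('k, 'v, 'w) adhm \<Rightarrow> 'k) \<Rightarrow>
    ((('k, 'v, 'w) adhm \<Rightarrow> 'k) \<times> (('k, 'v, 'w) adhm \<Rightarrow> 'k)) set" where
  "adhm_frac x f h = {(f', h'). f' \<in> adhm_polys \<and> h' \<in> adhm_polys \<and> h' x \<noteq> 0 \<and>
     (\<exists>u \<in> adhm_polys. u x \<noteq> 0 \<and> (\<lambda>y. u y * (f y * h' y - f' y * h y)) \<in> adhm_ideal)}"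

type_synonym ('k, 'v, 'w) adhm_local =
  "((('k, 'v, 'w) adhm \<Rightarrow> 'k) \<times> (('k, 'v, 'w) adhm \<Rightarrow> 'k)) set"

definition adhm_local_ring ::
    "('k::field, 'v::finite, 'w::finite) adhm \<Rightarrow> ('k, 'v, 'w) adhm_local ring" where
  "adhm_local_ring x = \<lparr>
     carrier = {adhm_frac x f h | f h. f \<in> adhm_polys \<and> h \<in> adhm_polys \<and> h x \<noteq> 0},
     mult = (\<lambda>a b. \<Union>(f, h)\<in>a. \<Union>(f', h')\<in>b. adhm_frac x (\<lambda>y. f y * f' y) (\<lambda>y. h y * h' y)),
     one = adhm_frac x (\<lambda>y. 1) (\<lambda>y. 1),
     zero = adhm_frac x (\<lambda>y. 0) (\<lambda>y. 1),
     add = (\<lambda>a b. \<Union>(f, h)\<in>a. \<Union>(f', h')\<in>b.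
        adhm_frac x (\<lambda>y. f y * h' y + f' y * h y) (\<lambda>y. h y * h' y)) \<rparr>"

definition fj_data :: "('k::field, 'v::finite, 'w::finite) adhm set" where
  "fj_data = {x. adhm_moment x = 0 \<and> fj_stable x}"

definition fj_topology :: "('k::field, 'v::finite, 'w::finite) adhm topology" where
  "fj_topology =
     subtopology (topology_generated_by {{x. h x \<noteq> 0} | h. h \<in> adhm_polys}) fj_data"

definition fj_sections :: "('k::field, 'v::finite, 'w::finite) adhm set \<Rightarrow>
    (('k, 'v, 'w) adhm \<Rightarrow> ('k, 'v, 'w) adhm_local) ring" where
  "fj_sections U = \<lparr>
     carrier = {s \<in> extensional U. \<forall>x\<in>U. \<exists>f\<in>adhm_polys. \<exists>h\<in>adhm_polys. \<exists>N.
        openin fj_topology N \<and> x \<in> N \<and> N \<subseteq> U \<and> (\<forall>y\<in>N. h y \<noteq> 0 \<and> s y = adhm_frac y f h)},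
     mult = (\<lambda>s t. \<lambda>x\<in>U. s x \<otimes>\<^bsub>adhm_local_ring x\<^esub> t x),
     one = (\<lambda>x\<in>U. \<one>\<^bsub>adhm_local_ring x\<^esub>),
     zero = (\<lambda>x\<in>U. \<zero>\<^bsub>adhm_local_ring x\<^esub>),
     add = (\<lambda>s t. \<lambda>x\<in>U. s x \<oplus>\<^bsub>adhm_local_ring x\<^esub> t x) \<rparr>"


section \<open>The moduli space of framed instantons\<close>

text \<open>The quotient by \<open>GL(V)\<close> as a ringed space: the points are the orbits, the topology is the
  quotient topology, and the sections over \<open>U\<close> are the invariant sections over the preimage
  of \<open>U\<close>. Since \<open>GL(V)\<close> is reduced and the field is algebraically closed, a section is invariant
  under the group scheme if and only if it is invariant under every rational point.\<close>

definition gl_orbit :: "('k::field, 'v::finite, 'w::finite) adhm \<Rightarrow> ('k, 'v, 'w) adhm set" where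
  "gl_orbit x = {gl_act g x | g. invertible g}"

definition orbit_preimage ::
    "('k::field, 'v::finite, 'w::finite) adhm set set \<Rightarrow> ('k, 'v, 'w) adhm set" where
  "orbit_preimage U = {x \<in> fj_data. gl_orbit x \<in> U}"

definition moduli_topology :: "('k::field, 'v::finite, 'w::finite) adhm set topology" where
  "moduli_topology =
     topology (\<lambda>U. U \<subseteq> gl_orbit ` fj_data \<and> openin fj_topology (orbit_preimage U))"

lemma openin_moduli_topology:
  fixes U :: "('k::field, 'v::finite, 'w::finite) adhm set set"
  shows "openin moduli_topology U \<longleftrightarrow>
     U \<subseteq> gl_orbit ` fj_data \<and> openin fj_topology (orbit_preimage U)"
proof -
  have pre_Int: "orbit_preimage (A \<inter> B) = orbit_preimage A \<inter> orbit_preimage B"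
    for A B :: "('k, 'v, 'w) adhm set set"
    by (auto simp: orbit_preimage_def)
  have pre_Union: "orbit_preimage (\<Union>K) = \<Union>(orbit_preimage ` K)"
    for K :: "('k, 'v, 'w) adhm set set set"
    by (auto simp: orbit_preimage_def)
  have "istopology (\<lambda>U :: ('k, 'v, 'w) adhm set set. U \<subseteq> gl_orbit ` fj_data \<and>
      openin fj_topology (orbit_preimage U))"
    unfolding istopology_def pre_Int pre_Union by (fastforce intro: openin_Int openin_Union)
  then show ?thesis
    by (simp add: moduli_topology_def topology_inverse')
qed

text \<open>Pullback along the isomorphism \<open>x \<mapsto> g \<cdot> x\<close>, from the local ring at \<open>g \<cdot> x\<close> to the local
  ring at \<open>x\<close>. It applies the substitution to all representatives of a fraction.\<close>

definition gl_pullback :: "'k::field ^ 'v ^ 'v \<Rightarrow>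
    ('k, 'v::finite, 'w::finite) adhm_local \<Rightarrow> ('k, 'v, 'w) adhm_local" where
  "gl_pullback g a = (\<lambda>(f, h). (f \<circ> gl_act g, h \<circ> gl_act g)) ` a"

definition moduli_sections :: "('k::field, 'v::finite, 'w::finite) adhm set set \<Rightarrow>
    (('k, 'v, 'w) adhm \<Rightarrow> ('k, 'v, 'w) adhm_local) ring" where
  "moduli_sections U = (fj_sections (orbit_preimage U))
     \<lparr>carrier := {s \<in> carrier (fj_sections (orbit_preimage U)).
        \<forall>g. \<forall>x\<in>orbit_preimage U. invertible g \<longrightarrow> gl_pullback g (s (gl_act g x)) = s x}\<rparr>"

type_synonym ('k, 'v, 'w) moduli_space =
  "(('k, 'v, 'w) adhm set, ('k, 'v, 'w) adhm \<Rightarrow> ('k, 'v, 'w) adhm_local) ringed_space"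

definition framed_instanton_moduli ::
    "('k::alg_closed_field, 'v::finite, 'w::finite) moduli_space" where
  "framed_instanton_moduli = \<lparr>
     top_of = moduli_topology,
     sections = moduli_sections,
     restr = (\<lambda>U U' s. restrict s (orbit_preimage U')) \<rparr>"

end

theory Submission
  imports Defs
begin

text \<open>
  The moduli space is in fact singular, at one explicit point. Put \<open>s = r - c\<close>, so that
  \<open>0 < s\<close> and \<open>2 s < c\<close>. The point is the orbit of the datum with \<open>B\<^sub>1 = B\<^sub>2 = 0\<close>, \<open>j = 0\<close> and
  \<open>i = z\<^sub>0 (I | 0) + z\<^sub>1 (0 | I)\<close>, a \<open>c \<times> r\<close> matrix whose second identity block is shifted by \<open>s\<close> columns;
  \<open>i\<close> is onto at every point of the line, so the datum is stable.

  For fixed \<open>i\<close> and \<open>B\<close> the ADHM equation is a linear system for \<open>j\<close>, with matrix the map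
  \<open>W \<otimes> H\<^sup>0(O(1)) \<rightarrow> V \<otimes> H\<^sup>0(O(2))\<close> induced by \<open>i\<close>. At the base point this map is injective
  (\<open>toeplitz_base_kernel\<close>), but it is not onto, because \<open>2 r < 3 c\<close>
  (\<open>toeplitz_base_cokernel\<close> gives a functional that kills its image). Injectivity has two
  consequences: the tangent directions at the base point are all directions in \<open>B\<close> and \<open>i\<close>, with
  \<open>j\<close> unchanged; and near the base point \<open>j\<close> is a rational function of \<open>B\<close> and \<open>i\<close>, by
  Cramer's rule. The cokernel yields a nontrivial relation between \<open>B\<close> and \<open>i\<close> alone, a combination of
  entries of \<open>[B\<^sub>1, B\<^sub>2]\<close> whose coefficients are polynomials in \<open>i\<close>. This relation is linear in an entry of
  \<open>B\<^sub>1\<close>, and the coefficient of that entry is linear in an entry of \<open>B\<^sub>2\<close>. Hence on every irreducible closed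
  subset through the base point one of the tangent coordinates is a rational function of the others
  (\<open>coordinate_system_exists\<close>), and the dimension is smaller than the number of tangent coordinates.

  To read this off the stalk, orbits near the base point are normalized by making the first \<open>c\<close> columns
  of \<open>i\<^sub>0\<close> the identity. The stalk is then the local ring of the slice: \<open>slice_germ f h\<close> extends a fraction
  from the slice to an invariant section, and \<open>germ_is_slice_germ\<close> shows that every germ arises so.
  A regular local ring needs exactly as many generators of its maximal ideal as its Krull dimension.
  By \<open>generators_bound\<close> the number of generators is at least the number of tangent coordinates.
  By \<open>prime_chain_bound\<close> the length of a chain of primes is at most the number of functions over which
  everything is rational modulo the smallest prime, one less here. So the stalk is not regular.
  The bound on prime chains is elementary: one element from each step of the chain gives
  algebraically independent elements, and monomials are counted.
\<close>

section \<open>Prime chains and transcendence in algebras of functions\<close>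

lemma nontrivial_linear_relation:
  fixes M :: "'a \<Rightarrow> 'b \<Rightarrow> 'k::field"
  assumes "finite B" and "finite A" and "card B < card A"
  shows "\<exists>c. (\<exists>a\<in>A. c a \<noteq> 0) \<and> (\<forall>b\<in>B. (\<Sum>a\<in>A. c a * M a b) = 0)"
  using assms
proof (induction B arbitrary: A M rule: finite_induct)
  case empty
  then obtain a where "a \<in> A" by fastforce
  then show ?case by (intro exI[of _ "\<lambda>_. 1"]) auto
next
  case (insert b B)
  show ?case
  proof (cases "\<forall>a\<in>A. M a b = 0")
    case True
    obtain c where c: "\<exists>a\<in>A. c a \<noteq> 0" "\<forall>b\<in>B. (\<Sum>a\<in>A. c a * M a b) = 0"
      using insert.IH[of A M] insert.prems insert.hyps by auto
    then show ?thesis using True by (intro exI[of _ c]) auto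
  next
    case False
    then obtain p where p: "p \<in> A" "M p b \<noteq> 0" by auto
    define M' where "M' a d = M a d - M a b / M p b * M p d" for a d
    have "card B < card (A - {p})" using insert.prems insert.hyps p by auto
    then obtain c where c: "\<exists>a\<in>A - {p}. c a \<noteq> 0"
        "\<forall>d\<in>B. (\<Sum>a\<in>A - {p}. c a * M' a d) = 0"
      using insert.IH[of "A - {p}" M'] insert.prems by auto
    define c' where "c' a = (if a = p then - (\<Sum>a\<in>A - {p}. c a * M a b) / M p b else c a)" for a
    have split: "(\<Sum>a\<in>A. c' a * M a d) = c' p * M p d + (\<Sum>a\<in>A - {p}. c a * M a d)" for d
    proof -
      have "(\<Sum>a\<in>A. c' a * M a d) = c' p * M p d + (\<Sum>a\<in>A - {p}. c' a * M a d)"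
        using p insert.prems by (simp add: sum.remove)
      also have "(\<Sum>a\<in>A - {p}. c' a * M a d) = (\<Sum>a\<in>A - {p}. c a * M a d)"
        by (rule sum.cong) (auto simp: c'_def)
      finally show ?thesis .
    qed
    have at_d: "(\<Sum>a\<in>A. c' a * M a d) = (\<Sum>a\<in>A - {p}. c a * M' a d)" for d
    proof -
      have "(\<Sum>a\<in>A - {p}. c a * M' a d) =
          (\<Sum>a\<in>A - {p}. c a * M a d) - (\<Sum>a\<in>A - {p}. c a * M a b * (M p d / M p b))"
        by (simp add: M'_def right_diff_distrib sum_subtractf mult.assoc)
      also have "(\<Sum>a\<in>A - {p}. c a * M a b * (M p d / M p b)) =
          (\<Sum>a\<in>A - {p}. c a * M a b) * (M p d / M p b)"
        by (simp only: sum_distrib_right)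
      finally show ?thesis unfolding split by (simp add: c'_def)
    qed
    have at_b: "(\<Sum>a\<in>A. c' a * M a b) = 0"
      unfolding split using p by (simp add: c'_def)
    have "\<forall>d\<in>insert b B. (\<Sum>a\<in>A. c' a * M a d) = 0"
      using at_b at_d c(2) by auto
    moreover have "\<exists>a\<in>A. c' a \<noteq> 0"
      using c(1) by (auto simp: c'_def)
    ultimately show ?thesis by blast
  qed
qed

definition subalgebra :: "('x \<Rightarrow> 'k::field) set \<Rightarrow> bool" where
  "subalgebra Q \<longleftrightarrow> (\<forall>a. (\<lambda>x. a) \<in> Q) \<and> (\<forall>f\<in>Q. \<forall>g\<in>Q. (\<lambda>x. f x + g x) \<in> Q) \<and>
     (\<forall>f\<in>Q. \<forall>g\<in>Q. (\<lambda>x. f x * g x) \<in> Q)"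

text \<open>
  Primes are sets of functions, relative to an algebra of functions given as a set; scalars are the
  constant functions. Pointwise arithmetic then replaces the operations of a ring record.
\<close>
definition prime_in :: "('x \<Rightarrow> 'k::field) set \<Rightarrow> ('x \<Rightarrow> 'k) set \<Rightarrow> bool" where
  "prime_in Q P \<longleftrightarrow> P \<subseteq> Q \<and> (\<lambda>x. 0) \<in> P \<and> (\<lambda>x. 1) \<notin> P \<and>
     (\<forall>f\<in>P. \<forall>g\<in>P. (\<lambda>x. f x + g x) \<in> P) \<and> (\<forall>f\<in>Q. \<forall>g\<in>P. (\<lambda>x. f x * g x) \<in> P) \<and>
     (\<forall>f\<in>Q. \<forall>g\<in>Q. (\<lambda>x. f x * g x) \<in> P \<longrightarrow> f \<in> P \<or> g \<in> P)"

inductive_set alg :: "('x \<Rightarrow> 'k::field) set \<Rightarrow> ('x \<Rightarrow> 'k) set" for Z where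
  const: "(\<lambda>x. a) \<in> alg Z"
| gen: "f \<in> Z \<Longrightarrow> f \<in> alg Z"
| add: "f \<in> alg Z \<Longrightarrow> g \<in> alg Z \<Longrightarrow> (\<lambda>x. f x + g x) \<in> alg Z"
| mult: "f \<in> alg Z \<Longrightarrow> g \<in> alg Z \<Longrightarrow> (\<lambda>x. f x * g x) \<in> alg Z"

locale function_algebra =
  fixes Q :: "('x \<Rightarrow> 'k::field) set"
  assumes Q: "subalgebra Q"
begin

lemma Q_const: "(\<lambda>x. a) \<in> Q" and
  Q_add: "f \<in> Q \<Longrightarrow> g \<in> Q \<Longrightarrow> (\<lambda>x. f x + g x) \<in> Q" and
  Q_mult: "f \<in> Q \<Longrightarrow> g \<in> Q \<Longrightarrow> (\<lambda>x. f x * g x) \<in> Q"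
  using Q by (auto simp: subalgebra_def)

lemma Q_uminus: "f \<in> Q \<Longrightarrow> (\<lambda>x. - f x) \<in> Q"
  using Q_mult[OF Q_const[of "-1"]] by force

lemma Q_diff: "f \<in> Q \<Longrightarrow> g \<in> Q \<Longrightarrow> (\<lambda>x. f x - g x) \<in> Q"
  using Q_add[of f, OF _ Q_uminus[of g]] by simp

lemma Q_sum: "(\<And>i. i \<in> I \<Longrightarrow> f i \<in> Q) \<Longrightarrow> (\<lambda>x. \<Sum>i\<in>I. f i x) \<in> Q"
  by (induction I rule: infinite_finite_induct) (auto intro: Q_const Q_add)

lemma Q_prod: "(\<And>i. i \<in> I \<Longrightarrow> f i \<in> Q) \<Longrightarrow> (\<lambda>x. \<Prod>i\<in>I. f i x) \<in> Q"
  by (induction I rule: infinite_finite_induct) (auto intro: Q_const Q_mult)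

lemma Q_power: "f \<in> Q \<Longrightarrow> (\<lambda>x. f x ^ n) \<in> Q"
  by (induction n) (auto intro: Q_const Q_mult)

lemma Q_if: "(b \<Longrightarrow> f \<in> Q) \<Longrightarrow> (\<not> b \<Longrightarrow> g \<in> Q) \<Longrightarrow> (\<lambda>x. if b then f x else g x) \<in> Q"
  by (cases b) auto

lemma Q_det:
  assumes "\<And>a b. (\<lambda>x. M x $ a $ b) \<in> Q"
  shows "(\<lambda>x. det (M x :: 'k^'n^'n)) \<in> Q"
  unfolding det_def by (intro Q_sum Q_mult Q_const Q_prod assms)

end

lemmas (in function_algebra) Q_intros =
  Q_const Q_add Q_mult Q_uminus Q_diff Q_sum Q_prod Q_power Q_if Q_det

lemma alg_subalgebra: "subalgebra (alg Z)"
  by (auto simp: subalgebra_def intro: alg.intros)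

lemma alg_subset: "subalgebra Q \<Longrightarrow> Z \<subseteq> Q \<Longrightarrow> alg Z \<subseteq> Q"
proof
  fix f assume "subalgebra Q" "Z \<subseteq> Q" "f \<in> alg Z"
  from this(3,1,2) show "f \<in> Q" by induction (auto simp: subalgebra_def)
qed

text \<open>
  Exponent lists are always as long as the list of generators; \<open>hd\<close> and \<open>tl\<close> only keep the recursion
  primitive in the latter.
\<close>
primrec monomial :: "('x \<Rightarrow> 'k::field) list \<Rightarrow> nat list \<Rightarrow> 'x \<Rightarrow> 'k" where
  "monomial [] es x = 1"
| "monomial (z # zs) es x = z x ^ hd es * monomial zs (tl es) x"

definition exponents :: "nat \<Rightarrow> nat \<Rightarrow> nat list set" where
  "exponents n N = {es. set es \<subseteq> {..<N} \<and> length es = n}"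

lemma finite_exponents [simp]: "finite (exponents n N)" and card_exponents: "card (exponents n N) = N ^ n"
  unfolding exponents_def by (auto simp: finite_lists_length_eq card_lists_length_eq)

lemma exponents_0: "exponents 0 N = {[]}" by (auto simp: exponents_def)

lemma sum_exponents_Suc: "(\<Sum>es\<in>exponents (Suc n) N. F es) = (\<Sum>e<N. \<Sum>es\<in>exponents n N. F (e # es))"
proof -
  have "exponents (Suc n) N = (\<lambda>(e, es). e # es) ` ({..<N} \<times> exponents n N)"
    by (auto simp: exponents_def length_Suc_conv image_iff)
  moreover have "inj_on (\<lambda>(e, es). e # es) ({..<N} \<times> exponents n N)"
    by (auto simp: inj_on_def)
  ultimately have "(\<Sum>es\<in>exponents (Suc n) N. F es) = (\<Sum>(e, es)\<in>{..<N} \<times> exponents n N. F (e # es))"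
    by (subst \<open>exponents (Suc n) N = _\<close>, subst sum.reindex) (auto intro: sum.cong)
  then show ?thesis by (simp add: sum.cartesian_product)
qed

lemma prime_inD:
  assumes "prime_in Q P"
  shows "P \<subseteq> Q" "(\<lambda>x. 0) \<in> P" "(\<lambda>x. 1) \<notin> P"
    "\<And>f g. f \<in> P \<Longrightarrow> g \<in> P \<Longrightarrow> (\<lambda>x. f x + g x) \<in> P"
    "\<And>f g. f \<in> Q \<Longrightarrow> g \<in> P \<Longrightarrow> (\<lambda>x. f x * g x) \<in> P"
    "\<And>f g. f \<in> Q \<Longrightarrow> g \<in> Q \<Longrightarrow> (\<lambda>x. f x * g x) \<in> P \<Longrightarrow> f \<in> P \<or> g \<in> P"
  using assms by (auto simp: prime_in_def)

context function_algebra begin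

lemma prime_uminus: "prime_in Q P \<Longrightarrow> f \<in> P \<Longrightarrow> (\<lambda>x. - f x) \<in> P"
  using prime_inD(5)[of Q P "\<lambda>x. -1" f] Q_const by simp

lemma prime_diff: "prime_in Q P \<Longrightarrow> f \<in> P \<Longrightarrow> g \<in> P \<Longrightarrow> (\<lambda>x. f x - g x) \<in> P"
  using prime_inD(4)[of Q P f "\<lambda>x. - g x"] prime_uminus by simp

lemma prime_sum: "prime_in Q P \<Longrightarrow> (\<And>i. i \<in> I \<Longrightarrow> f i \<in> P) \<Longrightarrow> (\<lambda>x. \<Sum>i\<in>I. f i x) \<in> P"
  by (induction I rule: infinite_finite_induct) (auto intro: prime_inD)

lemma prime_power: "prime_in Q P \<Longrightarrow> f \<in> Q \<Longrightarrow> f \<notin> P \<Longrightarrow> (\<lambda>x. f x ^ n) \<notin> P"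
proof (induction n)
  case (Suc n)
  then show ?case using prime_inD(6)[of Q P f "\<lambda>x. f x ^ n"] Q_power[of f n] by auto
qed (auto dest: prime_inD)

lemma prime_const:
  assumes "prime_in Q P" and "(\<lambda>x. a) \<in> P"
  shows "a = 0"
proof (rule ccontr)
  assume "a \<noteq> 0"
  moreover have "(\<lambda>x. inverse a * a) \<in> P" using prime_inD(5)[OF assms(1) Q_const assms(2)] .
  ultimately show False using prime_inD(3)[OF assms(1)] by simp
qed

lemma monomial_in: "set zs \<subseteq> Q \<Longrightarrow> monomial zs es \<in> Q"
proof (induction zs arbitrary: es)
  case Nil
  then show ?case using Q_const[of 1] by (simp add: fun_eq_iff[of "monomial [] es" "\<lambda>x. 1", simplified])
next
  case (Cons z zs)
  then have "(\<lambda>x. z x ^ hd es * monomial zs (tl es) x) \<in> Q" by (intro Q_intros) auto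
  then show ?case by (simp add: fun_eq_iff[of "monomial (z # zs) es", simplified])
qed

text \<open>
  Since \<open>a\<close> lies in the larger prime, so does the constant coefficient \<open>g 0\<close>, which therefore vanishes.
  As \<open>a\<close> is not in the smaller prime it can be cancelled there, which lowers the degree.
\<close>
lemma horner_in_prime:
  assumes P: "prime_in Q P" and P': "prime_in Q P'" "P \<subseteq> P'"
    and a: "a \<in> P'" "a \<notin> P"
    and g: "\<And>e. e < N \<Longrightarrow> g e \<in> Q" and sum: "(\<lambda>x. \<Sum>e<N. a x ^ e * g e x) \<in> P"
    and null: "\<And>e. e < N \<Longrightarrow> g e \<in> P' \<Longrightarrow> g e = (\<lambda>x. 0)"
  shows "\<forall>e<N. g e = (\<lambda>x. 0)"
  using g sum null
proof (induction N arbitrary: g)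
  case (Suc N)
  have aQ: "a \<in> Q" using a P' by (auto simp: prime_in_def)
  define h where "h = (\<lambda>x. \<Sum>e<N. a x ^ e * g (Suc e) x)"
  have hQ: "h \<in> Q" unfolding h_def using aQ Suc.prems(1) by (intro Q_intros) auto
  have eq: "(\<Sum>e<Suc N. a x ^ e * g e x) = g 0 x + a x * h x" for x
    unfolding h_def by (subst sum.lessThan_Suc_shift) (simp add: sum_distrib_left mult.assoc)
  have in_P: "(\<lambda>x. g 0 x + a x * h x) \<in> P" using Suc.prems(2) unfolding eq .
  have "(\<lambda>x. a x * h x) \<in> P'"
    using prime_inD(5)[OF P'(1) hQ a(1)] by (simp add: mult.commute)
  then have "(\<lambda>x. (g 0 x + a x * h x) - a x * h x) \<in> P'"
    using in_P P' by (intro prime_diff) auto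
  then have "g 0 \<in> P'" by simp
  then have g0: "g 0 = (\<lambda>x. 0)" using Suc.prems(3)[of 0] by simp
  then have "(\<lambda>x. a x * h x) \<in> P" using in_P by simp
  then have "h \<in> P" using prime_inD(6)[OF P aQ hQ] a by blast
  then have "\<forall>e<N. g (Suc e) = (\<lambda>x. 0)"
    using Suc.prems unfolding h_def by (intro Suc.IH) auto
  then show ?case using g0 by (metis less_Suc_eq_0_disj)
qed simp

text \<open>
  A polynomial relation modulo the bottom prime, read as a polynomial in the element of the first
  step, has coefficients in the elements of the higher steps; by Horner's scheme these coefficients
  are relations modulo the second prime.
\<close>
lemma chain_algebraically_independent:
  assumes "\<And>i. i \<le> length as \<Longrightarrow> prime_in Q (P i)" and "\<And>i. i < length as \<Longrightarrow> P i \<subseteq> P (Suc i)"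
    and "\<And>i. i < length as \<Longrightarrow> as ! i \<in> P (Suc i) - P i"
    and "(\<lambda>x. \<Sum>es\<in>exponents (length as) N. c es * monomial as es x) \<in> P 0"
  shows "\<forall>es\<in>exponents (length as) N. c es = 0"
  using assms
proof (induction as arbitrary: P c)
  case Nil
  then have "(\<lambda>x. c []) \<in> P 0" by (simp add: exponents_0)
  then show ?case using prime_const Nil.prems(1)[of 0] by (auto simp: exponents_0)
next
  case (Cons a as)
  let ?n = "length as"
  define g where "g e = (\<lambda>x. \<Sum>es\<in>exponents ?n N. c (e # es) * monomial as es x)" for e
  have asQ: "set as \<subseteq> Q"
  proof
    fix y assume "y \<in> set as"
    then obtain i where i: "i < ?n" "y = as ! i" by (auto simp: in_set_conv_nth)
    then show "y \<in> Q" using Cons.prems(3)[of "Suc i"] Cons.prems(1)[of "Suc (Suc i)"]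
      by (auto simp: prime_in_def)
  qed
  have gQ: "g e \<in> Q" for e unfolding g_def using asQ by (intro Q_intros monomial_in)
  have IH: "\<forall>es\<in>exponents ?n N. c (e # es) = 0" if "g e \<in> P (Suc 0)" for e
  proof (rule Cons.IH[of "\<lambda>i. P (Suc i)" "\<lambda>es. c (e # es)"])
    show "as ! i \<in> P (Suc (Suc i)) - P (Suc i)" if "i < ?n" for i
      using Cons.prems(3)[of "Suc i"] that by simp
  qed (use Cons.prems that g_def in auto)
  have "\<forall>e<N. g e = (\<lambda>x. 0)"
  proof (rule horner_in_prime[of "P 0" "P (Suc 0)" a])
    show "g e = (\<lambda>x. 0)" if "g e \<in> P (Suc 0)" for e
      using IH[OF that] by (simp add: g_def)
    have "(\<Sum>es\<in>exponents (length (a # as)) N. c es * monomial (a # as) es x) = (\<Sum>e<N. a x ^ e * g e x)" for x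
      by (simp add: sum_exponents_Suc g_def sum_distrib_left mult_ac)
    then show "(\<lambda>x. \<Sum>e<N. a x ^ e * g e x) \<in> P 0" using Cons.prems(4) by simp
  qed (use Cons.prems(1)[of 0] Cons.prems(1)[of "Suc 0"] Cons.prems(2)[of 0] Cons.prems(3)[of 0] gQ in auto)
  then have "\<forall>es\<in>exponents ?n N. c (e # es) = 0" if "e < N" for e
    using that IH[of e] prime_inD(2) Cons.prems(1)[of "Suc 0"] by auto
  then show ?case by (auto simp: exponents_def length_Suc_conv)
qed

lemma prime_cong_mult:
  assumes P: "prime_in Q P" and Q: "f \<in> Q" "h' \<in> Q"
    and "(\<lambda>x. f x - f' x) \<in> P" "(\<lambda>x. h x - h' x) \<in> P"
  shows "(\<lambda>x. f x * h x - f' x * h' x) \<in> P"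
proof -
  have "(\<lambda>x. f x * (h x - h' x) + h' x * (f x - f' x)) \<in> P"
    using assms by (intro prime_inD(4)[OF P] prime_inD(5)[OF P]) auto
  then show ?thesis by (simp add: algebra_simps)
qed

lemma prime_cong_power:
  assumes P: "prime_in Q P" and Q: "f \<in> Q" "f' \<in> Q" and "(\<lambda>x. f x - f' x) \<in> P"
  shows "(\<lambda>x. f x ^ n - f' x ^ n) \<in> P"
proof (induction n)
  case (Suc n)
  then show ?case using prime_cong_mult[OF P, of f "\<lambda>x. f' x ^ n" f' "\<lambda>x. f x ^ n"] assms Q_power
    by simp
qed (simp add: prime_inD[OF P])

end

definition monomial_span :: "('x \<Rightarrow> 'k::field) list \<Rightarrow> nat \<Rightarrow> ('x \<Rightarrow> 'k) set" where
  "monomial_span zs D = range (\<lambda>c x. \<Sum>es\<in>exponents (length zs) (Suc D). c es * monomial zs es x)"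

lemma monomial_span_add: "f \<in> monomial_span zs D \<Longrightarrow> g \<in> monomial_span zs D \<Longrightarrow> (\<lambda>x. f x + g x) \<in> monomial_span zs D"
proof -
  assume "f \<in> monomial_span zs D" "g \<in> monomial_span zs D"
  then obtain c d where "f = (\<lambda>x. \<Sum>es\<in>exponents (length zs) (Suc D). c es * monomial zs es x)"
      "g = (\<lambda>x. \<Sum>es\<in>exponents (length zs) (Suc D). d es * monomial zs es x)"
    by (auto simp: monomial_span_def)
  then have "(\<lambda>x. f x + g x) = (\<lambda>x. \<Sum>es\<in>exponents (length zs) (Suc D). (c es + d es) * monomial zs es x)"
    by (simp add: distrib_right sum.distrib)
  then show ?thesis unfolding monomial_span_def by - (rule range_eqI)
qed

lemma monomial_span_scale: "f \<in> monomial_span zs D \<Longrightarrow> (\<lambda>x. a * f x) \<in> monomial_span zs D"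
proof -
  assume "f \<in> monomial_span zs D"
  then obtain c where "f = (\<lambda>x. \<Sum>es\<in>exponents (length zs) (Suc D). c es * monomial zs es x)"
    by (auto simp: monomial_span_def)
  then have "(\<lambda>x. a * f x) = (\<lambda>x. \<Sum>es\<in>exponents (length zs) (Suc D). (a * c es) * monomial zs es x)"
    by (simp add: sum_distrib_left mult.assoc)
  then show ?thesis unfolding monomial_span_def by - (rule range_eqI)
qed

lemma monomial_span_zero: "(\<lambda>x. 0) \<in> monomial_span zs D"
proof -
  have "(\<lambda>x. 0) = (\<lambda>x. \<Sum>es\<in>exponents (length zs) (Suc D). 0 * monomial zs es x)" by simp
  then show ?thesis unfolding monomial_span_def by - (rule range_eqI)
qed

lemma monomial_span_sum: "(\<And>i. i \<in> I \<Longrightarrow> f i \<in> monomial_span zs D) \<Longrightarrow> (\<lambda>x. \<Sum>i\<in>I. f i x) \<in> monomial_span zs D"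
  by (induction I rule: infinite_finite_induct) (auto intro: monomial_span_zero monomial_span_add)

lemma monomial_span_monomial: "es \<in> exponents (length zs) (Suc D) \<Longrightarrow> monomial zs es \<in> monomial_span zs D"
proof -
  assume "es \<in> exponents (length zs) (Suc D)"
  then have "monomial zs es =
      (\<lambda>x. \<Sum>ds\<in>exponents (length zs) (Suc D). (if ds = es then 1 else 0) * monomial zs ds x)"
    by (simp add: fun_eq_iff mult_delta_left sum.delta)
  then show ?thesis unfolding monomial_span_def by - (rule range_eqI)
qed

lemma monomial_span_mono: "D \<le> D' \<Longrightarrow> f \<in> monomial_span zs D \<Longrightarrow> f \<in> monomial_span zs D'"
proof -
  assume "D \<le> D'" "f \<in> monomial_span zs D"
  then obtain c where c: "f = (\<lambda>x. \<Sum>es\<in>exponents (length zs) (Suc D). c es * monomial zs es x)"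
    by (auto simp: monomial_span_def)
  show ?thesis unfolding c using \<open>D \<le> D'\<close>
    by (intro monomial_span_sum monomial_span_scale monomial_span_monomial) (force simp: exponents_def)
qed

lemma monomial_mult:
  "length es = length zs \<Longrightarrow> length ds = length zs \<Longrightarrow>
    monomial zs es x * monomial zs ds x = monomial zs (map2 (+) es ds) x"
proof (induction zs arbitrary: es ds)
  case (Cons z zs)
  obtain e es' where es: "es = e # es'" using Cons.prems(1) by (cases es) auto
  obtain d ds' where ds: "ds = d # ds'" using Cons.prems(2) by (cases ds) auto
  have IH: "monomial zs (map2 (+) es' ds') x = monomial zs es' x * monomial zs ds' x"
    using Cons.IH[of es' ds'] Cons.prems es ds by simp
  show ?case by (simp add: es ds IH power_add mult_ac)
qed simp

lemma monomial_span_mult: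
  assumes "f \<in> monomial_span zs D" "g \<in> monomial_span zs D'"
  shows "(\<lambda>x. f x * g x) \<in> monomial_span zs (D + D')"
proof -
  obtain c d where c: "f = (\<lambda>x. \<Sum>es\<in>exponents (length zs) (Suc D). c es * monomial zs es x)"
     and d: "g = (\<lambda>x. \<Sum>es\<in>exponents (length zs) (Suc D'). d es * monomial zs es x)"
    using assms by (auto simp: monomial_span_def)
  have "(\<lambda>x. f x * g x) = (\<lambda>x. \<Sum>es\<in>exponents (length zs) (Suc D). \<Sum>ds\<in>exponents (length zs) (Suc D').
      c es * (d ds * monomial zs (map2 (+) es ds) x))"
    unfolding c d sum_product
  proof (intro ext sum.cong refl)
    fix x es ds assume "es \<in> exponents (length zs) (Suc D)" "ds \<in> exponents (length zs) (Suc D')"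
    then have "monomial zs (map2 (+) es ds) x = monomial zs es x * monomial zs ds x"
      by (simp add: monomial_mult exponents_def)
    then show "c es * monomial zs es x * (d ds * monomial zs ds x) =
        c es * (d ds * monomial zs (map2 (+) es ds) x)"
      by (simp add: mult_ac)
  qed
  also have "\<dots> \<in> monomial_span zs (D + D')"
  proof (intro monomial_span_sum monomial_span_scale monomial_span_monomial)
    fix es ds assume *: "es \<in> exponents (length zs) (Suc D)" "ds \<in> exponents (length zs) (Suc D')"
    have "e + d < Suc (D + D')" if "(e, d) \<in> set (zip es ds)" for e d
      using * set_zip_leftD[OF that] set_zip_rightD[OF that] by (fastforce simp: exponents_def)
    then show "map2 (+) es ds \<in> exponents (length zs) (Suc (D + D'))"
      using * by (auto simp: exponents_def)
  qed
  finally show ?thesis .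
qed

lemma monomial_span_const: "(\<lambda>x. a) \<in> monomial_span zs D"
proof -
  have "monomial zs (replicate (length zs) 0) x = 1" for x :: 'a by (induction zs) auto
  then have "(\<lambda>x. a) = (\<lambda>x. a * monomial zs (replicate (length zs) 0) x)" by simp
  also have "\<dots> \<in> monomial_span zs D" by (intro monomial_span_scale monomial_span_monomial) (auto simp: exponents_def)
  finally show ?thesis .
qed

lemma monomial_span_power: "f \<in> monomial_span zs D \<Longrightarrow> (\<lambda>x. f x ^ n) \<in> monomial_span zs (n * D)"
proof (induction n)
  case (Suc n)
  then show ?case using monomial_span_mult[of f zs D "\<lambda>x. f x ^ n" "n * D"] by simp
qed (simp add: monomial_span_const)

lemma monomial_span_gen: "z \<in> set zs \<Longrightarrow> z \<in> monomial_span zs 1"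
proof -
  have *: "monomial ys (replicate (length ys) 0) x = 1" for x and ys :: "('a \<Rightarrow> 'b) list"
    by (induction ys) auto
  assume "z \<in> set zs"
  then have "\<exists>es\<in>exponents (length zs) (Suc 1). monomial zs es = z"
  proof (induction zs)
    case (Cons y ys)
    show ?case
    proof (cases "z = y")
      case True
      then show ?thesis
        by (intro bexI[of _ "1 # replicate (length ys) 0"]) (auto simp: fun_eq_iff * exponents_def)
    next
      case False
      then obtain es where "es \<in> exponents (length ys) (Suc 1)" "monomial ys es = z" using Cons by auto
      then show ?thesis by (intro bexI[of _ "0 # es"]) (auto simp: fun_eq_iff exponents_def)
    qed
  qed simp
  then show ?thesis using monomial_span_monomial by blast
qed

lemma alg_monomial_span: "f \<in> alg (set zs) \<Longrightarrow> \<exists>D. f \<in> monomial_span zs D"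
proof (induction rule: alg.induct)
  case (add f g)
  then obtain D D' where "f \<in> monomial_span zs D" "g \<in> monomial_span zs D'" by auto
  then have "f \<in> monomial_span zs (D + D')" "g \<in> monomial_span zs (D + D')" by (auto intro: monomial_span_mono[rotated])
  then show ?case using monomial_span_add by blast
next
  case (mult f g)
  then obtain D D' where "f \<in> monomial_span zs D" "g \<in> monomial_span zs D'" by auto
  then show ?case using monomial_span_mult by blast
next
  case (const a)
  then show ?case using monomial_span_const by blast
next
  case (gen f)
  then show ?case using monomial_span_gen by blast
qed

context function_algebra begin

lemma common_denominator:
  assumes P: "prime_in Q P" and Z: "Z \<subseteq> Q" and "set as \<subseteq> Q"
    and "\<And>f. f \<in> Q \<Longrightarrow> \<exists>q\<in>alg Z - P. \<exists>g\<in>alg Z. (\<lambda>x. q x * f x - g x) \<in> P"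
  shows "\<exists>q\<in>alg Z - P. \<forall>a\<in>set as. \<exists>g\<in>alg Z. (\<lambda>x. q x * a x - g x) \<in> P"
  using assms(3)
proof (induction as)
  case Nil
  then show ?case using prime_inD(3)[OF P] alg.const[of 1 Z] by auto
next
  case (Cons a as)
  have sub: "alg Z \<subseteq> Q" by (rule alg_subset[OF Q Z])
  obtain q where q: "q \<in> alg Z - P" "\<forall>a\<in>set as. \<exists>g\<in>alg Z. (\<lambda>x. q x * a x - g x) \<in> P"
    using Cons by auto
  obtain p h where p: "p \<in> alg Z - P" "h \<in> alg Z" "(\<lambda>x. p x * a x - h x) \<in> P"
    using assms(4)[of a] Cons.prems by auto
  have "(\<lambda>x. p x * q x) \<in> alg Z - P"
    using p q sub prime_inD(6)[OF P, of p q] by (auto intro: alg.mult)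
  moreover have "\<exists>g\<in>alg Z. (\<lambda>x. (p x * q x) * b x - g x) \<in> P" if b: "b \<in> set (a # as)" for b
  proof (cases "b = a")
    case True
    have "(\<lambda>x. q x * (p x * a x - h x)) \<in> P" using p q sub by (intro prime_inD(5)[OF P]) auto
    then show ?thesis using p q True
      by (intro bexI[of _ "\<lambda>x. q x * h x"] alg.mult) (auto simp: algebra_simps)
  next
    case False
    then obtain g where g: "g \<in> alg Z" "(\<lambda>x. q x * b x - g x) \<in> P"
      using q(2) b by auto
    have "(\<lambda>x. p x * (q x * b x - g x)) \<in> P" using p g sub by (intro prime_inD(5)[OF P]) auto
    then show ?thesis using p g
      by (intro bexI[of _ "\<lambda>x. p x * g x"] alg.mult) (auto simp: algebra_simps)
  qed
  ultimately show ?case by (intro bexI[of _ "\<lambda>x. p x * q x"]) auto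
qed

text \<open>
  With a common denominator \<open>q\<close>, all monomials with exponents below \<open>N\<close> become polynomials in the
  generators whose degrees grow only linearly in \<open>N\<close>. This is what makes the count below work.
\<close>
lemma cleared_monomial:
  assumes P: "prime_in Q P" and q: "q \<in> Q" "q \<in> monomial_span zs D" and zs: "set zs \<subseteq> Q"
    and as: "\<And>a. a \<in> set as \<Longrightarrow> a \<in> Q \<and> (\<exists>g\<in>Q. g \<in> monomial_span zs D \<and> (\<lambda>x. q x * a x - g x) \<in> P)"
    and es: "es \<in> exponents (length as) N"
  shows "\<exists>v\<in>Q. v \<in> monomial_span zs (length as * (N * D)) \<and>
    (\<lambda>x. q x ^ (length as * N) * monomial as es x - v x) \<in> P"
  using as es
proof (induction as arbitrary: es)
  case Nil
  then show ?case
    by (intro bexI[of _ "\<lambda>x. 1"]) (auto simp: monomial_span_const Q_const prime_inD[OF P])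
next
  case (Cons a as)
  obtain e es' where es: "es = e # es'" "e < N" "es' \<in> exponents (length as) N"
    using Cons.prems(2) by (auto simp: exponents_def length_Suc_conv)
  obtain v where v: "v \<in> Q" "v \<in> monomial_span zs (length as * (N * D))"
      "(\<lambda>x. q x ^ (length as * N) * monomial as es' x - v x) \<in> P"
    using Cons.IH[of es'] Cons.prems es by auto
  obtain g where g: "g \<in> Q" "g \<in> monomial_span zs D" "(\<lambda>x. q x * a x - g x) \<in> P"
    using Cons.prems by auto
  have aQ: "a \<in> Q" using Cons.prems by auto
  define u where "u = (\<lambda>x. q x ^ (N - e) * g x ^ e)"
  have u: "u \<in> Q" unfolding u_def using q g by (intro Q_intros)
  have uspan: "u \<in> monomial_span zs (N * D)"
    unfolding u_def using monomial_span_mult[OF monomial_span_power[OF q(2), of "N - e"] monomial_span_power[OF g(2), of e]] es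
    by (simp flip: add_mult_distrib)
  have "(\<lambda>x. (q x * a x) ^ e - g x ^ e) \<in> P"
    using q g aQ by (intro prime_cong_power[OF P] Q_intros)
  then have "(\<lambda>x. q x ^ (N - e) * ((q x * a x) ^ e - g x ^ e)) \<in> P"
    using q by (intro prime_inD(5)[OF P] Q_intros)
  moreover have "q x ^ (N - e) * ((q x * a x) ^ e - g x ^ e) = q x ^ N * a x ^ e - u x" for x
  proof -
    have "q x ^ (N - e) * (q x * a x) ^ e = q x ^ (N - e + e) * a x ^ e"
      by (simp add: power_add power_mult_distrib)
    then show ?thesis using es by (simp add: u_def right_diff_distrib)
  qed
  ultimately have "(\<lambda>x. q x ^ N * a x ^ e - u x) \<in> P" by simp
  then have "(\<lambda>x. (q x ^ N * a x ^ e) * (q x ^ (length as * N) * monomial as es' x) - u x * v x) \<in> P"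
    using q aQ v by (intro prime_cong_mult[OF P] Q_intros) auto
  then have "(\<lambda>x. q x ^ (length (a # as) * N) * monomial (a # as) es x - u x * v x) \<in> P"
    by (simp add: es power_add mult_ac)
  then show ?case using Q_mult[OF u v(1)] monomial_span_mult[OF uspan v(2)] by auto
qed

text \<open>
  A chain of length \<open>n\<close> gives \<open>N\<^sup>n\<close> linearly independent monomials with exponents below \<open>N\<close>. After
  clearing denominators they lie in a space spanned by \<open>(K + 1)\<^sup>m\<close> monomials, where \<open>m\<close> is the number of
  generators and \<open>K\<close> is linear in \<open>N\<close>. For \<open>m < n\<close> and large \<open>N\<close> this is impossible.
\<close>
theorem prime_chain_bound:
  assumes P: "\<And>i. i \<le> n \<Longrightarrow> prime_in Q (P i)" "\<And>i. i < n \<Longrightarrow> P i \<subset> P (Suc i)"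
    and Z: "finite Z" "Z \<subseteq> Q"
    and rat: "\<And>f. f \<in> Q \<Longrightarrow> \<exists>q\<in>alg Z - P 0. \<exists>g\<in>alg Z. (\<lambda>x. q x * f x - g x) \<in> P 0"
  shows "n \<le> card Z"
proof (rule ccontr)
  assume "\<not> n \<le> card Z"
  obtain zs where zs: "set zs = Z" "length zs = card Z"
    using Z distinct_card finite_distinct_list by metis
  let ?m = "length zs"
  have mn: "?m < n" using zs \<open>\<not> n \<le> card Z\<close> by simp
  have P0: "prime_in Q (P 0)" using P by simp
  have sub: "alg Z \<subseteq> Q" by (rule alg_subset[OF Q Z(2)])
  have "\<forall>i<n. \<exists>a. a \<in> P (Suc i) - P i" using P(2) by blast
  then obtain a where a: "\<And>i. i < n \<Longrightarrow> a i \<in> P (Suc i) - P i" by metis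
  define as where "as = map a [0..<n]"
  have as_nth: "as ! i = a i" if "i < n" for i using that by (simp add: as_def)
  have as_len: "length as = n" by (simp add: as_def)
  have asQ: "set as \<subseteq> Q"
  proof
    fix b assume "b \<in> set as"
    then obtain i where "i < n" "b = a i" by (auto simp: as_def)
    then show "b \<in> Q" using a[of i] prime_inD(1)[OF P(1)[of "Suc i"]] by auto
  qed
  obtain q where q: "q \<in> alg Z" "q \<notin> P 0"
      "\<forall>a\<in>set as. \<exists>g\<in>alg Z. (\<lambda>x. q x * a x - g x) \<in> P 0"
    using common_denominator[OF P0 Z(2) asQ rat] by (auto simp: Bex_def)
  then obtain g where g: "\<And>a. a \<in> set as \<Longrightarrow> g a \<in> alg Z"
      "\<And>a. a \<in> set as \<Longrightarrow> (\<lambda>x. q x * a x - g a x) \<in> P 0" by metis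
  obtain deg where deg: "\<And>f. f \<in> alg Z \<Longrightarrow> f \<in> monomial_span zs (deg f)"
    using alg_monomial_span[of _ zs] zs by metis
  define D where "D = deg q + (\<Sum>a\<in>set as. deg (g a))"
  have qD: "q \<in> monomial_span zs D" using deg[OF q(1)] by (rule monomial_span_mono[rotated]) (simp add: D_def)
  have gD: "g b \<in> monomial_span zs D" if "b \<in> set as" for b
  proof -
    have "deg (g b) \<le> (\<Sum>a\<in>set as. deg (g a))" using that by (intro member_le_sum) auto
    then show ?thesis using deg[OF g(1)[OF that]] by (auto simp: D_def intro: monomial_span_mono[rotated])
  qed
  \<comment> \<open>\<open>K + 1 \<le> N (n D + 1)\<close>, so \<open>N > (n D + 1)\<^sup>m\<close> forces \<open>(K + 1)\<^sup>m < N\<^sup>m\<^sup>+\<^sup>1\<close>.\<close>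
  define N where "N = Suc ((n * D + 1) ^ ?m)"
  define K where "K = n * (N * D)"
  have "\<exists>v\<in>Q. v \<in> monomial_span zs K \<and> (\<lambda>x. q x ^ (n * N) * monomial as es x - v x) \<in> P 0"
    if "es \<in> exponents n N" for es
  proof -
    have "\<exists>v\<in>Q. v \<in> monomial_span zs (length as * (N * D)) \<and>
        (\<lambda>x. q x ^ (length as * N) * monomial as es x - v x) \<in> P 0"
    proof (rule cleared_monomial[OF P0])
      show "a \<in> Q \<and> (\<exists>g\<in>Q. g \<in> monomial_span zs D \<and> (\<lambda>x. q x * a x - g x) \<in> P 0)"
        if "a \<in> set as" for a
        using g[OF that] gD[OF that] asQ sub that by (intro conjI bexI[of _ "g a"]) auto
    qed (use q(1) sub qD zs(1) Z(2) that as_len in auto)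
    then show ?thesis by (simp add: K_def as_len)
  qed
  then obtain v where v: "\<And>es. es \<in> exponents n N \<Longrightarrow> v es \<in> monomial_span zs K"
      "\<And>es. es \<in> exponents n N \<Longrightarrow> (\<lambda>x. q x ^ (n * N) * monomial as es x - v es x) \<in> P 0"
    by metis
  then have "\<forall>es. \<exists>c. es \<in> exponents n N \<longrightarrow> v es = (\<lambda>x. \<Sum>ds\<in>exponents ?m (Suc K). c ds * monomial zs ds x)"
    by (auto simp: monomial_span_def)
  then obtain M where M: "\<And>es. es \<in> exponents n N \<Longrightarrow>
      v es = (\<lambda>x. \<Sum>ds\<in>exponents ?m (Suc K). M es ds * monomial zs ds x)" by metis
  have "card (exponents ?m (Suc K)) < card (exponents n N)"
  proof -
    have "Suc K \<le> N * (n * D + 1)" by (simp add: K_def N_def algebra_simps)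
    then have "Suc K ^ ?m \<le> N ^ ?m * (n * D + 1) ^ ?m"
      using power_mono[of "Suc K" "N * (n * D + 1)" ?m] by (simp only: power_mult_distrib)
    also have "\<dots> < N ^ ?m * N" by (simp add: N_def)
    also have "\<dots> = N ^ Suc ?m" by simp
    also have "\<dots> \<le> N ^ n" using mn by (intro power_increasing) (auto simp: N_def)
    finally show ?thesis by (simp add: card_exponents)
  qed
  then obtain c where c: "\<exists>es\<in>exponents n N. c es \<noteq> 0"
      "\<forall>ds\<in>exponents ?m (Suc K). (\<Sum>es\<in>exponents n N. c es * M es ds) = 0"
    using nontrivial_linear_relation[of "exponents ?m (Suc K)" "exponents n N" M] by auto
  have null: "(\<Sum>es\<in>exponents n N. c es * v es x) = 0" for x
  proof -
    have "(\<Sum>es\<in>exponents n N. c es * v es x) =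
        (\<Sum>es\<in>exponents n N. \<Sum>ds\<in>exponents ?m (Suc K). c es * M es ds * monomial zs ds x)"
      by (intro sum.cong refl) (simp add: M sum_distrib_left mult.assoc)
    also have "\<dots> = (\<Sum>ds\<in>exponents ?m (Suc K). (\<Sum>es\<in>exponents n N. c es * M es ds) * monomial zs ds x)"
      by (subst sum.swap) (simp add: sum_distrib_right)
    finally show ?thesis using c(2) by simp
  qed
  define F where "F = (\<lambda>x. \<Sum>es\<in>exponents n N. c es * monomial as es x)"
  have FQ: "F \<in> Q" unfolding F_def using asQ by (intro Q_intros monomial_in)
  have "(\<lambda>x. \<Sum>es\<in>exponents n N. c es * (q x ^ (n * N) * monomial as es x - v es x)) \<in> P 0"
    using v by (intro prime_sum[OF P0] prime_inD(5)[OF P0] Q_const)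
  moreover have "(\<Sum>es\<in>exponents n N. c es * (q x ^ (n * N) * monomial as es x - v es x)) = q x ^ (n * N) * F x" for x
    using null[of x] by (simp add: right_diff_distrib sum_subtractf F_def sum_distrib_left mult_ac)
  ultimately have "(\<lambda>x. q x ^ (n * N) * F x) \<in> P 0" by simp
  moreover have "(\<lambda>x. q x ^ (n * N)) \<notin> P 0" using prime_power[OF P0] q sub by auto
  ultimately have "F \<in> P 0"
    using prime_inD(6)[OF P0 Q_power FQ, of q] q sub by auto
  then have "\<forall>es\<in>exponents (length as) N. c es = 0"
    unfolding F_def as_len[symmetric]
    by (rule chain_algebraically_independent[rotated -1]) (use P a as_len as_nth in auto)
  then show False using c(1) as_len by auto
qed

end

section \<open>Polynomials on ADHM data and the action of the general linear group\<close>

lemma infinite_UNIV_alg_closed: "infinite (UNIV :: 'k::alg_closed_field set)"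
proof
  assume fin: "finite (UNIV :: 'k set)"
  define p :: "'k poly" where "p = (\<Prod>a\<in>UNIV. [:- a, 1:])"
  have "degree p = card (UNIV :: 'k set)"
    unfolding p_def by (subst degree_prod_eq_sum_degree) auto
  then have "degree (p + 1) > 0"
    using fin by (subst degree_add_eq_left) (auto simp: card_gt_0_iff)
  then obtain x where "poly (p + 1) x = 0" using alg_closed_imp_poly_has_root by blast
  moreover have "poly p x = 0" using fin by (simp add: p_def poly_prod)
  ultimately show False by simp
qed

lemma poly_eq_0_of_infinite:
  fixes p q :: "'k::alg_closed_field poly"
  assumes "q \<noteq> 0" and "\<And>t. poly q t \<noteq> 0 \<Longrightarrow> poly p t = 0"
  shows "p = 0"
proof (rule ccontr)
  assume "p \<noteq> 0"
  then have "finite {t. poly (p * q) t = 0}" using assms(1) by (intro poly_roots_finite) auto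
  moreover have "{t. poly (p * q) t = 0} = UNIV" using assms(2) by auto
  ultimately show False using infinite_UNIV_alg_closed by metis
qed

lemma matrix_inv_cancel:
  fixes A :: "'k::field^'n^'n"
  assumes "invertible A"
  shows "A ** matrix_inv A = mat 1" and "matrix_inv A ** A = mat 1"
  using someI_ex[OF assms[unfolded invertible_def]] unfolding matrix_inv_def by auto

lemma invertible_matrix_inv: "invertible (A :: 'k::field^'n^'n) \<Longrightarrow> invertible (matrix_inv A)"
  using matrix_inv_cancel unfolding invertible_def by blast

lemma matrix_inv_eqI:
  fixes A :: "'k::field^'n^'n"
  assumes "B ** A = mat 1" shows "matrix_inv A = B"
proof -
  have "invertible A" using assms invertible_left_inverse by blast
  then have "B ** (A ** matrix_inv A) = B" by (simp add: matrix_inv_cancel)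
  then show ?thesis using assms by (simp add: matrix_mul_assoc)
qed

lemma matrix_inv_one: "matrix_inv (mat 1 :: 'k::field^'n^'n) = mat 1"
  by (rule matrix_inv_eqI) simp

lemma invertible_mat_1: "invertible (mat 1 :: 'k::field^'n^'n)"
  unfolding invertible_def by (rule exI[of _ "mat 1"]) simp

lemma matrix_inv_mult:
  fixes A B :: "'k::field^'n^'n"
  assumes "invertible A" "invertible B"
  shows "matrix_inv (A ** B) = matrix_inv B ** matrix_inv A"
proof (rule matrix_inv_eqI)
  have "matrix_inv B ** matrix_inv A ** (A ** B) = matrix_inv B ** (matrix_inv A ** A) ** B"
    by (simp add: matrix_mul_assoc)
  then show "matrix_inv B ** matrix_inv A ** (A ** B) = mat 1" by (simp add: assms matrix_inv_cancel)
qed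

lemma matrix_inv_inv: "invertible (A :: 'k::field^'n^'n) \<Longrightarrow> matrix_inv (matrix_inv A) = A"
  by (rule matrix_inv_eqI) (rule matrix_inv_cancel)

text \<open>
  Columns are replaced by basis vectors as in Cramer's rule; the entries are then determinants, hence
  visibly polynomial in the entries of the matrix.
\<close>
definition adjugate :: "'k::field^'n^'n \<Rightarrow> 'k^'n^'n" where
  "adjugate A = (\<chi> k j. det (\<chi> i l. if l = k then (if i = j then 1 else 0) else A $ i $ l))"

lemma det_mult_matrix_inv:
  fixes A :: "'k::field^'n^'n"
  assumes "det A \<noteq> 0"
  shows "det A * matrix_inv A $ k $ j = adjugate A $ k $ j"
proof -
  have inv: "invertible A" using assms by (simp add: invertible_det_nz)
  have "A *v (matrix_inv A *v axis j 1) = axis j 1"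
    by (simp add: matrix_vector_mul_assoc matrix_inv_cancel[OF inv])
  then have "matrix_inv A *v axis j 1 =
      (\<chi> k. det (\<chi> i l. if l = k then axis j 1 $ i else A $ i $ l) / det A)"
    by (simp only: cramer[OF assms])
  then have "(matrix_inv A *v axis j 1) $ k =
      det (\<chi> i l. if l = k then axis j 1 $ i else A $ i $ l) / det A"
    by simp
  moreover have "(matrix_inv A *v axis j 1) $ k = matrix_inv A $ k $ j"
    by (simp add: matrix_vector_mult_def axis_def if_distrib cong: if_cong)
  moreover have "(\<chi> i l. if l = k then axis j 1 $ i else A $ i $ l) =
      (\<chi> i l. if l = k then (if i = j then 1 else 0) else A $ i $ l)"
    by (auto simp: vec_eq_iff axis_def)
  ultimately show ?thesis using assms by (simp add: adjugate_def)
qed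

lemma (in function_algebra) Q_adjugate:
  assumes "\<And>a b. (\<lambda>x. M x $ a $ b) \<in> Q"
  shows "(\<lambda>x. adjugate (M x :: 'k^'n^'n) $ k $ j) \<in> Q"
  unfolding adjugate_def vec_lambda_beta
  by (rule Q_det) (use assms in \<open>auto intro!: Q_if Q_const\<close>)

lemma (in function_algebra) Q_matrix_mult:
  assumes "\<And>a b. (\<lambda>x. M x $ a $ b) \<in> Q" "\<And>a b. (\<lambda>x. N x $ a $ b) \<in> Q"
  shows "(\<lambda>x. ((M x :: 'k^'n^'m) ** N x) $ a $ b) \<in> Q"
  unfolding matrix_matrix_mult_def vec_lambda_beta by (intro Q_intros assms)

lemma polys_subalgebra: "subalgebra adhm_polys"
  by (auto simp: subalgebra_def intro: adhm_polys.intros)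

interpretation P: function_algebra adhm_polys
  by standard (rule polys_subalgebra)

lemma polys_compose:
  assumes "f \<in> adhm_polys" and "subalgebra Q" and "\<And>\<phi>. \<phi> \<in> adhm_coords \<Longrightarrow> (\<lambda>y. \<phi> (T y)) \<in> Q"
  shows "(\<lambda>y. f (T y)) \<in> Q"
  using assms(1)
proof induction
  case (const a)
  then show ?case using assms(2) by (simp add: subalgebra_def)
next
  case (coord f)
  then show ?case by (rule assms(3))
next
  case (add f g)
  then show ?case using assms(2) by (simp add: subalgebra_def)
next
  case (mult f g)
  then show ?case using assms(2) by (simp add: subalgebra_def)
qed

lemma coords_polys:
  "(\<lambda>x. fst (adhm_B1 x) $ a $ b) \<in> adhm_polys" "(\<lambda>x. snd (adhm_B1 x) $ a $ b) \<in> adhm_polys"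
  "(\<lambda>x. fst (adhm_B2 x) $ a $ b) \<in> adhm_polys" "(\<lambda>x. snd (adhm_B2 x) $ a $ b) \<in> adhm_polys"
  "(\<lambda>x. fst (adhm_i x) $ a $ c) \<in> adhm_polys" "(\<lambda>x. snd (adhm_i x) $ a $ c) \<in> adhm_polys"
  "(\<lambda>x. fst (adhm_j x) $ c $ b) \<in> adhm_polys" "(\<lambda>x. snd (adhm_j x) $ c $ b) \<in> adhm_polys"
  by (rule adhm_polys.coord, unfold adhm_coords_def, fast)+

lemma coords_compose:
  assumes "\<phi> \<in> adhm_coords"
    and "\<And>a b. (\<lambda>y. fst (adhm_B1 (T y)) $ a $ b) \<in> Q" "\<And>a b. (\<lambda>y. snd (adhm_B1 (T y)) $ a $ b) \<in> Q"
    "\<And>a b. (\<lambda>y. fst (adhm_B2 (T y)) $ a $ b) \<in> Q" "\<And>a b. (\<lambda>y. snd (adhm_B2 (T y)) $ a $ b) \<in> Q"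
    "\<And>a b. (\<lambda>y. fst (adhm_i (T y)) $ a $ b) \<in> Q" "\<And>a b. (\<lambda>y. snd (adhm_i (T y)) $ a $ b) \<in> Q"
    "\<And>a b. (\<lambda>y. fst (adhm_j (T y)) $ a $ b) \<in> Q" "\<And>a b. (\<lambda>y. snd (adhm_j (T y)) $ a $ b) \<in> Q"
  shows "(\<lambda>y. \<phi> (T y)) \<in> Q"
  using assms(1) unfolding adhm_coords_def by (safe; simp add: assms(2-))

definition moment_entries :: "(('k::field, 'v::finite, 'w::finite) adhm \<Rightarrow> 'k) set" where
  "moment_entries =
     (\<Union>a b. {\<lambda>x. fst (adhm_moment x) $ a $ b, \<lambda>x. fst (snd (adhm_moment x)) $ a $ b,
             \<lambda>x. snd (snd (adhm_moment x)) $ a $ b})"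

lemma moment_entries_polys: "moment_entries \<subseteq> adhm_polys"
proof -
  have "(\<lambda>x. fst (adhm_moment x) $ a $ b) \<in> adhm_polys" for a b
    unfolding adhm_moment_def sec_mult_def matrix_matrix_mult_def
    by (simp, intro P.Q_intros coords_polys)
  moreover have "(\<lambda>x. fst (snd (adhm_moment x)) $ a $ b) \<in> adhm_polys" for a b
    unfolding adhm_moment_def sec_mult_def matrix_matrix_mult_def
    by (simp, intro P.Q_intros coords_polys)
  moreover have "(\<lambda>x. snd (snd (adhm_moment x)) $ a $ b) \<in> adhm_polys" for a b
    unfolding adhm_moment_def sec_mult_def matrix_matrix_mult_def
    by (simp, intro P.Q_intros coords_polys)
  ultimately show ?thesis unfolding moment_entries_def by blast
qed

lemma poly_ring_cring: "cring (adhm_poly_ring :: (('k::field, 'v::finite, 'w::finite) adhm \<Rightarrow> 'k) ring)"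
proof (rule cringI)
  show "abelian_group (adhm_poly_ring :: (('k, 'v, 'w) adhm \<Rightarrow> 'k) ring)"
  proof (rule abelian_groupI)
    fix f :: "('k, 'v, 'w) adhm \<Rightarrow> 'k" assume "f \<in> carrier adhm_poly_ring"
    then show "\<exists>g\<in>carrier adhm_poly_ring. g \<oplus>\<^bsub>adhm_poly_ring\<^esub> f = \<zero>\<^bsub>adhm_poly_ring\<^esub>"
      using P.Q_uminus[of f]
      by (intro bexI[of _ "\<lambda>x. - f x"]) (auto simp: adhm_poly_ring_def)
  qed (auto simp: adhm_poly_ring_def P.Q_add P.Q_const add_ac)
  show "Group.comm_monoid (adhm_poly_ring :: (('k, 'v, 'w) adhm \<Rightarrow> 'k) ring)"
    by (rule comm_monoidI) (auto simp: adhm_poly_ring_def P.Q_mult P.Q_const mult_ac)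
qed (auto simp: adhm_poly_ring_def distrib_right)

definition ideal_of_polys :: "(('k::field, 'v::finite, 'w::finite) adhm \<Rightarrow> 'k) set \<Rightarrow> bool" where
  "ideal_of_polys J \<longleftrightarrow> J \<subseteq> adhm_polys \<and> (\<lambda>x. 0) \<in> J \<and>
     (\<forall>f\<in>J. \<forall>g\<in>J. (\<lambda>x. f x + g x) \<in> J) \<and> (\<forall>f\<in>adhm_polys. \<forall>g\<in>J. (\<lambda>x. f x * g x) \<in> J)"

lemma ideal_of_polysD:
  assumes "ideal_of_polys J"
  shows "f \<in> J \<Longrightarrow> f \<in> adhm_polys" "(\<lambda>x. 0) \<in> J"
    "f \<in> J \<Longrightarrow> g \<in> J \<Longrightarrow> (\<lambda>x. f x + g x) \<in> J"
    "f \<in> adhm_polys \<Longrightarrow> g \<in> J \<Longrightarrow> (\<lambda>x. f x * g x) \<in> J"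
    "g \<in> J \<Longrightarrow> f \<in> adhm_polys \<Longrightarrow> (\<lambda>x. g x * f x) \<in> J"
  using assms by (auto simp: ideal_of_polys_def mult.commute)

lemma ideal_of_polys_uminus: "ideal_of_polys J \<Longrightarrow> f \<in> J \<Longrightarrow> (\<lambda>x. - f x) \<in> J"
  using ideal_of_polysD(4)[of J "\<lambda>x. -1" f, OF _ P.Q_const] by simp

lemma ideal_of_polys_diff: "ideal_of_polys J \<Longrightarrow> f \<in> J \<Longrightarrow> g \<in> J \<Longrightarrow> (\<lambda>x. f x - g x) \<in> J"
  using ideal_of_polysD(3)[of J f "\<lambda>x. - g x"] ideal_of_polys_uminus[of J g] by simp

lemma ideal_of_polys_sum:
  "ideal_of_polys J \<Longrightarrow> (\<And>i. i \<in> I \<Longrightarrow> f i \<in> J) \<Longrightarrow> (\<lambda>x. \<Sum>i\<in>I. f i x) \<in> J"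
  by (induction I rule: infinite_finite_induct) (auto intro: ideal_of_polysD)

lemma ideal_of_polys_ideal:
  assumes "ideal_of_polys J" shows "ideal J adhm_poly_ring"
proof -
  interpret cring "adhm_poly_ring :: (('a, 'b, 'c) adhm \<Rightarrow> 'a) ring" by (rule poly_ring_cring)
  have neg: "inv\<^bsub>add_monoid adhm_poly_ring\<^esub> f = (\<lambda>x. - f x)" if "f \<in> adhm_polys"
    for f :: "('a, 'b, 'c) adhm \<Rightarrow> 'a"
  proof -
    have "\<ominus>\<^bsub>adhm_poly_ring\<^esub> f = (\<lambda>x. - f x)"
      by (rule minus_equality) (auto simp: adhm_poly_ring_def that P.Q_uminus)
    then show ?thesis by (simp only: a_inv_def)
  qed
  show ?thesis
  proof (rule idealI)
    show "ring (adhm_poly_ring :: (('a, 'b, 'c) adhm \<Rightarrow> 'a) ring)" by (rule ring_axioms)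
    show "subgroup J (add_monoid adhm_poly_ring)"
    proof (rule subgroup.intro)
      show "inv\<^bsub>add_monoid adhm_poly_ring\<^esub> f \<in> J" if "f \<in> J" for f
        unfolding neg[OF ideal_of_polysD(1)[OF assms that]] by (rule ideal_of_polys_uminus[OF assms that])
    qed (use ideal_of_polysD[OF assms] in \<open>auto simp: adhm_poly_ring_def\<close>)
  qed (use ideal_of_polysD[OF assms] in \<open>auto simp: adhm_poly_ring_def\<close>)
qed

lemma adhm_ideal_minimal:
  assumes "ideal_of_polys J" "moment_entries \<subseteq> J" shows "adhm_ideal \<subseteq> J"
proof -
  interpret cring "adhm_poly_ring :: (('a, 'b, 'c) adhm \<Rightarrow> 'a) ring" by (rule poly_ring_cring)
  show ?thesis unfolding adhm_ideal_def
    by (rule genideal_minimal[OF ideal_of_polys_ideal[OF assms(1)] assms(2)[unfolded moment_entries_def]])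
qed

lemma adhm_ideal: "ideal_of_polys (adhm_ideal :: (('k::field, 'v::finite, 'w::finite) adhm \<Rightarrow> 'k) set)"
  and moment_entries_ideal: "(moment_entries :: (('k, 'v, 'w) adhm \<Rightarrow> 'k) set) \<subseteq> adhm_ideal"
proof -
  interpret cring "adhm_poly_ring :: (('k, 'v, 'w) adhm \<Rightarrow> 'k) ring" by (rule poly_ring_cring)
  have sub: "(moment_entries :: (('k, 'v, 'w) adhm \<Rightarrow> 'k) set) \<subseteq> carrier adhm_poly_ring"
    using moment_entries_polys by (simp add: adhm_poly_ring_def)
  have eq: "(adhm_ideal :: (('k, 'v, 'w) adhm \<Rightarrow> 'k) set) = Idl\<^bsub>adhm_poly_ring\<^esub> moment_entries"
    unfolding adhm_ideal_def moment_entries_def ..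
  interpret I: ideal "adhm_ideal :: (('k, 'v, 'w) adhm \<Rightarrow> 'k) set" adhm_poly_ring
    unfolding eq by (rule genideal_ideal[OF sub])
  show "(moment_entries :: (('k, 'v, 'w) adhm \<Rightarrow> 'k) set) \<subseteq> adhm_ideal"
    unfolding eq by (rule genideal_self[OF sub])
  show "ideal_of_polys (adhm_ideal :: (('k, 'v, 'w) adhm \<Rightarrow> 'k) set)"
    using I.a_subset I.a_closed I.I_l_closed I.zero_closed
    by (auto simp: ideal_of_polys_def adhm_poly_ring_def)
qed

text \<open>
  This passage to points loses nilpotents. It is used only at points of lines through the base
  point that lie in the zero locus.
\<close>
lemma adhm_ideal_vanishes:
  fixes f :: "('k::field, 'v::finite, 'w::finite) adhm \<Rightarrow> 'k"
  assumes "f \<in> adhm_ideal" "adhm_moment x = 0"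
  shows "f x = 0"
proof -
  let ?J = "{f \<in> adhm_polys. \<forall>x. adhm_moment x = 0 \<longrightarrow> f x = 0} :: (('k, 'v, 'w) adhm \<Rightarrow> 'k) set"
  have "ideal_of_polys ?J"
    unfolding ideal_of_polys_def by (auto simp: P.Q_const intro: P.Q_add P.Q_mult)
  moreover have "moment_entries \<subseteq> ?J"
  proof
    fix f :: "('k, 'v, 'w) adhm \<Rightarrow> 'k" assume f: "f \<in> moment_entries"
    then have "\<forall>x. adhm_moment x = 0 \<longrightarrow> f x = 0" unfolding moment_entries_def by auto
    then show "f \<in> ?J" using f moment_entries_polys by blast
  qed
  ultimately have "adhm_ideal \<subseteq> ?J" by (rule adhm_ideal_minimal)
  then show ?thesis using assms by blast
qed

definition conjugate :: "'k::field^'n^'n \<Rightarrow> 'k^'n^'n \<Rightarrow> 'k^'n^'n" where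
  "conjugate g M = g ** M ** matrix_inv g"

lemma gl_act_simps [simp]:
  "adhm_B1 (gl_act g x) = (conjugate g (fst (adhm_B1 x)), conjugate g (snd (adhm_B1 x)))"
  "adhm_B2 (gl_act g x) = (conjugate g (fst (adhm_B2 x)), conjugate g (snd (adhm_B2 x)))"
  "adhm_i (gl_act g x) = (g ** fst (adhm_i x), g ** snd (adhm_i x))"
  "adhm_j (gl_act g x) = (fst (adhm_j x) ** matrix_inv g, snd (adhm_j x) ** matrix_inv g)"
  by (simp_all add: gl_act_def conjugate_def map_prod_def split_beta)

lemma matrix_diff_ldistrib: "(A :: 'k::field^'n^'m) ** (B - C) = A ** B - A ** C"
  by (simp add: vec_eq_iff matrix_matrix_mult_def right_diff_distrib sum_subtractf)

lemma matrix_diff_rdistrib: "(B - C) ** (A :: 'k::field^'n^'m) = B ** A - C ** A"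
  by (simp add: vec_eq_iff matrix_matrix_mult_def left_diff_distrib sum_subtractf)

lemma matrix_add_rdistrib': "(B + C) ** (A :: 'k::field^'n^'m) = B ** A + C ** A"
  by (simp add: vec_eq_iff matrix_matrix_mult_def distrib_right sum.distrib)

lemma conjugate_add: "conjugate g (M + N) = conjugate g M + conjugate g N"
  and conjugate_diff: "conjugate g (M - N) = conjugate g M - conjugate g N"
  by (simp_all add: conjugate_def matrix_add_ldistrib matrix_add_rdistrib' matrix_diff_ldistrib
      matrix_diff_rdistrib)

lemma conjugate_mult: "invertible g \<Longrightarrow> conjugate g M ** conjugate g N = conjugate g (M ** N)"
proof -
  assume g: "invertible g"
  have "conjugate g M ** conjugate g N = g ** M ** (matrix_inv g ** g) ** N ** matrix_inv g"
    by (simp add: conjugate_def matrix_mul_assoc)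
  then show ?thesis by (simp add: conjugate_def matrix_inv_cancel[OF g] matrix_mul_assoc)
qed

lemma conjugate_mixed: "(g ** I) ** (J ** matrix_inv g) = conjugate g (I ** J)"
  by (simp add: conjugate_def matrix_mul_assoc)

lemma adhm_moment_simps:
  "fst (adhm_moment x) = fst (adhm_B1 x) ** fst (adhm_B2 x) - fst (adhm_B2 x) ** fst (adhm_B1 x)
     + fst (adhm_i x) ** fst (adhm_j x)"
  "fst (snd (adhm_moment x)) = fst (adhm_B1 x) ** snd (adhm_B2 x) + snd (adhm_B1 x) ** fst (adhm_B2 x)
     - (fst (adhm_B2 x) ** snd (adhm_B1 x) + snd (adhm_B2 x) ** fst (adhm_B1 x))
     + (fst (adhm_i x) ** snd (adhm_j x) + snd (adhm_i x) ** fst (adhm_j x))"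
  "snd (snd (adhm_moment x)) = snd (adhm_B1 x) ** snd (adhm_B2 x) - snd (adhm_B2 x) ** snd (adhm_B1 x)
     + snd (adhm_i x) ** snd (adhm_j x)"
  by (simp_all add: adhm_moment_def sec_mult_def)

lemma moment_gl_act:
  assumes "invertible g"
  shows "fst (adhm_moment (gl_act g x)) = conjugate g (fst (adhm_moment x))"
    "fst (snd (adhm_moment (gl_act g x))) = conjugate g (fst (snd (adhm_moment x)))"
    "snd (snd (adhm_moment (gl_act g x))) = conjugate g (snd (snd (adhm_moment x)))"
  by (simp_all add: adhm_moment_simps conjugate_mult[OF assms] conjugate_mixed conjugate_add conjugate_diff)

lemma conjugate_conj: "invertible g \<Longrightarrow> invertible h \<Longrightarrow> conjugate g (conjugate h M) = conjugate (g ** h) M"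
  by (simp add: conjugate_def matrix_inv_mult matrix_mul_assoc)

lemma gl_act_mult:
  assumes "invertible g" "invertible h"
  shows "gl_act g (gl_act h x) = gl_act (g ** h) x"
proof -
  have "conjugate g (conjugate h M) = conjugate (g ** h) M" for M using assms by (rule conjugate_conj)
  then show ?thesis
    by (simp add: adhm.equality matrix_mul_assoc matrix_inv_mult[OF assms])
qed

lemma gl_act_one [simp]: "gl_act (mat 1) x = x"
  by (simp add: adhm.equality conjugate_def matrix_inv_one)

lemma gl_act_inv [simp]:
  "invertible g \<Longrightarrow> gl_act (matrix_inv g) (gl_act g x) = x"
  "invertible g \<Longrightarrow> gl_act g (gl_act (matrix_inv g) x) = x"
  by (simp_all add: gl_act_mult invertible_matrix_inv matrix_inv_cancel)

lemma polys_gl_act: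
  assumes "f \<in> adhm_polys" shows "(\<lambda>y. f (gl_act g y)) \<in> adhm_polys"
proof (rule polys_compose[OF assms polys_subalgebra])
  fix \<phi> :: "('a, 'b, 'c) adhm \<Rightarrow> 'a" assume "\<phi> \<in> adhm_coords"
  then show "(\<lambda>y. \<phi> (gl_act g y)) \<in> adhm_polys"
    by (rule coords_compose; simp add: conjugate_def; intro P.Q_matrix_mult coords_polys P.Q_const)
qed

lemma moment_zero_iff: "adhm_moment x = 0 \<longleftrightarrow> fst (adhm_moment x) = 0 \<and>
    fst (snd (adhm_moment x)) = 0 \<and> snd (snd (adhm_moment x)) = 0"
  by (auto simp: prod_eq_iff)

lemma conjugate_zero [simp]: "conjugate g 0 = 0"
  using conjugate_diff[of g 0 0] by simp

lemma moment_zero_gl_act: "invertible g \<Longrightarrow> adhm_moment x = 0 \<Longrightarrow> adhm_moment (gl_act g x) = 0"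
  by (simp add: moment_zero_iff moment_gl_act)

lemma moment_entries_conj:
  fixes T :: "('k::field, 'v::finite, 'w::finite) adhm \<Rightarrow> 'k^'v^'v"
  assumes J: "ideal_of_polys J" and M: "\<And>a b. (\<lambda>x. M x $ a $ b) \<in> J"
    and T: "\<And>a b. (\<lambda>x. T x $ a $ b) \<in> adhm_polys" and S: "\<And>a b. (\<lambda>x. S x $ a $ b) \<in> adhm_polys"
  shows "(\<lambda>x. (T x ** M x ** S x) $ a $ b) \<in> J"
  unfolding matrix_matrix_mult_def vec_lambda_beta
  by (intro ideal_of_polys_sum[OF J] ideal_of_polysD(4,5)[OF J] M T S)

text \<open>
  The three components of the moment map are conjugated by \<open>g\<close>, so their entries are mixed with constant
  coefficients.
\<close>
lemma adhm_ideal_gl_act: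
  fixes f :: "('k::field, 'v::finite, 'w::finite) adhm \<Rightarrow> 'k"
  assumes g: "invertible g" and "f \<in> adhm_ideal" shows "(\<lambda>y. f (gl_act g y)) \<in> adhm_ideal"
proof -
  let ?J = "{f \<in> adhm_polys. (\<lambda>y. f (gl_act g y)) \<in> adhm_ideal} :: (('k, 'v, 'w) adhm \<Rightarrow> 'k) set"
  note I = adhm_ideal moment_entries_ideal[unfolded moment_entries_def]
  have "ideal_of_polys ?J"
    unfolding ideal_of_polys_def
  proof (intro conjI ballI)
    show "(\<lambda>x. f' x * f x) \<in> ?J" if "f' \<in> adhm_polys" "f \<in> ?J" for f' f
      using that ideal_of_polysD(4)[OF adhm_ideal polys_gl_act[OF that(1)], of "\<lambda>y. f (gl_act g y)"]
      by (auto intro: P.Q_mult)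
  qed (use ideal_of_polysD(2,3)[OF adhm_ideal] in \<open>auto intro: P.Q_add P.Q_const\<close>)
  moreover have "moment_entries \<subseteq> ?J"
  proof
    fix f :: "('k, 'v, 'w) adhm \<Rightarrow> 'k" assume f: "f \<in> moment_entries"
    have "(\<lambda>y. conjugate g (fst (adhm_moment y)) $ a $ b) \<in> adhm_ideal"
      "(\<lambda>y. conjugate g (fst (snd (adhm_moment y))) $ a $ b) \<in> adhm_ideal"
      "(\<lambda>y. conjugate g (snd (snd (adhm_moment y))) $ a $ b) \<in> adhm_ideal" for a b
      unfolding conjugate_def using I(2)
      by (auto intro!: moment_entries_conj[OF I(1)] P.Q_const)
    then have "(\<lambda>y. f (gl_act g y)) \<in> adhm_ideal"
      using f unfolding moment_entries_def by (auto simp: moment_gl_act[OF g])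
    then show "f \<in> ?J" using f moment_entries_polys by blast
  qed
  ultimately have "adhm_ideal \<subseteq> ?J" by (rule adhm_ideal_minimal)
  then show ?thesis using assms by blast
qed

lemma sec_eval_conj: "sec_eval p (conjugate g M, conjugate g N) = conjugate g (sec_eval p (M, N))"
  unfolding sec_eval_def conjugate_def
  by (simp add: vec_eq_iff matrix_matrix_mult_def sum_distrib_left sum_distrib_right sum.distrib
      distrib_left distrib_right mult_ac)

lemma sec_eval_mult: "sec_eval p (g ** M, g ** N) = g ** sec_eval p (M, N)"
  unfolding sec_eval_def
  by (simp add: vec_eq_iff matrix_matrix_mult_def sum_distrib_left sum.distrib
      distrib_left mult_ac)

lemma conjugate_apply: "invertible g \<Longrightarrow> conjugate g M *v (g *v u) = g *v (M *v u)"
proof -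
  assume g: "invertible g"
  have "conjugate g M *v (g *v u) = (g ** M ** (matrix_inv g ** g)) *v u"
    by (simp add: conjugate_def matrix_vector_mul_assoc matrix_mul_assoc)
  then show ?thesis by (simp add: matrix_inv_cancel[OF g] matrix_vector_mul_assoc)
qed

lemma fj_stable_gl_act:
  fixes x :: "('k::field, 'v::finite, 'w::finite) adhm"
  assumes g: "invertible g" and st: "fj_stable x"
  shows "fj_stable (gl_act g x)"
  unfolding fj_stable_def
proof (intro allI impI notI, elim exE conjE)
  fix p S assume p: "p \<noteq> (0, 0)" and S: "vec.subspace S" "S \<noteq> UNIV"
    and inv: "(\<lambda>u. sec_eval p (adhm_B1 (gl_act g x)) *v u) ` S \<subseteq> S"
      "(\<lambda>u. sec_eval p (adhm_B2 (gl_act g x)) *v u) ` S \<subseteq> S"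
      "range (\<lambda>w. sec_eval p (adhm_i (gl_act g x)) *v w) \<subseteq> S"
  define T where "T = {u. g *v u \<in> S}"
  have "vec.subspace T" using S(1)
    by (simp add: T_def vec.subspace_def matrix_vector_right_distrib vector_scalar_commute)
  moreover have "T \<noteq> UNIV"
  proof
    assume T: "T = UNIV"
    have "u \<in> S" for u
    proof -
      have "matrix_inv g *v u \<in> T" using T by simp
      then show ?thesis by (simp add: T_def matrix_vector_mul_assoc matrix_inv_cancel[OF g])
    qed
    then show False using S(2) by auto
  qed
  moreover have "(\<lambda>u. sec_eval p (adhm_B1 x) *v u) ` T \<subseteq> T"
    "(\<lambda>u. sec_eval p (adhm_B2 x) *v u) ` T \<subseteq> T"
    using inv(1,2) by (auto simp: T_def sec_eval_conj simp flip: conjugate_apply[OF g])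
  moreover have "range (\<lambda>w. sec_eval p (adhm_i x) *v w) \<subseteq> T"
    using inv(3) by (auto simp: T_def sec_eval_mult matrix_vector_mul_assoc)
  ultimately show False using st p unfolding fj_stable_def by blast
qed

lemma fj_data_gl_act: "invertible g \<Longrightarrow> gl_act g x \<in> fj_data \<longleftrightarrow> x \<in> fj_data"
proof -
  have "gl_act g x \<in> fj_data" if "invertible g" "x \<in> fj_data" for g and x :: "('a, 'b, 'c) adhm"
    using that by (simp add: fj_data_def moment_zero_gl_act fj_stable_gl_act)
  from this[of g x] this[of "matrix_inv g" "gl_act g x"]
  show "invertible g \<Longrightarrow> ?thesis" by (auto simp: invertible_matrix_inv)
qed

lemma gl_orbit_gl_act: "invertible g \<Longrightarrow> gl_orbit (gl_act g x) = gl_orbit x"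
proof -
  assume g: "invertible g"
  have "gl_orbit (gl_act h y) \<subseteq> gl_orbit y" if "invertible h" for h and y :: "('a, 'b, 'c) adhm"
    using that by (auto simp: gl_orbit_def gl_act_mult intro: invertible_mult)
  from this[of g x] this[of "matrix_inv g" "gl_act g x"] g
  show ?thesis by (auto simp: invertible_matrix_inv)
qed

lemma gl_orbit_self: "x \<in> gl_orbit x"
  unfolding gl_orbit_def using invertible_mat_1 by (force intro: exI[of _ "mat 1"])

lemma gl_orbit_eq_iff: "gl_orbit x = gl_orbit y \<longleftrightarrow> (\<exists>g. invertible g \<and> x = gl_act g y)"
proof
  assume "gl_orbit x = gl_orbit y"
  then show "\<exists>g. invertible g \<and> x = gl_act g y"
    using gl_orbit_self[of x] by (auto simp: gl_orbit_def)
qed (auto simp: gl_orbit_gl_act)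

section \<open>Fractions, the topology and germs on the quotient\<close>

text \<open>
  The kernel of the map from the polynomial ring to the local ring at \<open>x\<close>.
\<close>
definition local_ideal :: "('k::field, 'v::finite, 'w::finite) adhm \<Rightarrow> (('k, 'v, 'w) adhm \<Rightarrow> 'k) set" where
  "local_ideal x = {f \<in> adhm_polys. \<exists>u\<in>adhm_polys. u x \<noteq> 0 \<and> (\<lambda>y. u y * f y) \<in> adhm_ideal}"

lemma local_idealI:
  "f \<in> adhm_polys \<Longrightarrow> u \<in> adhm_polys \<Longrightarrow> u x \<noteq> 0 \<Longrightarrow> (\<lambda>y. u y * f y) \<in> adhm_ideal \<Longrightarrow> f \<in> local_ideal x"
  unfolding local_ideal_def by blast

lemma local_idealE:
  assumes "f \<in> local_ideal x"
  obtains u where "f \<in> adhm_polys" "u \<in> adhm_polys" "u x \<noteq> 0" "(\<lambda>y. u y * f y) \<in> adhm_ideal"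
  using assms unfolding local_ideal_def by blast

lemma adhm_ideal_local: "f \<in> adhm_ideal \<Longrightarrow> f \<in> local_ideal x"
  using ideal_of_polysD(1)[OF adhm_ideal] by (intro local_idealI[of f "\<lambda>x. 1"] P.Q_const) auto

lemma local_ideal:
  fixes x :: "('k::field, 'v::finite, 'w::finite) adhm"
  shows "ideal_of_polys (local_ideal x)"
  unfolding ideal_of_polys_def
proof (intro conjI ballI)
  show "local_ideal x \<subseteq> adhm_polys" unfolding local_ideal_def by blast
  show "(\<lambda>x. 0) \<in> local_ideal x"
    by (rule adhm_ideal_local[OF ideal_of_polysD(2)[OF adhm_ideal]])
next
  fix f g :: "('k, 'v, 'w) adhm \<Rightarrow> 'k" assume f: "f \<in> local_ideal x" and g: "g \<in> local_ideal x"
  obtain u where u: "f \<in> adhm_polys" "u \<in> adhm_polys" "u x \<noteq> 0" "(\<lambda>y. u y * f y) \<in> adhm_ideal"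
    by (rule local_idealE[OF f])
  obtain v where v: "g \<in> adhm_polys" "v \<in> adhm_polys" "v x \<noteq> 0" "(\<lambda>y. v y * g y) \<in> adhm_ideal"
    by (rule local_idealE[OF g])
  have "(\<lambda>y. v y * (u y * f y) + u y * (v y * g y)) \<in> adhm_ideal"
    using ideal_of_polysD(3)[OF adhm_ideal ideal_of_polysD(4)[OF adhm_ideal v(2) u(4)]
        ideal_of_polysD(4)[OF adhm_ideal u(2) v(4)]] .
  then have "(\<lambda>y. (u y * v y) * (f y + g y)) \<in> adhm_ideal" by (simp add: algebra_simps)
  then show "(\<lambda>y. f y + g y) \<in> local_ideal x"
    using u v by (intro local_idealI[of _ "\<lambda>y. u y * v y"] P.Q_add P.Q_mult) auto
next
  fix f g :: "('k, 'v, 'w) adhm \<Rightarrow> 'k" assume f: "f \<in> adhm_polys" and g: "g \<in> local_ideal x"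
  obtain u where u: "g \<in> adhm_polys" "u \<in> adhm_polys" "u x \<noteq> 0" "(\<lambda>y. u y * g y) \<in> adhm_ideal"
    by (rule local_idealE[OF g])
  have "(\<lambda>y. f y * (u y * g y)) \<in> adhm_ideal"
    by (rule ideal_of_polysD(4)[OF adhm_ideal f u(4)])
  then have "(\<lambda>y. u y * (f y * g y)) \<in> adhm_ideal" by (simp add: algebra_simps)
  then show "(\<lambda>y. f y * g y) \<in> local_ideal x"
    using f u by (intro local_idealI[of _ u] P.Q_mult)
qed

lemma local_ideal_cancel:
  assumes "u \<in> adhm_polys" "u x \<noteq> 0" "f \<in> adhm_polys" "(\<lambda>y. u y * f y) \<in> local_ideal x"
  shows "f \<in> local_ideal x"
proof -
  obtain v where v: "v \<in> adhm_polys" "v x \<noteq> 0" "(\<lambda>y. v y * (u y * f y)) \<in> adhm_ideal"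
    by (rule local_idealE[OF assms(4)])
  then show ?thesis using assms
    by (intro local_idealI[of f "\<lambda>y. v y * u y"] P.Q_mult) (auto simp: mult.assoc)
qed

text \<open>
  A relation between germs at a point holds at all points near it, with the same witness \<open>u\<close>.
\<close>
lemma local_ideal_spread:
  assumes "f \<in> local_ideal x"
  obtains u where "u \<in> adhm_polys" "u x \<noteq> 0" "\<And>y. u y \<noteq> 0 \<Longrightarrow> f \<in> local_ideal y"
  by (rule local_idealE[OF assms]) (use local_idealI in blast)

definition frac_pair :: "('k::field, 'v::finite, 'w::finite) adhm \<Rightarrow> (('k, 'v, 'w) adhm \<Rightarrow> 'k) \<Rightarrow>
    (('k, 'v, 'w) adhm \<Rightarrow> 'k) \<Rightarrow> bool" where
  "frac_pair x f h \<longleftrightarrow> f \<in> adhm_polys \<and> h \<in> adhm_polys \<and> h x \<noteq> 0"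

lemma cross_polys: "frac_pair x f h \<Longrightarrow> frac_pair x f' h' \<Longrightarrow> (\<lambda>y. f y * h' y - f' y * h y) \<in> adhm_polys"
  unfolding frac_pair_def by (intro P.Q_diff P.Q_mult) auto

lemma mem_adhm_frac:
  assumes "frac_pair x f h"
  shows "(f', h') \<in> adhm_frac x f h \<longleftrightarrow> frac_pair x f' h' \<and> (\<lambda>y. f y * h' y - f' y * h y) \<in> local_ideal x"
proof
  assume "(f', h') \<in> adhm_frac x f h"
  then obtain u where u: "f' \<in> adhm_polys" "h' \<in> adhm_polys" "h' x \<noteq> 0" "u \<in> adhm_polys" "u x \<noteq> 0"
      "(\<lambda>y. u y * (f y * h' y - f' y * h y)) \<in> adhm_ideal"
    unfolding adhm_frac_def by blast
  then have p: "frac_pair x f' h'" by (simp add: frac_pair_def)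
  then show "frac_pair x f' h' \<and> (\<lambda>y. f y * h' y - f' y * h y) \<in> local_ideal x"
    using local_idealI[OF cross_polys[OF assms p] u(4-6)] by simp
next
  assume *: "frac_pair x f' h' \<and> (\<lambda>y. f y * h' y - f' y * h y) \<in> local_ideal x"
  show "(f', h') \<in> adhm_frac x f h"
    by (rule local_idealE[OF conjunct2[OF *]]) (use * in \<open>auto simp: adhm_frac_def frac_pair_def\<close>)
qed

lemma frac_cong_trans:
  assumes "frac_pair x f h" "frac_pair x f' h'" "frac_pair x f'' h''"
    and "(\<lambda>y. f y * h' y - f' y * h y) \<in> local_ideal x" "(\<lambda>y. f' y * h'' y - f'' y * h' y) \<in> local_ideal x"
  shows "(\<lambda>y. f y * h'' y - f'' y * h y) \<in> local_ideal x"
proof (rule local_ideal_cancel[OF _ _ cross_polys[OF assms(1,3)]])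
  note p = assms(1-3)[unfolded frac_pair_def]
  have "(\<lambda>y. h'' y * (f y * h' y - f' y * h y) + h y * (f' y * h'' y - f'' y * h' y)) \<in> local_ideal x"
    using assms p by (intro ideal_of_polysD(3,4)[OF local_ideal]) auto
  then show "(\<lambda>y. h' y * (f y * h'' y - f'' y * h y)) \<in> local_ideal x" by (simp add: algebra_simps)
  show "h' \<in> adhm_polys" "h' x \<noteq> 0" using p by auto
qed

lemma frac_cong_sym:
  "(\<lambda>y. f y * h' y - f' y * h y) \<in> local_ideal x \<Longrightarrow> (\<lambda>y. f' y * h y - f y * h' y) \<in> local_ideal x"
  using ideal_of_polys_uminus[OF local_ideal, of "\<lambda>y. f y * h' y - f' y * h y" x] by simp

lemma adhm_frac_self: "frac_pair x f h \<Longrightarrow> (f, h) \<in> adhm_frac x f h"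
  using ideal_of_polysD(2)[OF local_ideal] by (simp add: mem_adhm_frac)

lemma adhm_frac_subset:
  assumes p: "frac_pair x f h" "frac_pair x f' h'" and L: "(\<lambda>y. f' y * h y - f y * h' y) \<in> local_ideal x"
  shows "adhm_frac x f h \<subseteq> adhm_frac x f' h'"
proof
  fix z assume "z \<in> adhm_frac x f h"
  moreover obtain g k where z: "z = (g, k)" by fastforce
  ultimately have *: "frac_pair x g k" "(\<lambda>y. f y * k y - g y * h y) \<in> local_ideal x"
    using mem_adhm_frac[OF p(1)] by auto
  then show "z \<in> adhm_frac x f' h'"
    unfolding z mem_adhm_frac[OF p(2)] using frac_cong_trans[OF p(2,1) *(1) L *(2)] by simp
qed

lemma adhm_frac_eq_iff:
  assumes "frac_pair x f h" "frac_pair x f' h'"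
  shows "adhm_frac x f h = adhm_frac x f' h' \<longleftrightarrow> (\<lambda>y. f y * h' y - f' y * h y) \<in> local_ideal x"
proof
  assume "adhm_frac x f h = adhm_frac x f' h'"
  then have "(f', h') \<in> adhm_frac x f h" using adhm_frac_self[OF assms(2)] by simp
  then show "(\<lambda>y. f y * h' y - f' y * h y) \<in> local_ideal x"
    unfolding mem_adhm_frac[OF assms(1)] by simp
next
  assume L: "(\<lambda>y. f y * h' y - f' y * h y) \<in> local_ideal x"
  show "adhm_frac x f h = adhm_frac x f' h'"
    using adhm_frac_subset[OF assms frac_cong_sym[OF L]] adhm_frac_subset[OF assms(2,1) L] by blast
qed

lemma UN_pair_const:
  assumes "(f0, h0) \<in> a" and F: "\<And>f h. (f, h) \<in> a \<Longrightarrow> F f h = c"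
  shows "(\<Union>(f, h)\<in>a. F f h) = c"
proof -
  have "(\<Union>(f, h)\<in>a. F f h) = (\<Union>z\<in>a. c)"
    by (rule SUP_cong[OF refl]) (clarify, rule F)
  then show ?thesis using assms(1) by auto
qed

lemma UN_pair2_const:
  assumes "(f0, h0) \<in> a" "(f0', h0') \<in> b"
    and F: "\<And>f h f' h'. (f, h) \<in> a \<Longrightarrow> (f', h') \<in> b \<Longrightarrow> F f h f' h' = c"
  shows "(\<Union>(f, h)\<in>a. \<Union>(f', h')\<in>b. F f h f' h') = c"
  by (rule UN_pair_const[OF assms(1)], rule UN_pair_const[OF assms(2)], rule F)

lemma frac_pair_mult: "frac_pair x f h \<Longrightarrow> frac_pair x f' h' \<Longrightarrow>
    frac_pair x (\<lambda>y. f y * f' y) (\<lambda>y. h y * h' y)"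
  unfolding frac_pair_def by (auto intro!: P.Q_mult)

lemma frac_pair_add: "frac_pair x f h \<Longrightarrow> frac_pair x f' h' \<Longrightarrow>
    frac_pair x (\<lambda>y. f y * h' y + f' y * h y) (\<lambda>y. h y * h' y)"
  unfolding frac_pair_def by (auto intro!: P.Q_mult P.Q_add)

lemma local_mult:
  assumes p: "frac_pair x f1 h1" "frac_pair x f2 h2"
  shows "adhm_frac x f1 h1 \<otimes>\<^bsub>adhm_local_ring x\<^esub> adhm_frac x f2 h2 =
    adhm_frac x (\<lambda>y. f1 y * f2 y) (\<lambda>y. h1 y * h2 y)"
proof -
  have "adhm_frac x (\<lambda>y. f y * f' y) (\<lambda>y. h y * h' y) = adhm_frac x (\<lambda>y. f1 y * f2 y) (\<lambda>y. h1 y * h2 y)"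
    if "(f, h) \<in> adhm_frac x f1 h1" "(f', h') \<in> adhm_frac x f2 h2" for f h f' h'
  proof -
    have *: "frac_pair x f h" "(\<lambda>y. f1 y * h y - f y * h1 y) \<in> local_ideal x"
      "frac_pair x f' h'" "(\<lambda>y. f2 y * h' y - f' y * h2 y) \<in> local_ideal x"
      using that p by (auto simp: mem_adhm_frac)
    have "(\<lambda>y. (f1 y * h y) * (f2 y * h' y - f' y * h2 y) + (f' y * h2 y) * (f1 y * h y - f y * h1 y)) \<in> local_ideal x"
      using * p unfolding frac_pair_def
      by (intro ideal_of_polysD(3)[OF local_ideal] ideal_of_polysD(4)[OF local_ideal]) (auto intro!: P.Q_mult)
    then have "(\<lambda>y. (f1 y * f2 y) * (h y * h' y) - (f y * f' y) * (h1 y * h2 y)) \<in> local_ideal x"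
      by (simp add: algebra_simps)
    then show ?thesis
      by (rule adhm_frac_eq_iff[OF frac_pair_mult[OF p] frac_pair_mult[OF *(1,3)], THEN iffD2, symmetric])
  qed
  then show ?thesis unfolding adhm_local_ring_def monoid.simps
    by (rule UN_pair2_const[OF adhm_frac_self[OF p(1)] adhm_frac_self[OF p(2)]])
qed

lemma local_add:
  assumes p: "frac_pair x f1 h1" "frac_pair x f2 h2"
  shows "adhm_frac x f1 h1 \<oplus>\<^bsub>adhm_local_ring x\<^esub> adhm_frac x f2 h2 =
    adhm_frac x (\<lambda>y. f1 y * h2 y + f2 y * h1 y) (\<lambda>y. h1 y * h2 y)"
proof -
  have "adhm_frac x (\<lambda>y. f y * h' y + f' y * h y) (\<lambda>y. h y * h' y) =
      adhm_frac x (\<lambda>y. f1 y * h2 y + f2 y * h1 y) (\<lambda>y. h1 y * h2 y)"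
    if "(f, h) \<in> adhm_frac x f1 h1" "(f', h') \<in> adhm_frac x f2 h2" for f h f' h'
  proof -
    have *: "frac_pair x f h" "(\<lambda>y. f1 y * h y - f y * h1 y) \<in> local_ideal x"
      "frac_pair x f' h'" "(\<lambda>y. f2 y * h' y - f' y * h2 y) \<in> local_ideal x"
      using that p by (auto simp: mem_adhm_frac)
    have "(\<lambda>y. (h' y * h2 y) * (f1 y * h y - f y * h1 y) + (h y * h1 y) * (f2 y * h' y - f' y * h2 y)) \<in> local_ideal x"
      using * p unfolding frac_pair_def
      by (intro ideal_of_polysD(3)[OF local_ideal] ideal_of_polysD(4)[OF local_ideal]) (auto intro!: P.Q_mult)
    then have "(\<lambda>y. (f1 y * h2 y + f2 y * h1 y) * (h y * h' y) - (f y * h' y + f' y * h y) * (h1 y * h2 y)) \<in> local_ideal x"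
      by (simp add: algebra_simps)
    then show ?thesis
      by (rule adhm_frac_eq_iff[OF frac_pair_add[OF p] frac_pair_add[OF *(1,3)], THEN iffD2, symmetric])
  qed
  then show ?thesis unfolding adhm_local_ring_def ring_record_simps
    by (rule UN_pair2_const[OF adhm_frac_self[OF p(1)] adhm_frac_self[OF p(2)]])
qed

lemma local_ideal_gl_act:
  assumes g: "invertible g" and f: "f \<in> local_ideal (gl_act g x)"
  shows "(\<lambda>y. f (gl_act g y)) \<in> local_ideal x"
proof -
  obtain u where u: "f \<in> adhm_polys" "u \<in> adhm_polys" "u (gl_act g x) \<noteq> 0" "(\<lambda>y. u y * f y) \<in> adhm_ideal"
    by (rule local_idealE[OF f])
  show ?thesis
    by (rule local_idealI[OF polys_gl_act[OF u(1)] polys_gl_act[OF u(2)] u(3)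
          adhm_ideal_gl_act[OF g u(4)]])
qed

lemma frac_pair_gl_act: "frac_pair (gl_act g x) f h \<Longrightarrow> frac_pair x (f \<circ> gl_act g) (h \<circ> gl_act g)"
  by (simp add: frac_pair_def polys_gl_act comp_def)

lemma gl_pullback_frac:
  assumes g: "invertible g" and p: "frac_pair (gl_act g x) f h"
  shows "gl_pullback g (adhm_frac (gl_act g x) f h) = adhm_frac x (f \<circ> gl_act g) (h \<circ> gl_act g)"
proof
  have p': "frac_pair x (f \<circ> gl_act g) (h \<circ> gl_act g)" by (rule frac_pair_gl_act[OF p])
  let ?pull = "\<lambda>(f, h). (f \<circ> gl_act g, h \<circ> gl_act g)"
  show "gl_pullback g (adhm_frac (gl_act g x) f h) \<subseteq> adhm_frac x (f \<circ> gl_act g) (h \<circ> gl_act g)"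
  proof
    fix z assume "z \<in> gl_pullback g (adhm_frac (gl_act g x) f h)"
    then obtain f' h' where z: "z = (f' \<circ> gl_act g, h' \<circ> gl_act g)" "(f', h') \<in> adhm_frac (gl_act g x) f h"
      unfolding gl_pullback_def by auto
    then have "frac_pair (gl_act g x) f' h'" "(\<lambda>y. f y * h' y - f' y * h y) \<in> local_ideal (gl_act g x)"
      by (auto simp: mem_adhm_frac[OF p])
    then show "z \<in> adhm_frac x (f \<circ> gl_act g) (h \<circ> gl_act g)"
      unfolding z(1) mem_adhm_frac[OF p']
      using frac_pair_gl_act local_ideal_gl_act[OF g] by fastforce
  qed
  show "adhm_frac x (f \<circ> gl_act g) (h \<circ> gl_act g) \<subseteq> gl_pullback g (adhm_frac (gl_act g x) f h)"
  proof
    let ?k = "matrix_inv g"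
    fix z assume z_in: "z \<in> adhm_frac x (f \<circ> gl_act g) (h \<circ> gl_act g)"
    obtain f' h' where z: "z = (f', h')" by fastforce
    have *: "frac_pair x f' h'" "(\<lambda>y. f (gl_act g y) * h' y - f' y * h (gl_act g y)) \<in> local_ideal x"
      using z_in unfolding z mem_adhm_frac[OF p'] by auto
    have k: "invertible ?k" by (rule invertible_matrix_inv[OF g])
    have x: "gl_act ?k (gl_act g x) = x" using g by simp
    have "frac_pair (gl_act g x) (f' \<circ> gl_act ?k) (h' \<circ> gl_act ?k)"
      using frac_pair_gl_act[of ?k "gl_act g x" f' h'] *(1) x by simp
    moreover have "(\<lambda>y. f y * (h' \<circ> gl_act ?k) y - (f' \<circ> gl_act ?k) y * h y) \<in> local_ideal (gl_act g x)"
      using local_ideal_gl_act[OF k, of "\<lambda>y. f (gl_act g y) * h' y - f' y * h (gl_act g y)" "gl_act g x"] * x g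
      by simp
    ultimately have "(f' \<circ> gl_act ?k, h' \<circ> gl_act ?k) \<in> adhm_frac (gl_act g x) f h"
      unfolding mem_adhm_frac[OF p] by simp
    moreover have "z = ?pull (f' \<circ> gl_act ?k, h' \<circ> gl_act ?k)"
      using g by (simp add: z comp_def)
    ultimately show "z \<in> gl_pullback g (adhm_frac (gl_act g x) f h)"
      unfolding gl_pullback_def by (rule rev_image_eqI)
  qed
qed

lemma openin_principal:
  assumes "h \<in> adhm_polys" shows "openin fj_topology {x \<in> fj_data. h x \<noteq> 0}"
proof -
  have "openin (topology_generated_by {{x. h x \<noteq> 0} | h. h \<in> adhm_polys}) {x. h x \<noteq> 0}"
    using assms by (intro topology_generated_by_Basis) blast
  then show ?thesis unfolding fj_topology_def openin_subtopology by (auto intro!: exI[of _ "{x. h x \<noteq> 0}"])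
qed

lemma principal_neighbourhood:
  assumes "openin fj_topology N" and "x \<in> N"
  obtains h where "h \<in> adhm_polys" "h x \<noteq> 0" "{y \<in> fj_data. h y \<noteq> 0} \<subseteq> N"
proof -
  obtain T where T: "generate_topology_on {{x. h x \<noteq> 0} | h. h \<in> adhm_polys} T" "N = T \<inter> fj_data"
    using assms(1) unfolding fj_topology_def openin_subtopology
    by (auto dest: openin_topology_generated_by)
  have "\<exists>h\<in>adhm_polys. h x \<noteq> 0 \<and> {y. h y \<noteq> 0} \<subseteq> T" if "x \<in> T" for x
    using T(1) that
  proof (induction arbitrary: x)
    case (Int a b)
    obtain h where h: "h \<in> adhm_polys" "h x \<noteq> 0" "{y. h y \<noteq> 0} \<subseteq> a" using Int.IH(1)[of x] Int.prems by blast
    obtain k where k: "k \<in> adhm_polys" "k x \<noteq> 0" "{y. k y \<noteq> 0} \<subseteq> b" using Int.IH(2)[of x] Int.prems by blast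
    show ?case
    proof (rule bexI[of _ "\<lambda>y. h y * k y"])
      show "h x * k x \<noteq> 0 \<and> {y. h y * k y \<noteq> 0} \<subseteq> a \<inter> b" using h k by auto
    qed (rule P.Q_mult[OF h(1) k(1)])
  next
    case (UN K)
    from UN.prems obtain k where "k \<in> K" "x \<in> k" by blast
    then show ?case using UN.IH[of k x] by blast
  qed auto
  from this[of x] obtain h where "h \<in> adhm_polys" "h x \<noteq> 0" "{y. h y \<noteq> 0} \<subseteq> T"
    using assms(2) T(2) by blast
  then show thesis using that[of h] T(2) by blast
qed

lemma openin_neighbourhoods:
  assumes "N \<subseteq> fj_data"
    and "\<And>x. x \<in> N \<Longrightarrow> \<exists>h\<in>adhm_polys. h x \<noteq> 0 \<and> {y \<in> fj_data. h y \<noteq> 0} \<subseteq> N"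
  shows "openin fj_topology N"
proof (subst openin_subopen, intro ballI)
  fix x assume "x \<in> N"
  obtain h where "h \<in> adhm_polys" "h x \<noteq> 0" "{y \<in> fj_data. h y \<noteq> 0} \<subseteq> N"
    using assms(2)[OF \<open>x \<in> N\<close>] by blast
  then show "\<exists>T. openin fj_topology T \<and> x \<in> T \<and> T \<subseteq> N"
    using openin_principal[of h] \<open>x \<in> N\<close> assms(1)
    by (intro exI[of _ "{y \<in> fj_data. h y \<noteq> 0}"]) auto
qed

abbreviation moduli :: "('k::alg_closed_field, 'v::finite, 'w::finite) moduli_space" where
  "moduli \<equiv> framed_instanton_moduli"

lemma moduli_sel [simp]:
  "top_of moduli = moduli_topology" "sections moduli = moduli_sections"
  "restr moduli = (\<lambda>U U' s. restrict s (orbit_preimage U'))"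
  by (simp_all add: framed_instanton_moduli_def)

lemma orbit_preimage_Int: "orbit_preimage (U \<inter> V) = orbit_preimage U \<inter> orbit_preimage V"
  by (auto simp: orbit_preimage_def)

lemma orbit_preimage_mono: "U \<subseteq> V \<Longrightarrow> orbit_preimage U \<subseteq> orbit_preimage V"
  by (auto simp: orbit_preimage_def)

lemma restrict_eq_iff: "restrict s A = restrict t A \<longleftrightarrow> (\<forall>x\<in>A. s x = t x)"
  by (metis restrict_apply' restrict_ext)

lemma germ_eqI:
  fixes p :: "('k::alg_closed_field, 'v::finite, 'w::finite) adhm set"
  assumes W: "openin moduli_topology W" "p \<in> W" "W \<subseteq> U \<inter> V"
    and eq: "\<And>x. x \<in> orbit_preimage W \<Longrightarrow> s x = t x"
  shows "germ moduli p U s = germ moduli p V t"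
proof -
  have *: "germ moduli p U s \<subseteq> germ moduli p V t"
    if "W \<subseteq> U \<inter> V" "\<And>x. x \<in> orbit_preimage W \<Longrightarrow> s x = t x" for U V s t
  proof (clarsimp simp: germ_def restrict_eq_iff)
    fix V' t' W'
    assume "openin moduli_topology W'" "p \<in> W'" "W' \<subseteq> U" "W' \<subseteq> V'" "\<forall>x\<in>orbit_preimage W'. s x = t' x"
    then show "\<exists>W. openin moduli_topology W \<and> p \<in> W \<and> W \<subseteq> V \<and> W \<subseteq> V' \<and> (\<forall>x\<in>orbit_preimage W. t x = t' x)"
      using W that by (intro exI[of _ "W \<inter> W'"]) (auto simp: orbit_preimage_Int)
  qed
  show ?thesis using *[of U V s t] *[of V U t s] W eq by auto
qed

lemma germ_self:
  assumes "openin moduli_topology U" "p \<in> U" "s \<in> carrier (moduli_sections U)"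
  shows "(U, s) \<in> germ moduli p U s"
  using assms by (auto simp: germ_def)

lemma germ_value:
  assumes "germ moduli (gl_orbit x) U s = germ moduli (gl_orbit x) V t" and x: "x \<in> fj_data"
    and V: "openin moduli_topology V" "gl_orbit x \<in> V" "t \<in> carrier (moduli_sections V)"
  shows "s x = t x"
proof -
  have "(V, t) \<in> germ moduli (gl_orbit x) U s" using germ_self[OF V] assms(1) by simp
  then obtain W where "gl_orbit x \<in> W" "\<forall>y\<in>orbit_preimage W. s y = t y"
    by (auto simp: germ_def restrict_eq_iff)
  then show ?thesis using x by (auto simp: orbit_preimage_def)
qed

text \<open>
  Addition and multiplication of germs have the same shape, so both are covered by one statement about
  a pointwise operation.
\<close>
lemma stalk_op:
  fixes p :: "('k::alg_closed_field, 'v::finite, 'w::finite) adhm set"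
  assumes U: "openin moduli_topology U" "p \<in> U" "s \<in> carrier (moduli_sections U)"
    and V: "openin moduli_topology V" "p \<in> V" "t \<in> carrier (moduli_sections V)"
    and op: "\<And>U s t. op U s t = (\<lambda>x\<in>orbit_preimage U. lop x (s x) (t x))"
  shows "(\<Union>(U, s)\<in>germ moduli p U s. \<Union>(V, t)\<in>germ moduli p V t. germ moduli p (U \<inter> V)
        (op (U \<inter> V) (restr moduli U (U \<inter> V) s) (restr moduli V (U \<inter> V) t))) =
      germ moduli p (U \<inter> V) (\<lambda>x. lop x (s x) (t x))"
proof -
  have "germ moduli p (U' \<inter> V') (op (U' \<inter> V') (restr moduli U' (U' \<inter> V') s') (restr moduli V' (U' \<inter> V') t')) =
      germ moduli p (U \<inter> V) (\<lambda>x. lop x (s x) (t x))"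
    if germs: "(U', s') \<in> germ moduli p U s" "(V', t') \<in> germ moduli p V t" for U' s' V' t'
  proof -
    obtain W1 where W1: "openin moduli_topology W1" "p \<in> W1" "W1 \<subseteq> U \<inter> U'" "\<forall>y\<in>orbit_preimage W1. s y = s' y"
      using germs(1) by (auto simp: germ_def restrict_eq_iff)
    obtain W2 where W2: "openin moduli_topology W2" "p \<in> W2" "W2 \<subseteq> V \<inter> V'" "\<forall>y\<in>orbit_preimage W2. t y = t' y"
      using germs(2) by (auto simp: germ_def restrict_eq_iff)
    show ?thesis
    proof (rule germ_eqI[of "W1 \<inter> W2"])
      fix x assume x: "x \<in> orbit_preimage (W1 \<inter> W2)"
      moreover have "orbit_preimage (W1 \<inter> W2) \<subseteq> orbit_preimage (U' \<inter> V')"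
        using W1 W2 by (intro orbit_preimage_mono) auto
      ultimately show "op (U' \<inter> V') (restr moduli U' (U' \<inter> V') s') (restr moduli V' (U' \<inter> V') t') x =
          lop x (s x) (t x)"
        using W1 W2 by (auto simp: op orbit_preimage_Int)
    qed (use W1 W2 in auto)
  qed
  then show ?thesis by (rule UN_pair2_const[OF germ_self[OF U] germ_self[OF V]])
qed

lemma stalk_mult:
  assumes "openin moduli_topology U" "p \<in> U" "s \<in> carrier (moduli_sections U)"
    and "openin moduli_topology V" "p \<in> V" "t \<in> carrier (moduli_sections V)"
  shows "germ moduli p U s \<otimes>\<^bsub>stalk moduli p\<^esub> germ moduli p V t =
    germ moduli p (U \<inter> V) (\<lambda>x. s x \<otimes>\<^bsub>adhm_local_ring x\<^esub> t x)"
  unfolding stalk_def monoid.simps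
  by (rule stalk_op[OF assms]) (simp add: moduli_sections_def fj_sections_def restrict_def)

lemma stalk_add:
  assumes "openin moduli_topology U" "p \<in> U" "s \<in> carrier (moduli_sections U)"
    and "openin moduli_topology V" "p \<in> V" "t \<in> carrier (moduli_sections V)"
  shows "germ moduli p U s \<oplus>\<^bsub>stalk moduli p\<^esub> germ moduli p V t =
    germ moduli p (U \<inter> V) (\<lambda>x. s x \<oplus>\<^bsub>adhm_local_ring x\<^esub> t x)"
  unfolding stalk_def ring_record_simps
  by (rule stalk_op[OF assms]) (simp add: moduli_sections_def fj_sections_def restrict_def)

section \<open>The slice chart of the quotient\<close>

text \<open>
  The functions on the locus \<open>d \<noteq> 0\<close> that become members of \<open>Q\<close> after multiplication by a power of \<open>d\<close>.
  Their values elsewhere are arbitrary, so inverse matrices can be used without case distinctions.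
\<close>
definition localized :: "('x \<Rightarrow> 'k::field) set \<Rightarrow> ('x \<Rightarrow> 'k) \<Rightarrow> ('x \<Rightarrow> 'k) set" where
  "localized Q d = {\<phi>. \<exists>n. \<exists>F\<in>Q. \<forall>x. d x \<noteq> 0 \<longrightarrow> F x = d x ^ n * \<phi> x}"

lemma localizedI:
  "F \<in> Q \<Longrightarrow> (\<And>x. d x \<noteq> 0 \<Longrightarrow> F x = d x ^ n * \<phi> x) \<Longrightarrow> \<phi> \<in> localized Q d"
  unfolding localized_def by blast

lemma localizedE:
  assumes "\<phi> \<in> localized Q d"
  obtains n F where "F \<in> Q" "\<And>x. d x \<noteq> 0 \<Longrightarrow> F x = d x ^ n * \<phi> x"
  using assms unfolding localized_def by blast

lemma localized_cong:
  assumes "\<phi> \<in> localized Q d" and "\<And>x. d x \<noteq> 0 \<Longrightarrow> \<psi> x = \<phi> x"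
  shows "\<psi> \<in> localized Q d"
proof -
  obtain n F where "F \<in> Q" "\<And>x. d x \<noteq> 0 \<Longrightarrow> F x = d x ^ n * \<phi> x"
    by (rule localizedE[OF assms(1)]) blast
  then show ?thesis using assms(2) by (intro localizedI[where n = n and F = F]) simp_all
qed

lemma (in function_algebra) localized_subalgebra:
  assumes d: "d \<in> Q" shows "subalgebra (localized Q d)"
  unfolding subalgebra_def
proof (intro conjI ballI allI)
  show "(\<lambda>x. a) \<in> localized Q d" for a
    by (rule localizedI[where n = 0, OF Q_const[of a]]) simp
next
  fix \<phi> \<psi> assume in_loc: "\<phi> \<in> localized Q d" "\<psi> \<in> localized Q d"
  obtain n F where F: "F \<in> Q" "\<And>x. d x \<noteq> 0 \<Longrightarrow> F x = d x ^ n * \<phi> x"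
    by (rule localizedE[OF in_loc(1)]) blast
  obtain m G where G: "G \<in> Q" "\<And>x. d x \<noteq> 0 \<Longrightarrow> G x = d x ^ m * \<psi> x"
    by (rule localizedE[OF in_loc(2)]) blast
  show "(\<lambda>x. \<phi> x + \<psi> x) \<in> localized Q d"
    by (rule localizedI[where n = "n + m" and F = "\<lambda>x. d x ^ m * F x + d x ^ n * G x"])
      (use F(1) G(1) d in \<open>auto intro!: Q_add Q_mult Q_power\<close>,
        simp add: F(2) G(2) power_add algebra_simps)
  show "(\<lambda>x. \<phi> x * \<psi> x) \<in> localized Q d"
    by (rule localizedI[where n = "n + m" and F = "\<lambda>x. F x * G x"])
      (use F(1) G(1) in \<open>auto intro!: Q_mult\<close>, simp add: F(2) G(2) power_add algebra_simps)
qed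

text \<open>
  The square block of \<open>i\<^sub>0\<close> formed by the columns that \<open>iota\<close> selects. It is multiplied by \<open>g\<close> under the
  action, so where it is invertible an orbit contains exactly one datum with block \<open>1\<close>.
\<close>
definition frame :: "('v::finite \<Rightarrow> 'w::finite) \<Rightarrow> ('k::field, 'v, 'w) adhm \<Rightarrow> 'k^'v^'v" where
  "frame iota x = (\<chi> a b. fst (adhm_i x) $ a $ iota b)"

lemma frame_gl_act: "frame iota (gl_act g x) = g ** frame iota x"
  by (simp add: frame_def vec_eq_iff matrix_matrix_mult_def)

lemma frame_polys: "(\<lambda>x. frame iota x $ a $ b) \<in> adhm_polys"
  unfolding frame_def by (simp add: coords_polys)

locale slice_chart =
  fixes iota :: "'v::finite \<Rightarrow> 'w::finite" and x0 :: "('k::alg_closed_field, 'v, 'w) adhm"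
  assumes x0: "x0 \<in> fj_data" and frame_x0: "frame iota x0 = mat 1"
begin

definition frame_det :: "('k, 'v, 'w) adhm \<Rightarrow> 'k" where "frame_det x = det (frame iota x)"

text \<open>
  The projection to the slice along orbits.
\<close>
definition retr :: "('k, 'v, 'w) adhm \<Rightarrow> ('k, 'v, 'w) adhm" where
  "retr x = gl_act (matrix_inv (frame iota x)) x"

lemma frame_det_polys: "frame_det \<in> adhm_polys"
  unfolding frame_det_def[abs_def] by (intro P.Q_det frame_polys)

lemma invertible_frame: "frame_det x \<noteq> 0 \<longleftrightarrow> invertible (frame iota x)"
  by (simp add: frame_det_def invertible_det_nz)

lemma frame_det_gl_act: "frame_det (gl_act g x) = det g * frame_det x"
  by (simp add: frame_det_def frame_gl_act det_mul)

lemma retr_gl_act: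
  assumes g: "invertible g" and frame_det: "frame_det x \<noteq> 0" shows "retr (gl_act g x) = retr x"
proof -
  let ?A = "frame iota x"
  have A: "invertible ?A" using frame_det by (simp add: invertible_frame)
  have "retr (gl_act g x) = gl_act (matrix_inv ?A ** matrix_inv g) (gl_act g x)"
    by (simp add: retr_def frame_gl_act matrix_inv_mult[OF g A])
  also have "\<dots> = gl_act (matrix_inv ?A) (gl_act (matrix_inv g) (gl_act g x))"
    by (simp only: gl_act_mult[OF invertible_matrix_inv[OF A] invertible_matrix_inv[OF g]])
  finally show ?thesis using g by (simp add: retr_def)
qed

lemma frame_retr: "frame_det x \<noteq> 0 \<Longrightarrow> frame iota (retr x) = mat 1"
  by (simp add: retr_def frame_gl_act invertible_frame matrix_inv_cancel)

lemma retr_slice: "frame iota x = mat 1 \<Longrightarrow> retr x = x"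
  by (simp add: retr_def matrix_inv_one)

lemma frame_det_slice: "frame iota x = mat 1 \<Longrightarrow> frame_det x = 1"
  by (simp add: frame_det_def)

abbreviation chart_regular :: "(('k, 'v, 'w) adhm \<Rightarrow> 'k) set" where
  "chart_regular \<equiv> localized adhm_polys frame_det"

lemma chart_regular_subalgebra: "subalgebra chart_regular"
  by (rule P.localized_subalgebra[OF frame_det_polys])

lemma polys_chart_regular: "f \<in> adhm_polys \<Longrightarrow> f \<in> chart_regular"
  by (rule localizedI[where n = 0]) auto

lemma inverse_frame_regular: "(\<lambda>x. matrix_inv (frame iota x) $ a $ b) \<in> chart_regular"
  by (rule localizedI[where n = 1 and F = "\<lambda>x. adjugate (frame iota x) $ a $ b"])
    (auto intro!: P.Q_adjugate frame_polys simp: frame_det_def det_mult_matrix_inv)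

lemma retr_regular:
  assumes "f \<in> adhm_polys" shows "(\<lambda>x. f (retr x)) \<in> chart_regular"
proof (rule polys_compose[OF assms chart_regular_subalgebra])
  interpret R: function_algebra chart_regular by standard (rule chart_regular_subalgebra)
  note reg = polys_chart_regular[OF coords_polys(1)] polys_chart_regular[OF coords_polys(2)]
    polys_chart_regular[OF coords_polys(3)] polys_chart_regular[OF coords_polys(4)]
    polys_chart_regular[OF coords_polys(5)] polys_chart_regular[OF coords_polys(6)]
    polys_chart_regular[OF coords_polys(7)] polys_chart_regular[OF coords_polys(8)]
    polys_chart_regular[OF frame_polys] inverse_frame_regular
  have conj: "(\<lambda>x. conjugate (matrix_inv (frame iota x)) (M x) $ a $ b) \<in> chart_regular"
    if "\<And>a b. (\<lambda>x. M x $ a $ b) \<in> chart_regular" for M a b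
    by (rule localized_cong[where \<phi> = "\<lambda>x. (matrix_inv (frame iota x) ** M x ** frame iota x) $ a $ b"])
      (auto intro!: R.Q_matrix_mult reg that simp: conjugate_def matrix_inv_inv invertible_frame)
  have mixed: "(\<lambda>x. (M x ** matrix_inv (matrix_inv (frame iota x))) $ a $ b) \<in> chart_regular"
    if "\<And>a b. (\<lambda>x. M x $ a $ b) \<in> chart_regular" for M :: "('k, 'v, 'w) adhm \<Rightarrow> 'k^'v^'w" and a b
    by (rule localized_cong[where \<phi> = "\<lambda>x. (M x ** frame iota x) $ a $ b"])
      (auto intro!: R.Q_matrix_mult reg that simp: matrix_inv_inv invertible_frame)
  fix \<phi> :: "('k, 'v, 'w) adhm \<Rightarrow> 'k" assume "\<phi> \<in> adhm_coords"
  then show "(\<lambda>y. \<phi> (retr y)) \<in> chart_regular"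
    by (rule coords_compose; simp add: retr_def; intro conj mixed R.Q_matrix_mult reg)
qed

text \<open>
  The fraction \<open>f / h\<close> on the slice, pulled back along the projection and written with polynomial
  numerator and denominator. The constant \<open>c\<close> makes the notion stable under the action, which multiplies
  the determinant of the frame by a constant.
\<close>
definition clears :: "(('k, 'v, 'w) adhm \<Rightarrow> 'k) \<Rightarrow> (('k, 'v, 'w) adhm \<Rightarrow> 'k) \<Rightarrow>
    (('k, 'v, 'w) adhm \<Rightarrow> 'k) \<Rightarrow> (('k, 'v, 'w) adhm \<Rightarrow> 'k) \<Rightarrow> bool" where
  "clears f h F H \<longleftrightarrow> F \<in> adhm_polys \<and> H \<in> adhm_polys \<and> (\<exists>n c. c \<noteq> 0 \<and>
     (\<forall>x. frame_det x \<noteq> 0 \<longrightarrow> F x = c * frame_det x ^ n * f (retr x) \<and> H x = c * frame_det x ^ n * h (retr x)))"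

lemma clearsI:
  "F \<in> adhm_polys \<Longrightarrow> H \<in> adhm_polys \<Longrightarrow> c \<noteq> 0 \<Longrightarrow>
    (\<And>x. frame_det x \<noteq> 0 \<Longrightarrow> F x = c * frame_det x ^ n * f (retr x)) \<Longrightarrow>
    (\<And>x. frame_det x \<noteq> 0 \<Longrightarrow> H x = c * frame_det x ^ n * h (retr x)) \<Longrightarrow> clears f h F H"
  unfolding clears_def by blast

lemma clearsE:
  assumes "clears f h F H"
  obtains n c where "F \<in> adhm_polys" "H \<in> adhm_polys" "c \<noteq> 0"
    "\<And>x. frame_det x \<noteq> 0 \<Longrightarrow> F x = c * frame_det x ^ n * f (retr x)" "\<And>x. frame_det x \<noteq> 0 \<Longrightarrow> H x = c * frame_det x ^ n * h (retr x)"
  using assms unfolding clears_def by blast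

lemma regularE:
  assumes "f \<in> adhm_polys"
  obtains n F where "F \<in> adhm_polys" "\<And>x. frame_det x \<noteq> 0 \<Longrightarrow> F x = frame_det x ^ n * f (retr x)"
  using retr_regular[OF assms] unfolding localized_def by blast

lemma clears_exists:
  assumes "f \<in> adhm_polys" "h \<in> adhm_polys" shows "\<exists>F H. clears f h F H"
proof -
  obtain n F where F: "F \<in> adhm_polys" "\<And>x. frame_det x \<noteq> 0 \<Longrightarrow> F x = frame_det x ^ n * f (retr x)"
    by (rule regularE[OF assms(1)]) blast
  obtain m H where H: "H \<in> adhm_polys" "\<And>x. frame_det x \<noteq> 0 \<Longrightarrow> H x = frame_det x ^ m * h (retr x)"
    by (rule regularE[OF assms(2)]) blast
  have "clears f h (\<lambda>x. frame_det x ^ m * F x) (\<lambda>x. frame_det x ^ n * H x)"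
    by (rule clearsI[where n = "n + m" and c = 1])
      (use F(1) H(1) frame_det_polys in \<open>auto intro!: P.Q_mult P.Q_power\<close>, simp_all add: F(2) H(2) power_add)
  then show ?thesis by blast
qed

lemma frac_pair_clears:
  assumes "clears f h F H" "frame_det y \<noteq> 0" "h (retr y) \<noteq> 0" shows "frac_pair y F H"
  by (rule clearsE[OF assms(1)]) (use assms(2,3) in \<open>auto simp: frac_pair_def\<close>)

lemma adjugate_conjugate:
  fixes A :: "'k^'n^'n"
  assumes "det A \<noteq> 0"
  shows "(adjugate A ** M ** A) $ a $ b = det A * conjugate (matrix_inv A) M $ a $ b"
proof -
  have "invertible A" using assms by (simp add: invertible_det_nz)
  then show ?thesis unfolding conjugate_def
    by (simp add: matrix_inv_inv matrix_matrix_mult_def sum_distrib_left sum_distrib_right mult.assoc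
        flip: det_mult_matrix_inv[OF assms])
qed

lemma retr_ideal:
  fixes e :: "('k, 'v, 'w) adhm \<Rightarrow> 'k"
  assumes "e \<in> adhm_ideal"
  shows "\<exists>n. \<exists>E\<in>adhm_ideal. \<forall>x. frame_det x \<noteq> 0 \<longrightarrow> E x = frame_det x ^ n * e (retr x)"
proof -
  let ?P = "\<lambda>e E n. E \<in> adhm_ideal \<and> (\<forall>x. frame_det x \<noteq> 0 \<longrightarrow> E x = frame_det x ^ n * e (retr x))"
  let ?J = "{e \<in> adhm_polys. \<exists>n E. ?P e E n}"
  note I = ideal_of_polysD[OF adhm_ideal]
  have "ideal_of_polys ?J"
    unfolding ideal_of_polys_def
  proof (intro conjI ballI)
    show "?J \<subseteq> adhm_polys" by blast
    have "?P (\<lambda>x. 0) (\<lambda>x. 0) 0" using I(2) by simp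
    then show "(\<lambda>x. 0) \<in> ?J" using P.Q_const[of 0] by blast
  next
    fix f g :: "('k, 'v, 'w) adhm \<Rightarrow> 'k" assume "f \<in> ?J" "g \<in> ?J"
    then obtain n F m G where F: "f \<in> adhm_polys" "F \<in> adhm_ideal" "\<And>x. frame_det x \<noteq> 0 \<Longrightarrow> F x = frame_det x ^ n * f (retr x)"
      and G: "g \<in> adhm_polys" "G \<in> adhm_ideal" "\<And>x. frame_det x \<noteq> 0 \<Longrightarrow> G x = frame_det x ^ m * g (retr x)" by blast
    have "?P (\<lambda>x. f x + g x) (\<lambda>x. frame_det x ^ m * F x + frame_det x ^ n * G x) (n + m)"
      using I(3)[OF I(4)[OF P.Q_power[OF frame_det_polys] F(2)] I(4)[OF P.Q_power[OF frame_det_polys] G(2)]] F(3) G(3)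
      by (simp add: power_add algebra_simps)
    then show "(\<lambda>x. f x + g x) \<in> ?J" using P.Q_add[OF F(1) G(1)] by blast
  next
    fix f g :: "('k, 'v, 'w) adhm \<Rightarrow> 'k" assume f: "f \<in> adhm_polys" and "g \<in> ?J"
    then obtain m G where G: "g \<in> adhm_polys" "G \<in> adhm_ideal" "\<And>x. frame_det x \<noteq> 0 \<Longrightarrow> G x = frame_det x ^ m * g (retr x)" by blast
    obtain n F where F: "F \<in> adhm_polys" "\<And>x. frame_det x \<noteq> 0 \<Longrightarrow> F x = frame_det x ^ n * f (retr x)"
      by (rule regularE[OF f]) blast
    have "?P (\<lambda>x. f x * g x) (\<lambda>x. F x * G x) (n + m)"
      using I(4)[OF F(1) G(2)] F(2) G(3) by (simp add: power_add algebra_simps)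
    then show "(\<lambda>x. f x * g x) \<in> ?J" using P.Q_mult[OF f G(1)] by blast
  qed
  moreover have "moment_entries \<subseteq> ?J"
  proof
    fix f :: "('k, 'v, 'w) adhm \<Rightarrow> 'k" assume f: "f \<in> moment_entries"
    have key: "?P (\<lambda>x. M x $ a $ b) (\<lambda>x. (adjugate (frame iota x) ** M x ** frame iota x) $ a $ b) 1"
      if "\<And>a b. (\<lambda>x. M x $ a $ b) \<in> adhm_ideal"
        "\<And>g x. invertible g \<Longrightarrow> M (gl_act g x) = conjugate g (M x)"
      for M :: "('k, 'v, 'w) adhm \<Rightarrow> 'k^'v^'v" and a b
    proof
      show "(\<lambda>x. (adjugate (frame iota x) ** M x ** frame iota x) $ a $ b) \<in> adhm_ideal"
        by (intro moment_entries_conj[OF adhm_ideal] that(1) P.Q_adjugate frame_polys)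
      show "\<forall>x. frame_det x \<noteq> 0 \<longrightarrow> (adjugate (frame iota x) ** M x ** frame iota x) $ a $ b =
          frame_det x ^ 1 * M (retr x) $ a $ b"
      proof (intro allI impI)
        fix x assume frame_det: "frame_det x \<noteq> 0"
        then show "(adjugate (frame iota x) ** M x ** frame iota x) $ a $ b = frame_det x ^ 1 * M (retr x) $ a $ b"
          using adjugate_conjugate[of "frame iota x" "M x" a b]
            that(2)[OF invertible_matrix_inv[OF frame_det[unfolded invertible_frame]], of x]
          by (simp add: retr_def frame_det_def)
      qed
    qed
    have "\<exists>n E. ?P f E n"
    proof -
      have mem: "(\<lambda>x. fst (adhm_moment x) $ a $ b) \<in> adhm_ideal"
        "(\<lambda>x. fst (snd (adhm_moment x)) $ a $ b) \<in> adhm_ideal"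
        "(\<lambda>x. snd (snd (adhm_moment x)) $ a $ b) \<in> adhm_ideal" for a b
        using moment_entries_ideal unfolding moment_entries_def by auto
      consider a b where "f = (\<lambda>x. fst (adhm_moment x) $ a $ b)"
        | a b where "f = (\<lambda>x. fst (snd (adhm_moment x)) $ a $ b)"
        | a b where "f = (\<lambda>x. snd (snd (adhm_moment x)) $ a $ b)"
        using f unfolding moment_entries_def by blast
      then show ?thesis
      proof cases
        case (1 a b)
        then show ?thesis using key[OF mem(1) moment_gl_act(1)] by blast
      next
        case (2 a b)
        then show ?thesis using key[OF mem(2) moment_gl_act(2)] by blast
      next
        case (3 a b)
        then show ?thesis using key[OF mem(3) moment_gl_act(3)] by blast
      qed
    qed
    then show "f \<in> ?J" using f moment_entries_polys by blast
  qed
  ultimately have "adhm_ideal \<subseteq> ?J" by (rule adhm_ideal_minimal)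
  then show ?thesis using assms by blast
qed

text \<open>
  Fractions that agree on the slice modulo the ADHM ideal agree after pullback: the relation is
  transported along the projection and multiplied by a power of the determinant.
\<close>
lemma clears_frac_eq:
  assumes cl: "clears f h F H" "clears f' h' F' H'" and u: "u \<in> adhm_polys" and e: "e \<in> adhm_ideal"
    and eq: "\<And>y. frame iota y = mat 1 \<Longrightarrow> u y * (f y * h' y - f' y * h y) = e y"
    and y: "frame_det y \<noteq> 0" "u (retr y) \<noteq> 0" "h (retr y) \<noteq> 0" "h' (retr y) \<noteq> 0"
  shows "adhm_frac y F H = adhm_frac y F' H'"
proof -
  note p = frac_pair_clears[OF cl(1) y(1,3)] frac_pair_clears[OF cl(2) y(1,4)]
  obtain n c where F: "F \<in> adhm_polys" "H \<in> adhm_polys" "c \<noteq> 0"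
    "\<And>x. frame_det x \<noteq> 0 \<Longrightarrow> F x = c * frame_det x ^ n * f (retr x)" "\<And>x. frame_det x \<noteq> 0 \<Longrightarrow> H x = c * frame_det x ^ n * h (retr x)"
    by (rule clearsE[OF cl(1)]) blast
  obtain n' c' where F': "F' \<in> adhm_polys" "H' \<in> adhm_polys" "c' \<noteq> 0"
    "\<And>x. frame_det x \<noteq> 0 \<Longrightarrow> F' x = c' * frame_det x ^ n' * f' (retr x)" "\<And>x. frame_det x \<noteq> 0 \<Longrightarrow> H' x = c' * frame_det x ^ n' * h' (retr x)"
    by (rule clearsE[OF cl(2)]) blast
  obtain m U where U: "U \<in> adhm_polys" "\<And>x. frame_det x \<noteq> 0 \<Longrightarrow> U x = frame_det x ^ m * u (retr x)"
    by (rule regularE[OF u]) blast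
  obtain k E where E: "E \<in> adhm_ideal" "\<And>x. frame_det x \<noteq> 0 \<Longrightarrow> E x = frame_det x ^ k * e (retr x)"
    using retr_ideal[OF e] by blast
  let ?N = "m + n + n'"
  have "(\<lambda>x. (c * c' * frame_det x ^ Suc ?N) * E x) \<in> adhm_ideal"
    by (intro ideal_of_polysD(4)[OF adhm_ideal _ E(1)] P.Q_mult[OF P.Q_const] P.Q_power frame_det_polys)
  also have "(\<lambda>x. (c * c' * frame_det x ^ Suc ?N) * E x) =
      (\<lambda>x. (frame_det x ^ Suc k * U x) * (F x * H' x - F' x * H x))"
  proof
    fix x
    show "(c * c' * frame_det x ^ Suc ?N) * E x = (frame_det x ^ Suc k * U x) * (F x * H' x - F' x * H x)"
    proof (cases "frame_det x = 0")
      case False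
      have rhs: "(frame_det x ^ Suc k * U x) * (F x * H' x - F' x * H x) =
          (c * c' * frame_det x ^ Suc (k + ?N)) *
            (u (retr x) * (f (retr x) * h' (retr x) - f' (retr x) * h (retr x)))"
        unfolding U(2)[OF False] F(4,5)[OF False] F'(4,5)[OF False]
        by (simp add: power_add algebra_simps)
      show ?thesis
        unfolding rhs eq[OF frame_retr[OF False]] E(2)[OF False] by (simp add: power_add mult_ac)
    qed simp
  qed
  finally have "(\<lambda>x. (frame_det x ^ Suc k * U x) * (F x * H' x - F' x * H x)) \<in> local_ideal y"
    by (rule adhm_ideal_local)
  moreover have "(\<lambda>x. frame_det x ^ Suc k * U x) \<in> adhm_polys"
    by (intro P.Q_mult P.Q_power frame_det_polys U(1))
  moreover have "frame_det y ^ Suc k * U y \<noteq> 0" using y U(2) by simp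
  ultimately have "(\<lambda>x. F x * H' x - F' x * H x) \<in> local_ideal y"
    using local_ideal_cancel[OF _ _ cross_polys[OF p]] by blast
  then show ?thesis by (simp add: adhm_frac_eq_iff[OF p])
qed

definition num :: "(('k, 'v, 'w) adhm \<Rightarrow> 'k) \<Rightarrow> (('k, 'v, 'w) adhm \<Rightarrow> 'k) \<Rightarrow> ('k, 'v, 'w) adhm \<Rightarrow> 'k" where
  "num f h = (SOME F. \<exists>H. clears f h F H)"

definition den :: "(('k, 'v, 'w) adhm \<Rightarrow> 'k) \<Rightarrow> (('k, 'v, 'w) adhm \<Rightarrow> 'k) \<Rightarrow> ('k, 'v, 'w) adhm \<Rightarrow> 'k" where
  "den f h = (SOME H. clears f h (num f h) H)"

lemma clears_num_den: "f \<in> adhm_polys \<Longrightarrow> h \<in> adhm_polys \<Longrightarrow> clears f h (num f h) (den f h)"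
  using someI_ex[OF clears_exists[of f h]] unfolding den_def num_def by (rule someI_ex)

definition chart_open :: "(('k, 'v, 'w) adhm \<Rightarrow> 'k) \<Rightarrow> ('k, 'v, 'w) adhm set" where
  "chart_open h = {y \<in> fj_data. frame_det y \<noteq> 0 \<and> h (retr y) \<noteq> 0}"

definition frac_section :: "(('k, 'v, 'w) adhm \<Rightarrow> 'k) \<Rightarrow> (('k, 'v, 'w) adhm \<Rightarrow> 'k) \<Rightarrow>
    ('k, 'v, 'w) adhm \<Rightarrow> ('k, 'v, 'w) adhm_local" where
  "frac_section f h = (\<lambda>y\<in>chart_open h. adhm_frac y (num f h) (den f h))"

abbreviation p0 :: "('k, 'v, 'w) adhm set" where "p0 \<equiv> gl_orbit x0"

text \<open>
  The germ at the base orbit of the invariant section that restricts to \<open>f / h\<close> on the slice.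
\<close>
definition slice_germ :: "(('k, 'v, 'w) adhm \<Rightarrow> 'k) \<Rightarrow> (('k, 'v, 'w) adhm \<Rightarrow> 'k) \<Rightarrow>
    (('k, 'v, 'w) adhm set set \<times> (('k, 'v, 'w) adhm \<Rightarrow> ('k, 'v, 'w) adhm_local)) set" where
  "slice_germ f h = germ moduli p0 (gl_orbit ` chart_open h) (frac_section f h)"

lemma chart_open_gl_act: "invertible g \<Longrightarrow> gl_act g y \<in> chart_open h \<longleftrightarrow> y \<in> chart_open h"
  by (auto simp: chart_open_def fj_data_gl_act frame_det_gl_act retr_gl_act invertible_det_nz)

lemma orbit_preimage_chart_open: "orbit_preimage (gl_orbit ` chart_open h) = chart_open h"
proof (rule subset_antisym; rule subsetI)
  fix y assume "y \<in> orbit_preimage (gl_orbit ` chart_open h)"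
  then obtain z where z: "z \<in> chart_open h" "gl_orbit y = gl_orbit z" unfolding orbit_preimage_def by blast
  then obtain g where "invertible g" "y = gl_act g z" unfolding gl_orbit_eq_iff by blast
  then show "y \<in> chart_open h" using z(1) chart_open_gl_act by simp
next
  fix y assume "y \<in> chart_open h"
  then show "y \<in> orbit_preimage (gl_orbit ` chart_open h)"
    unfolding orbit_preimage_def chart_open_def by blast
qed

lemma openin_chart_open:
  assumes h: "h \<in> adhm_polys" shows "openin fj_topology (chart_open h)"
proof -
  note cl = clears_num_den[OF h h]
  obtain n c where F: "den h h \<in> adhm_polys" "c \<noteq> 0"
    "\<And>x. frame_det x \<noteq> 0 \<Longrightarrow> den h h x = c * frame_det x ^ n * h (retr x)"
    by (rule clearsE[OF cl]) blast
  have "chart_open h = {x \<in> fj_data. frame_det x * den h h x \<noteq> 0}"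
    using F(2,3) by (auto simp: chart_open_def)
  then show ?thesis using openin_principal[OF P.Q_mult[OF frame_det_polys F(1)]] by simp
qed

lemma openin_orbits_chart_open: "h \<in> adhm_polys \<Longrightarrow> openin moduli_topology (gl_orbit ` chart_open h)"
  unfolding openin_moduli_topology orbit_preimage_chart_open using openin_chart_open by (auto simp: chart_open_def)

lemma x0_chart_open: "h x0 \<noteq> 0 \<Longrightarrow> x0 \<in> chart_open h"
  using x0 frame_x0 by (simp add: chart_open_def frame_det_slice retr_slice)

lemma chart_open_mult: "chart_open (\<lambda>x. h x * k x) = chart_open h \<inter> chart_open k"
  by (auto simp: chart_open_def)

lemma frac_section_invariant:
  assumes "f \<in> adhm_polys" "h \<in> adhm_polys" "invertible g" "y \<in> chart_open h"
  shows "gl_pullback g (frac_section f h (gl_act g y)) = frac_section f h y"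
proof -
  note cl = clears_num_den[OF assms(1,2)]
  have y: "frame_det y \<noteq> 0" "h (retr y) \<noteq> 0" using assms(4) by (auto simp: chart_open_def)
  have gy: "gl_act g y \<in> chart_open h" using assms by (simp add: chart_open_gl_act)
  then have pair: "frac_pair (gl_act g y) (num f h) (den f h)"
    by (intro frac_pair_clears[OF cl]) (auto simp: chart_open_def)
  obtain n c where F: "num f h \<in> adhm_polys" "den f h \<in> adhm_polys" "c \<noteq> 0"
    "\<And>x. frame_det x \<noteq> 0 \<Longrightarrow> num f h x = c * frame_det x ^ n * f (retr x)"
    "\<And>x. frame_det x \<noteq> 0 \<Longrightarrow> den f h x = c * frame_det x ^ n * h (retr x)"
    by (rule clearsE[OF cl]) blast
  have g: "det g \<noteq> 0" using assms(3) by (simp add: invertible_det_nz)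
  have "clears f h (num f h \<circ> gl_act g) (den f h \<circ> gl_act g)"
    by (rule clearsI[where n = n and c = "c * det g ^ n"])
      (use F(1-3) g in \<open>auto simp: comp_def polys_gl_act frame_det_gl_act F(4,5) retr_gl_act[OF assms(3)] power_mult_distrib\<close>)
  then have "adhm_frac y (num f h \<circ> gl_act g) (den f h \<circ> gl_act g) = adhm_frac y (num f h) (den f h)"
    by (rule clears_frac_eq[OF _ cl P.Q_const[of 1] ideal_of_polysD(2)[OF adhm_ideal]])
      (use y in simp_all)
  then show ?thesis
    using gl_pullback_frac[OF assms(3) pair] gy assms(4) by (simp add: frac_section_def)
qed

lemma frac_section_carrier:
  assumes "f \<in> adhm_polys" "h \<in> adhm_polys"
  shows "frac_section f h \<in> carrier (moduli_sections (gl_orbit ` chart_open h))"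
proof -
  note cl = clears_num_den[OF assms]
  have "num f h \<in> adhm_polys" "den f h \<in> adhm_polys" using cl by (auto simp: clears_def)
  moreover have "den f h y \<noteq> 0" if "y \<in> chart_open h" for y
    using frac_pair_clears[OF cl, of y] that by (auto simp: frac_pair_def chart_open_def)
  moreover have "frac_section f h \<in> extensional (chart_open h)" by (simp add: frac_section_def)
  moreover have "frac_section f h y = adhm_frac y (num f h) (den f h)" if "y \<in> chart_open h" for y
    using that by (simp add: frac_section_def)
  ultimately have "\<exists>F\<in>adhm_polys. \<exists>H\<in>adhm_polys. \<exists>N. openin fj_topology N \<and> y \<in> N \<and> N \<subseteq> chart_open h \<and>
      (\<forall>z\<in>N. H z \<noteq> 0 \<and> frac_section f h z = adhm_frac z F H)" if "y \<in> chart_open h" for y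
    by - (rule bexI[where x = "num f h"], rule bexI[where x = "den f h"], rule exI[where x = "chart_open h"],
        use openin_chart_open[OF assms(2)] that in auto)
  then have "frac_section f h \<in> carrier (fj_sections (chart_open h))"
    using \<open>frac_section f h \<in> extensional (chart_open h)\<close> unfolding fj_sections_def by simp
  then show ?thesis
    using frac_section_invariant[OF assms] by (simp add: moduli_sections_def orbit_preimage_chart_open)
qed

lemma slice_germ_carrier:
  assumes "f \<in> adhm_polys" "h \<in> adhm_polys" "h x0 \<noteq> 0"
  shows "slice_germ f h \<in> carrier (stalk moduli p0)"
  using openin_orbits_chart_open[OF assms(2)] frac_section_carrier[OF assms(1,2)] x0_chart_open[of h] assms(3)
  unfolding stalk_def slice_germ_def by auto

lemma slice_germ_germ_eqI:
  assumes "k \<in> adhm_polys" "k x0 \<noteq> 0" "gl_orbit ` chart_open k \<subseteq> U \<inter> gl_orbit ` chart_open h"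
    and "\<And>y. y \<in> chart_open k \<Longrightarrow> s y = frac_section f h y"
  shows "germ moduli p0 U s = slice_germ f h"
  unfolding slice_germ_def
  by (rule germ_eqI[OF openin_orbits_chart_open[OF assms(1)]])
    (use assms x0_chart_open[of k] in \<open>auto simp: orbit_preimage_chart_open\<close>)

lemma slice_germ_eqI:
  assumes fh: "f \<in> adhm_polys" "h \<in> adhm_polys" "h x0 \<noteq> 0"
    and fh': "f' \<in> adhm_polys" "h' \<in> adhm_polys" "h' x0 \<noteq> 0"
    and u: "u \<in> adhm_polys" "u x0 \<noteq> 0" and e: "e \<in> adhm_ideal"
    and eq: "\<And>y. frame iota y = mat 1 \<Longrightarrow> u y * (f y * h' y - f' y * h y) = e y"
  shows "slice_germ f h = slice_germ f' h'"
proof -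
  let ?k = "\<lambda>x. u x * (h x * h' x)"
  have chart_open: "chart_open ?k = chart_open u \<inter> (chart_open h \<inter> chart_open h')" by (simp only: chart_open_mult)
  show ?thesis unfolding slice_germ_def[of f h]
  proof (rule slice_germ_germ_eqI[where k = ?k])
    show "?k \<in> adhm_polys" using fh fh' u by (intro P.Q_mult)
    show "?k x0 \<noteq> 0" using fh fh' u by simp
    show "gl_orbit ` chart_open ?k \<subseteq> gl_orbit ` chart_open h \<inter> gl_orbit ` chart_open h'" unfolding chart_open by blast
    fix y :: "('k, 'v, 'w) adhm" assume "y \<in> chart_open ?k"
    then have y: "y \<in> chart_open u" "y \<in> chart_open h" "y \<in> chart_open h'" unfolding chart_open by auto
    then show "frac_section f h y = frac_section f' h' y"
      using clears_frac_eq[OF clears_num_den[OF fh(1,2)] clears_num_den[OF fh'(1,2)] u(1) e eq, of y]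
      by (auto simp: frac_section_def chart_open_def)
  qed
qed

text \<open>
  Equal germs have numerators and denominators that agree on the points of the slice. The nilpotent part of
  the equality is not recorded.
\<close>
lemma slice_germ_eqD:
  assumes fh: "f \<in> adhm_polys" "h \<in> adhm_polys" "h x0 \<noteq> 0"
    and fh': "f' \<in> adhm_polys" "h' \<in> adhm_polys" "h' x0 \<noteq> 0"
    and eq: "slice_germ f h = slice_germ f' h'"
  obtains u where "u \<in> adhm_polys" "u x0 \<noteq> 0"
    "\<And>y. adhm_moment y = 0 \<Longrightarrow> frame iota y = mat 1 \<Longrightarrow> u y * (f y * h' y - f' y * h y) = 0"
proof -
  note cl = clears_num_den[OF fh(1,2)] clears_num_den[OF fh'(1,2)]
  have "frac_section f h x0 = frac_section f' h' x0"
    using eq[unfolded slice_germ_def] x0 openin_orbits_chart_open[OF fh'(2)] _ frac_section_carrier[OF fh'(1,2)]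
    by (rule germ_value) (use x0_chart_open fh' in auto)
  then have frac: "adhm_frac x0 (num f h) (den f h) = adhm_frac x0 (num f' h') (den f' h')"
    using x0_chart_open[of h] x0_chart_open[of h'] fh fh' by (simp add: frac_section_def)
  have pairs: "frac_pair x0 (num f h) (den f h)" "frac_pair x0 (num f' h') (den f' h')"
    using fh fh' frame_det_slice[OF frame_x0] retr_slice[OF frame_x0]
    by (auto intro!: frac_pair_clears[OF cl(1)] frac_pair_clears[OF cl(2)])
  obtain u where u: "u \<in> adhm_polys" "u x0 \<noteq> 0"
      "(\<lambda>y. u y * (num f h y * den f' h' y - num f' h' y * den f h y)) \<in> adhm_ideal"
    by (rule local_idealE[OF frac[unfolded adhm_frac_eq_iff[OF pairs]]])
  obtain n c where F: "c \<noteq> 0" "\<And>x. frame_det x \<noteq> 0 \<Longrightarrow> num f h x = c * frame_det x ^ n * f (retr x)"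
    "\<And>x. frame_det x \<noteq> 0 \<Longrightarrow> den f h x = c * frame_det x ^ n * h (retr x)"
    by (rule clearsE[OF cl(1)]) blast
  obtain n' c' where F': "c' \<noteq> 0" "\<And>x. frame_det x \<noteq> 0 \<Longrightarrow> num f' h' x = c' * frame_det x ^ n' * f' (retr x)"
    "\<And>x. frame_det x \<noteq> 0 \<Longrightarrow> den f' h' x = c' * frame_det x ^ n' * h' (retr x)"
    by (rule clearsE[OF cl(2)]) blast
  show thesis
  proof (rule that[OF u(1,2)])
    fix y :: "('k, 'v, 'w) adhm" assume y: "adhm_moment y = 0" "frame iota y = mat 1"
    have frame_det: "frame_det y = 1" by (rule frame_det_slice[OF y(2)])
    have "u y * (num f h y * den f' h' y - num f' h' y * den f h y) = 0"
      using adhm_ideal_vanishes[OF u(3) y(1)] .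
    then have "(c * c') * (u y * (f y * h' y - f' y * h y)) = 0"
      using F(2,3)[of y] F'(2,3)[of y] frame_det retr_slice[OF y(2)] by (simp add: algebra_simps)
    then show "u y * (f y * h' y - f' y * h y) = 0" using F(1) F'(1) by simp
  qed
qed

lemma clears_mult:
  assumes "clears f h F H" "clears f' h' F' H'"
  shows "clears (\<lambda>x. f x * f' x) (\<lambda>x. h x * h' x) (\<lambda>x. F x * F' x) (\<lambda>x. H x * H' x)"
proof -
  obtain n c where F: "F \<in> adhm_polys" "H \<in> adhm_polys" "c \<noteq> 0"
    "\<And>x. frame_det x \<noteq> 0 \<Longrightarrow> F x = c * frame_det x ^ n * f (retr x)" "\<And>x. frame_det x \<noteq> 0 \<Longrightarrow> H x = c * frame_det x ^ n * h (retr x)"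
    by (rule clearsE[OF assms(1)]) blast
  obtain n' c' where F': "F' \<in> adhm_polys" "H' \<in> adhm_polys" "c' \<noteq> 0"
    "\<And>x. frame_det x \<noteq> 0 \<Longrightarrow> F' x = c' * frame_det x ^ n' * f' (retr x)" "\<And>x. frame_det x \<noteq> 0 \<Longrightarrow> H' x = c' * frame_det x ^ n' * h' (retr x)"
    by (rule clearsE[OF assms(2)]) blast
  show ?thesis
    by (rule clearsI[where c = "c * c'" and n = "n + n'"])
      (use F(1-3) F'(1-3) in \<open>auto intro!: P.Q_mult simp: F(4,5) F'(4,5) power_add\<close>)
qed

lemma clears_add:
  assumes "clears f h F H" "clears f' h' F' H'"
  shows "clears (\<lambda>x. f x * h' x + f' x * h x) (\<lambda>x. h x * h' x)
    (\<lambda>x. F x * H' x + F' x * H x) (\<lambda>x. H x * H' x)"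
proof -
  obtain n c where F: "F \<in> adhm_polys" "H \<in> adhm_polys" "c \<noteq> 0"
    "\<And>x. frame_det x \<noteq> 0 \<Longrightarrow> F x = c * frame_det x ^ n * f (retr x)" "\<And>x. frame_det x \<noteq> 0 \<Longrightarrow> H x = c * frame_det x ^ n * h (retr x)"
    by (rule clearsE[OF assms(1)]) blast
  obtain n' c' where F': "F' \<in> adhm_polys" "H' \<in> adhm_polys" "c' \<noteq> 0"
    "\<And>x. frame_det x \<noteq> 0 \<Longrightarrow> F' x = c' * frame_det x ^ n' * f' (retr x)" "\<And>x. frame_det x \<noteq> 0 \<Longrightarrow> H' x = c' * frame_det x ^ n' * h' (retr x)"
    by (rule clearsE[OF assms(2)]) blast
  show ?thesis
    by (rule clearsI[where c = "c * c'" and n = "n + n'"])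
      (use F(1-3) F'(1-3) in \<open>auto intro!: P.Q_mult P.Q_add simp: F(4,5) F'(4,5) power_add algebra_simps\<close>)
qed

lemma clears_frac_unique:
  assumes cl: "clears f h F H" "clears f h F' H'" and y: "frame_det y \<noteq> 0" "h (retr y) \<noteq> 0"
  shows "adhm_frac y F H = adhm_frac y F' H'"
  by (rule clears_frac_eq[OF cl P.Q_const[of 1] ideal_of_polysD(2)[OF adhm_ideal]])
    (use y in simp_all)

lemma slice_germ_mult:
  assumes fh: "f \<in> adhm_polys" "h \<in> adhm_polys" "h x0 \<noteq> 0"
    and fh': "f' \<in> adhm_polys" "h' \<in> adhm_polys" "h' x0 \<noteq> 0"
  shows "slice_germ f h \<otimes>\<^bsub>stalk moduli p0\<^esub> slice_germ f' h' = slice_germ (\<lambda>x. f x * f' x) (\<lambda>x. h x * h' x)"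
proof -
  let ?f = "\<lambda>x. f x * f' x" and ?h = "\<lambda>x. h x * h' x"
  note cl = clears_num_den[OF fh(1,2)] clears_num_den[OF fh'(1,2)]
    clears_num_den[OF P.Q_mult[OF fh(1) fh'(1)] P.Q_mult[OF fh(2) fh'(2)]]
  have "slice_germ f h \<otimes>\<^bsub>stalk moduli p0\<^esub> slice_germ f' h' = germ moduli p0 (gl_orbit ` chart_open h \<inter> gl_orbit ` chart_open h')
      (\<lambda>x. frac_section f h x \<otimes>\<^bsub>adhm_local_ring x\<^esub> frac_section f' h' x)"
    unfolding slice_germ_def using fh fh' x0_chart_open
    by (intro stalk_mult openin_orbits_chart_open frac_section_carrier) auto
  also have "\<dots> = slice_germ ?f ?h"
  proof (rule slice_germ_germ_eqI[where k = ?h])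
    fix y :: "('k, 'v, 'w) adhm" assume y: "y \<in> chart_open ?h"
    then have y': "y \<in> chart_open h" "y \<in> chart_open h'" by (auto simp: chart_open_mult)
    have pairs: "frac_pair y (num f h) (den f h)" "frac_pair y (num f' h') (den f' h')"
      using y' by (auto intro!: frac_pair_clears[OF cl(1)] frac_pair_clears[OF cl(2)] simp: chart_open_def)
    have "adhm_frac y (\<lambda>x. num f h x * num f' h' x) (\<lambda>x. den f h x * den f' h' x) =
        adhm_frac y (num ?f ?h) (den ?f ?h)"
      using y' by (intro clears_frac_unique[OF clears_mult[OF cl(1,2)] cl(3)]) (auto simp: chart_open_def)
    then show "frac_section f h y \<otimes>\<^bsub>adhm_local_ring y\<^esub> frac_section f' h' y = frac_section ?f ?h y"
      using y y' by (simp add: frac_section_def local_mult[OF pairs])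
  qed (use fh fh' in \<open>auto simp: chart_open_mult intro!: P.Q_mult\<close>)
  finally show ?thesis .
qed

lemma slice_germ_add:
  assumes fh: "f \<in> adhm_polys" "h \<in> adhm_polys" "h x0 \<noteq> 0"
    and fh': "f' \<in> adhm_polys" "h' \<in> adhm_polys" "h' x0 \<noteq> 0"
  shows "slice_germ f h \<oplus>\<^bsub>stalk moduli p0\<^esub> slice_germ f' h' =
    slice_germ (\<lambda>x. f x * h' x + f' x * h x) (\<lambda>x. h x * h' x)"
proof -
  let ?f = "\<lambda>x. f x * h' x + f' x * h x" and ?h = "\<lambda>x. h x * h' x"
  note cl = clears_num_den[OF fh(1,2)] clears_num_den[OF fh'(1,2)]
    clears_num_den[OF P.Q_add[OF P.Q_mult[OF fh(1) fh'(2)] P.Q_mult[OF fh'(1) fh(2)]] P.Q_mult[OF fh(2) fh'(2)]]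
  have "slice_germ f h \<oplus>\<^bsub>stalk moduli p0\<^esub> slice_germ f' h' = germ moduli p0 (gl_orbit ` chart_open h \<inter> gl_orbit ` chart_open h')
      (\<lambda>x. frac_section f h x \<oplus>\<^bsub>adhm_local_ring x\<^esub> frac_section f' h' x)"
    unfolding slice_germ_def using fh fh' x0_chart_open
    by (intro stalk_add openin_orbits_chart_open frac_section_carrier) auto
  also have "\<dots> = slice_germ ?f ?h"
  proof (rule slice_germ_germ_eqI[where k = ?h])
    fix y :: "('k, 'v, 'w) adhm" assume y: "y \<in> chart_open ?h"
    then have y': "y \<in> chart_open h" "y \<in> chart_open h'" by (auto simp: chart_open_mult)
    have pairs: "frac_pair y (num f h) (den f h)" "frac_pair y (num f' h') (den f' h')"
      using y' by (auto intro!: frac_pair_clears[OF cl(1)] frac_pair_clears[OF cl(2)] simp: chart_open_def)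
    have "adhm_frac y (\<lambda>x. num f h x * den f' h' x + num f' h' x * den f h x) (\<lambda>x. den f h x * den f' h' x) =
        adhm_frac y (num ?f ?h) (den ?f ?h)"
      using y' by (intro clears_frac_unique[OF clears_add[OF cl(1,2)] cl(3)]) (auto simp: chart_open_def)
    then show "frac_section f h y \<oplus>\<^bsub>adhm_local_ring y\<^esub> frac_section f' h' y = frac_section ?f ?h y"
      using y y' by (simp add: frac_section_def local_add[OF pairs])
  qed (use fh fh' in \<open>auto simp: chart_open_mult intro!: P.Q_mult\<close>)
  finally show ?thesis .
qed

lemma slice_germ_const:
  assumes "\<And>y. s y = adhm_frac y (\<lambda>x. a) (\<lambda>x. 1)"
  shows "germ moduli p0 (topspace moduli_topology) (restrict s (orbit_preimage (topspace moduli_topology))) =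
    slice_germ (\<lambda>x. a) (\<lambda>x. 1)"
proof (rule slice_germ_germ_eqI[where k = "\<lambda>x. 1"])
  note poly = P.Q_const[of a] P.Q_const[of 1]
  have sub: "gl_orbit ` chart_open (\<lambda>x. 1) \<subseteq> topspace moduli_topology"
    by (rule openin_subset[OF openin_orbits_chart_open[OF poly(2)]])
  then show "gl_orbit ` chart_open (\<lambda>x. 1) \<subseteq> topspace moduli_topology \<inter> gl_orbit ` chart_open (\<lambda>x. 1)" by simp
  fix y :: "('k, 'v, 'w) adhm" assume y: "y \<in> chart_open (\<lambda>x. 1)"
  then have "y \<in> orbit_preimage (topspace moduli_topology)"
    using orbit_preimage_mono[OF sub] orbit_preimage_chart_open[of "\<lambda>x. 1"] by auto
  moreover have "clears (\<lambda>x. a) (\<lambda>x. 1) (\<lambda>x. a) (\<lambda>x. 1)"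
    by (rule clearsI[where n = 0 and c = 1, OF poly]) auto
  then have "adhm_frac y (\<lambda>x. a) (\<lambda>x. 1) = adhm_frac y (num (\<lambda>x. a) (\<lambda>x. 1)) (den (\<lambda>x. a) (\<lambda>x. 1))"
    using y by (intro clears_frac_unique[OF _ clears_num_den[OF poly]]) (auto simp: chart_open_def)
  ultimately show "restrict s (orbit_preimage (topspace moduli_topology)) y = frac_section (\<lambda>x. a) (\<lambda>x. 1) y"
    using y by (simp add: frac_section_def assms)
qed (simp_all add: P.Q_const)

lemma slice_germ_one: "\<one>\<^bsub>stalk moduli p0\<^esub> = slice_germ (\<lambda>x. 1) (\<lambda>x. 1)"
  using slice_germ_const[of "\<lambda>y. \<one>\<^bsub>adhm_local_ring y\<^esub>" 1]
  by (simp add: stalk_def moduli_sections_def fj_sections_def adhm_local_ring_def)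

lemma slice_germ_zero: "\<zero>\<^bsub>stalk moduli p0\<^esub> = slice_germ (\<lambda>x. 0) (\<lambda>x. 1)"
  using slice_germ_const[of "\<lambda>y. \<zero>\<^bsub>adhm_local_ring y\<^esub>" 0]
  by (simp add: stalk_def moduli_sections_def fj_sections_def adhm_local_ring_def)

end

section \<open>Invariant germs are determined on the slice\<close>

definition poly_funs :: "('k::field \<Rightarrow> 'k) set" where "poly_funs = range poly"

lemma poly_funs_subalgebra: "subalgebra (poly_funs :: ('k::field \<Rightarrow> 'k) set)"
  unfolding subalgebra_def poly_funs_def
proof (intro conjI ballI allI)
  show "(\<lambda>t. a) \<in> range poly" for a :: 'k by (rule range_eqI[of _ _ "[:a:]"]) (simp add: fun_eq_iff)
next
  fix f g :: "'k \<Rightarrow> 'k" assume "f \<in> range poly" "g \<in> range poly"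
  then obtain p q where "f = poly p" "g = poly q" by blast
  then have "(\<lambda>t. f t + g t) = poly (p + q)" "(\<lambda>t. f t * g t) = poly (p * q)"
    by (simp_all add: fun_eq_iff)
  then show "(\<lambda>t. f t + g t) \<in> range poly" "(\<lambda>t. f t * g t) \<in> range poly"
    by simp_all
qed

lemma poly_funs_id: "(\<lambda>t. t) \<in> poly_funs"
  unfolding poly_funs_def by (rule range_eqI[of _ _ "[:0, 1:]"]) (simp add: fun_eq_iff)

interpretation L: function_algebra poly_funs
  by standard (rule poly_funs_subalgebra)

text \<open>
  The coordinate ring of the general linear group: polynomials in the entries of a matrix and of its
  inverse.
\<close>
definition group_funs :: "('k::field^'n^'n \<Rightarrow> 'k) set" where
  "group_funs = alg ((\<Union>a b. {\<lambda>g. g $ a $ b}) \<union> (\<Union>a b. {\<lambda>g. matrix_inv g $ a $ b}))"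

lemma group_funs_gens: "(\<lambda>g. g $ a $ b) \<in> group_funs" "(\<lambda>g. matrix_inv g $ a $ b) \<in> group_funs"
  unfolding group_funs_def by (rule alg.gen, blast)+

interpretation G: function_algebra group_funs
  by standard (simp add: group_funs_def alg_subalgebra)

lemma group_funs_compose:
  assumes "m \<in> group_funs" and Q: "subalgebra Q"
    and gens: "\<And>a b. (\<lambda>y. T y $ a $ b) \<in> Q" "\<And>a b. (\<lambda>y. matrix_inv (T y) $ a $ b) \<in> Q"
  shows "(\<lambda>y. m (T y)) \<in> Q"
  using assms(1) unfolding group_funs_def
proof induction
  case (gen f)
  then show ?case using gens by blast
qed (use Q in \<open>auto simp: subalgebra_def\<close>)

lemma orbit_map_group_fun:
  assumes "f \<in> adhm_polys" shows "(\<lambda>g. f (gl_act g x)) \<in> group_funs"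
proof (rule polys_compose[OF assms G.Q])
  fix \<phi> :: "('a, 'b, 'c) adhm \<Rightarrow> 'a" assume "\<phi> \<in> adhm_coords"
  then show "(\<lambda>g. \<phi> (gl_act g x)) \<in> group_funs"
    by (rule coords_compose; simp add: conjugate_def; intro G.Q_matrix_mult group_funs_gens G.Q_const)
qed

text \<open>
  Regular functions on the group are determined on the open set \<open>w \<noteq> 0\<close>. The line from \<open>1\<close> to \<open>g\<close> meets the
  complement of this set, and the singular matrices, in finitely many points only, and the field is
  infinite.
\<close>
lemma group_fun_vanishes:
  fixes m w :: "'k::alg_closed_field^'n^'n \<Rightarrow> 'k"
  assumes m: "m \<in> group_funs" and w: "w \<in> group_funs" "w (mat 1) \<noteq> 0"
    and null: "\<And>g. invertible g \<Longrightarrow> w g \<noteq> 0 \<Longrightarrow> m g = 0" and g: "invertible g"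
  shows "m g = 0"
proof -
  define line where "line t = (\<chi> a b. (1 - t) * (if a = b then 1 else 0) + t * g $ a $ b)" for t :: 'k
  have line0: "line 0 = mat 1" and line1: "line 1 = g" by (auto simp: line_def vec_eq_iff mat_def)
  define d where "d t = det (line t)" for t
  have line_poly: "(\<lambda>t. line t $ a $ b) \<in> poly_funs" for a b
    unfolding line_def vec_lambda_beta by (intro L.Q_add L.Q_mult L.Q_diff L.Q_const poly_funs_id)
  have d_poly: "d \<in> poly_funs" unfolding d_def[abs_def] by (intro L.Q_det line_poly)
  then obtain pd where pd: "d = poly pd" by (auto simp: poly_funs_def)
  have reg: "(\<lambda>t. f (line t)) \<in> localized poly_funs d" if "f \<in> group_funs" for f
  proof (rule group_funs_compose[OF that L.localized_subalgebra[OF d_poly]])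
    show "(\<lambda>t. line t $ a $ b) \<in> localized poly_funs d" for a b
      by (rule localizedI[where n = 0, OF line_poly]) simp
    show "(\<lambda>t. matrix_inv (line t) $ a $ b) \<in> localized poly_funs d" for a b
      by (rule localizedI[where n = 1 and F = "\<lambda>t. adjugate (line t) $ a $ b"])
        (auto intro!: L.Q_adjugate line_poly simp: d_def det_mult_matrix_inv)
  qed
  obtain n F where F: "F \<in> poly_funs" "\<And>t. d t \<noteq> 0 \<Longrightarrow> F t = d t ^ n * m (line t)"
    by (rule localizedE[OF reg[OF m]]) blast
  obtain k H where H: "H \<in> poly_funs" "\<And>t. d t \<noteq> 0 \<Longrightarrow> H t = d t ^ k * w (line t)"
    by (rule localizedE[OF reg[OF w(1)]]) blast
  obtain pF where pF: "F = poly pF" using F(1) by (auto simp: poly_funs_def)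
  obtain pH where pH: "H = poly pH" using H(1) by (auto simp: poly_funs_def)
  have d0: "d 0 = 1" by (simp add: d_def line0)
  then have "poly (pd * pH) 0 \<noteq> 0" using H(2)[of 0] w(2) by (simp add: line0 pd[symmetric] pH[symmetric])
  then have "pd * pH \<noteq> 0" by force
  moreover have "poly pF t = 0" if "poly (pd * pH) t \<noteq> 0" for t
  proof -
    have dt: "d t \<noteq> 0" "H t \<noteq> 0" using that by (auto simp: pd pH)
    then have "w (line t) \<noteq> 0" using H(2)[of t] by auto
    moreover have "invertible (line t)" using dt(1) by (simp add: d_def invertible_det_nz)
    ultimately show ?thesis using null F(2)[OF dt(1)] by (simp add: pF)
  qed
  ultimately have "pF = 0" by (rule poly_eq_0_of_infinite)
  moreover have "d 1 \<noteq> 0" using g by (simp add: d_def line1 invertible_det_nz)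
  ultimately show ?thesis using F(2)[of 1] by (simp add: pF line1)
qed

text \<open>
  A list of pairs \<open>(m, c)\<close> stands for the element \<open>\<Sum> m \<otimes> c\<close> of the tensor product of the coordinate
  rings of the group and of the space of data, evaluated as a function of \<open>(g, y)\<close>.
\<close>
definition tensor :: "(('k::field^'v^'v \<Rightarrow> 'k) \<times> (('k, 'v::finite, 'w::finite) adhm \<Rightarrow> 'k)) list \<Rightarrow>
    ('k^'v^'v) \<times> ('k, 'v, 'w) adhm \<Rightarrow> 'k" where
  "tensor xs z = (\<Sum>(m, c)\<leftarrow>xs. m (fst z) * c (snd z))"

definition tensors :: "(('k::field^'v^'v) \<times> ('k, 'v::finite, 'w::finite) adhm \<Rightarrow> 'k) set" where
  "tensors = {tensor xs | xs. set xs \<subseteq> group_funs \<times> adhm_polys}"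

lemma tensor_simps: "tensor [] z = 0" "tensor ((m, c) # xs) z = m (fst z) * c (snd z) + tensor xs z"
  "tensor (xs @ ys) z = tensor xs z + tensor ys z"
  by (simp_all add: tensor_def)

lemma tensorsI: "set xs \<subseteq> group_funs \<times> adhm_polys \<Longrightarrow> f = tensor xs \<Longrightarrow> f \<in> tensors"
  unfolding tensors_def by blast

lemma tensors_subalgebra: "subalgebra tensors"
  unfolding subalgebra_def
proof (intro conjI ballI allI)
  show "(\<lambda>z. a) \<in> tensors" for a
    by (rule tensorsI[where xs = "[(\<lambda>g. a, \<lambda>y. 1)]"])
      (auto simp: tensor_simps fun_eq_iff intro: G.Q_const P.Q_const)
next
  fix f g :: "('k::field^'v^'v) \<times> ('k, 'v::finite, 'w::finite) adhm \<Rightarrow> 'k"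
  assume "f \<in> tensors" "g \<in> tensors"
  then obtain xs ys where xs: "set xs \<subseteq> group_funs \<times> adhm_polys" "f = tensor xs"
    and ys: "set ys \<subseteq> group_funs \<times> adhm_polys" "g = tensor ys"
    unfolding tensors_def by blast
  show "(\<lambda>z. f z + g z) \<in> tensors"
    by (rule tensorsI[where xs = "xs @ ys"]) (use xs ys in \<open>auto simp: tensor_simps fun_eq_iff\<close>)
  have scaled: "tensor (map (\<lambda>(m', c'). (\<lambda>g. m g * m' g, \<lambda>y. c y * c' y)) ys) z =
      m (fst z) * c (snd z) * tensor ys z" for m c and ys :: "(('k^'v^'v \<Rightarrow> 'k) \<times> (('k, 'v, 'w) adhm \<Rightarrow> 'k)) list" and z
    by (induction ys) (auto simp: tensor_simps algebra_simps)
  have "\<exists>zs. set zs \<subseteq> group_funs \<times> adhm_polys \<and> (\<lambda>z. tensor xs z * tensor ys z) = tensor zs"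
    using xs(1)
  proof (induction xs)
    case Nil
    show ?case by (intro exI[of _ "[]"]) (simp add: tensor_simps fun_eq_iff)
  next
    case (Cons x xs)
    obtain m c where x: "x = (m, c)" by fastforce
    obtain zs where zs: "set zs \<subseteq> group_funs \<times> adhm_polys" "(\<lambda>z. tensor xs z * tensor ys z) = tensor zs"
      using Cons by auto
    have zs': "tensor zs z = tensor xs z * tensor ys z" for z using zs(2) by (metis (no_types))
    show ?case
    proof (intro exI conjI)
      let ?zs = "map (\<lambda>(m', c'). (\<lambda>g. m g * m' g, \<lambda>y. c y * c' y)) ys @ zs"
      show "set ?zs \<subseteq> group_funs \<times> adhm_polys"
        using zs(1) ys(1) Cons.prems by (auto simp: x intro!: G.Q_mult P.Q_mult)
      show "(\<lambda>z. tensor (x # xs) z * tensor ys z) = tensor ?zs"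
        by (simp add: fun_eq_iff x tensor_simps scaled zs' distrib_right)
    qed
  qed
  then show "(\<lambda>z. f z * g z) \<in> tensors" using xs(2) ys(2) tensorsI by blast
qed

interpretation T: function_algebra tensors
  by standard (rule tensors_subalgebra)

lemma group_fun_tensor: "m \<in> group_funs \<Longrightarrow> (\<lambda>z. m (fst z)) \<in> tensors"
  by (rule tensorsI[where xs = "[(m, \<lambda>y. 1)]"]) (auto simp: tensor_simps fun_eq_iff intro: P.Q_const)

lemma poly_tensor: "c \<in> adhm_polys \<Longrightarrow> (\<lambda>z. c (snd z)) \<in> tensors"
  by (rule tensorsI[where xs = "[(\<lambda>g. 1, c)]"]) (auto simp: tensor_simps fun_eq_iff intro: G.Q_const)

lemma action_tensor:
  assumes "f \<in> adhm_polys" shows "(\<lambda>z. f (gl_act (fst z) (snd z))) \<in> tensors"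
proof (rule polys_compose[OF assms tensors_subalgebra])
  fix \<phi> :: "('a, 'b, 'c) adhm \<Rightarrow> 'a" assume "\<phi> \<in> adhm_coords"
  then show "(\<lambda>z. \<phi> (gl_act (fst z) (snd z))) \<in> tensors"
    by (rule coords_compose; simp add: conjugate_def;
        intro T.Q_matrix_mult group_fun_tensor[OF group_funs_gens(1)] group_fun_tensor[OF group_funs_gens(2)]
          poly_tensor[OF coords_polys(1)] poly_tensor[OF coords_polys(2)] poly_tensor[OF coords_polys(3)]
          poly_tensor[OF coords_polys(4)] poly_tensor[OF coords_polys(5)] poly_tensor[OF coords_polys(6)]
          poly_tensor[OF coords_polys(7)] poly_tensor[OF coords_polys(8)])
qed

lemma tensor_reduce:
  "tensor (map (\<lambda>(m', c'). (\<lambda>g. m' g - m g * (m' g0 / m g0), c')) ys) (g, y) =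
    tensor ys (g, y) - m g / m g0 * tensor ys (g0, y)"
proof (induction ys)
  case (Cons x ys)
  obtain a b where x: "x = (a, b)" by fastforce
  show ?case unfolding x list.map prod.case tensor_simps fst_conv snd_conv Cons.IH
    by (simp add: algebra_simps add_divide_distrib)
qed (simp add: tensor_simps)

context slice_chart begin

lemma group_fun_inverse_frame:
  assumes "m \<in> group_funs" shows "(\<lambda>y. m (matrix_inv (frame iota y))) \<in> chart_regular"
proof (rule group_funs_compose[OF assms chart_regular_subalgebra])
  show "(\<lambda>y. matrix_inv (frame iota y) $ a $ b) \<in> chart_regular" for a b by (rule inverse_frame_regular)
  show "(\<lambda>y. matrix_inv (matrix_inv (frame iota y)) $ a $ b) \<in> chart_regular" for a b
    by (rule localized_cong[OF polys_chart_regular[OF frame_polys[of iota a b]]])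
      (simp add: matrix_inv_inv invertible_frame)
qed

text \<open>
  This passes from constant group elements to the element \<open>g = (frame y)\<^sup>-\<^sup>1\<close> that varies with the point.
  A value at a single \<open>g0\<close> with \<open>m g0 \<noteq> 0\<close> expresses the coefficient \<open>c\<close> of \<open>m\<close> through the others modulo \<open>J\<close>.
  Eliminating it leaves a shorter element with the same property. If no such \<open>g0\<close> exists, then \<open>m\<close> vanishes
  on the whole group and its term disappears after the substitution.
\<close>
lemma tensor_substitution:
  assumes J: "ideal_of_polys J" and w: "w \<in> group_funs" "w (mat 1) \<noteq> 0"
    and "set xs \<subseteq> group_funs \<times> adhm_polys"
    and "\<And>g. invertible g \<Longrightarrow> w g \<noteq> 0 \<Longrightarrow> (\<lambda>y. tensor xs (g, y)) \<in> J"
  shows "\<exists>n. \<exists>F\<in>J. \<forall>y. frame_det y \<noteq> 0 \<longrightarrow> F y = frame_det y ^ n * tensor xs (matrix_inv (frame iota y), y)"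
  using assms(4,5)
proof (induction "length xs" arbitrary: xs)
  case 0
  then have "tensor xs z = 0" for z by (simp add: tensor_simps)
  then show ?case using ideal_of_polysD(2)[OF J] by (intro exI[of _ 0] bexI[of _ "\<lambda>y. 0"]) auto
next
  case (Suc l)
  obtain m c ys where xs: "xs = (m, c) # ys" using Suc(2) by (cases xs) auto
  have mc: "m \<in> group_funs" "c \<in> adhm_polys" "set ys \<subseteq> group_funs \<times> adhm_polys" "length ys = l"
    using Suc(2,3) by (auto simp: xs)
  show ?case
  proof (cases "\<forall>g. invertible g \<longrightarrow> w g \<noteq> 0 \<longrightarrow> m g = 0")
    case True
    have m0: "m g = 0" if "invertible g" for g
      by (rule group_fun_vanishes[OF mc(1) w _ that]) (use True in simp)
    have "(\<lambda>y. tensor ys (g, y)) \<in> J" if "invertible g" "w g \<noteq> 0" for g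
      using Suc(4)[OF that] m0[OF that(1)] by (simp add: xs tensor_simps)
    note IH = Suc(1)[OF mc(4)[symmetric] mc(3) this]
    have "tensor xs (matrix_inv (frame iota y), y) = tensor ys (matrix_inv (frame iota y), y)" if "frame_det y \<noteq> 0" for y
      using m0[OF invertible_matrix_inv[OF that[unfolded invertible_frame]]] by (simp add: xs tensor_simps)
    with IH show ?thesis by simp
  next
    case False
    then obtain g0 where g0: "invertible g0" "w g0 \<noteq> 0" "m g0 \<noteq> 0" by blast
    define j0 where "j0 = (\<lambda>y. tensor xs (g0, y))"
    have j0: "j0 \<in> J" unfolding j0_def by (rule Suc(4)[OF g0(1,2)])
    define zs where "zs = map (\<lambda>(m', c'). (\<lambda>g. m' g - m g * (m' g0 / m g0), c')) ys"
    have red: "tensor zs (g, y) = tensor xs (g, y) - m g / m g0 * j0 y" for g y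
    proof -
      have "m g / m g0 * (m g0 * c y + t) = m g * c y + m g / m g0 * t" for t
        using g0(3) by (simp add: distrib_left)
      then show ?thesis unfolding zs_def tensor_reduce j0_def xs tensor_simps by simp
    qed
    have "(\<lambda>y. tensor zs (g, y)) \<in> J" if "invertible g" "w g \<noteq> 0" for g
      unfolding red using ideal_of_polys_diff[OF J Suc(4)[OF that] ideal_of_polysD(4)[OF J P.Q_const j0]] .
    moreover have "set zs \<subseteq> group_funs \<times> adhm_polys"
    proof
      fix z assume "z \<in> set zs"
      then obtain m' c' where z: "(m', c') \<in> set ys" "z = (\<lambda>g. m' g - m g * (m' g0 / m g0), c')"
        unfolding zs_def by auto
      then have "m' \<in> group_funs" "c' \<in> adhm_polys" using mc(3) by auto
      then show "z \<in> group_funs \<times> adhm_polys"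
        unfolding z(2) by (intro SigmaI G.Q_diff G.Q_mult G.Q_const mc(1))
    qed
    moreover have "l = length zs" using mc(4) by (simp add: zs_def)
    ultimately have "\<exists>n. \<exists>F\<in>J. \<forall>y. frame_det y \<noteq> 0 \<longrightarrow> F y = frame_det y ^ n * tensor zs (matrix_inv (frame iota y), y)"
      by (intro Suc(1))
    then obtain n F where F: "F \<in> J" "\<And>y. frame_det y \<noteq> 0 \<Longrightarrow> F y = frame_det y ^ n * tensor zs (matrix_inv (frame iota y), y)"
      by blast
    obtain k M where M: "M \<in> adhm_polys" "\<And>y. frame_det y \<noteq> 0 \<Longrightarrow> M y = frame_det y ^ k * m (matrix_inv (frame iota y))"
      by (rule localizedE[OF group_fun_inverse_frame[OF mc(1)]]) blast
    let ?F = "\<lambda>y. frame_det y ^ k * F y + (frame_det y ^ n * M y * inverse (m g0)) * j0 y"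
    have "?F \<in> J"
      by (intro ideal_of_polysD(3)[OF J] ideal_of_polysD(4)[OF J _ F(1)] ideal_of_polysD(4)[OF J _ j0]
          P.Q_mult P.Q_power frame_det_polys M(1) P.Q_const)
    moreover have "?F y = frame_det y ^ (k + n) * tensor xs (matrix_inv (frame iota y), y)" if "frame_det y \<noteq> 0" for y
      unfolding F(2)[OF that] M(2)[OF that] red by (simp add: power_add divide_inverse algebra_simps)
    ultimately show ?thesis by (intro exI[of _ "k + n"] bexI[of _ ?F]) simp_all
  qed
qed

text \<open>
  Near the base point an invariant section is a fraction \<open>f / h\<close>, and invariance says that
  \<open>f (y) h (g y) - f (g y) h (y)\<close> is zero in the local ring at the base point for \<open>g\<close> near \<open>1\<close>. Comparing values
  at points would not suffice, because the local ring may have nilpotents; instead \<open>g\<close> is replaced by the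
  inverse frame of \<open>y\<close>, and the fraction becomes the pullback of its restriction to the slice.
\<close>
lemma germ_is_slice_germ:
  assumes U: "openin moduli_topology U" "p0 \<in> U" and s: "s \<in> carrier (moduli_sections U)"
  obtains f h where "f \<in> adhm_polys" "h \<in> adhm_polys" "h x0 \<noteq> 0" "germ moduli p0 U s = slice_germ f h"
proof -
  have inv: "gl_pullback g (s (gl_act g x)) = s x" if "x \<in> orbit_preimage U" "invertible g" for g x
    using s that by (simp add: moduli_sections_def)
  have x0U: "x0 \<in> orbit_preimage U" using U x0 by (simp add: orbit_preimage_def)
  have "s \<in> carrier (fj_sections (orbit_preimage U))" using s by (simp add: moduli_sections_def)
  then have "\<exists>f\<in>adhm_polys. \<exists>h\<in>adhm_polys. \<exists>N. openin fj_topology N \<and> x0 \<in> N \<and> N \<subseteq> orbit_preimage U \<and>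
      (\<forall>y\<in>N. h y \<noteq> 0 \<and> s y = adhm_frac y f h)"
    using x0U unfolding fj_sections_def by simp
  then obtain f h N where fh: "f \<in> adhm_polys" "h \<in> adhm_polys" and N: "openin fj_topology N" "x0 \<in> N"
      "N \<subseteq> orbit_preimage U" "\<And>y. y \<in> N \<Longrightarrow> h y \<noteq> 0" "\<And>y. y \<in> N \<Longrightarrow> s y = adhm_frac y f h"
    by blast
  obtain w where w: "w \<in> adhm_polys" "w x0 \<noteq> 0" "{y \<in> fj_data. w y \<noteq> 0} \<subseteq> N"
    by (rule principal_neighbourhood[OF N(1,2)])
  have hx0: "h x0 \<noteq> 0" by (rule N(4)[OF N(2)])
  have pair: "frac_pair y f h" if "y \<in> N" for y using fh N(4)[OF that] by (simp add: frac_pair_def)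
  let ?G = "\<lambda>z. f (snd z) * h (gl_act (fst z) (snd z)) - f (gl_act (fst z) (snd z)) * h (snd z)"
  have "?G \<in> tensors"
    by (intro T.Q_diff T.Q_mult action_tensor poly_tensor fh)
  then obtain xs where xs: "set xs \<subseteq> group_funs \<times> adhm_polys" "?G = tensor xs" unfolding tensors_def by blast
  have xs': "tensor xs (g, y) = f y * h (gl_act g y) - f (gl_act g y) * h y" for g y
    using fun_cong[OF xs(2), of "(g, y)"] by simp
  have "(\<lambda>y. tensor xs (g, y)) \<in> local_ideal x0" if g: "invertible g" and wg: "w (gl_act g x0) \<noteq> 0" for g
  proof -
    have "gl_act g x0 \<in> N" using w(3) wg x0 fj_data_gl_act[OF g] by blast
    note gN = N(5)[OF this] pair[OF this]
    have "adhm_frac x0 f h = adhm_frac x0 (f \<circ> gl_act g) (h \<circ> gl_act g)"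
      using inv[OF x0U g] gl_pullback_frac[OF g gN(2)] by (simp add: gN(1) N(5)[OF N(2)])
    then show ?thesis
      unfolding adhm_frac_eq_iff[OF pair[OF N(2)] frac_pair_gl_act[OF gN(2)]] xs' by simp
  qed
  then obtain n F where F: "F \<in> local_ideal x0"
      "\<And>y. frame_det y \<noteq> 0 \<Longrightarrow> F y = frame_det y ^ n * tensor xs (matrix_inv (frame iota y), y)"
    using tensor_substitution[OF local_ideal orbit_map_group_fun[OF w(1)] _ xs(1)] w(2) by fastforce
  obtain k c where cl: "num f h \<in> adhm_polys" "den f h \<in> adhm_polys" "c \<noteq> 0"
    "\<And>x. frame_det x \<noteq> 0 \<Longrightarrow> num f h x = c * frame_det x ^ k * f (retr x)" "\<And>x. frame_det x \<noteq> 0 \<Longrightarrow> den f h x = c * frame_det x ^ k * h (retr x)"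
    by (rule clearsE[OF clears_num_den[OF fh]]) blast
  have D0: "frame_det x0 = 1" by (rule frame_det_slice[OF frame_x0])
  have den0: "den f h x0 \<noteq> 0" using cl(3,5) hx0 D0 by (simp add: retr_slice[OF frame_x0])
  let ?C = "\<lambda>y. f y * den f h y - num f h y * h y"
  have "(\<lambda>y. frame_det y ^ Suc n * ?C y) = (\<lambda>y. (c * frame_det y ^ Suc k) * F y)"
  proof
    fix y
    show "frame_det y ^ Suc n * ?C y = (c * frame_det y ^ Suc k) * F y"
    proof (cases "frame_det y = 0")
      case False
      have Fy: "F y = frame_det y ^ n * (f y * h (retr y) - f (retr y) * h y)"
        unfolding F(2)[OF False] xs' retr_def ..
      show ?thesis unfolding Fy cl(4,5)[OF False] by (simp add: algebra_simps)
    qed simp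
  qed
  also have "\<dots> \<in> local_ideal x0"
    by (intro ideal_of_polysD(4)[OF local_ideal _ F(1)] P.Q_mult P.Q_const P.Q_power frame_det_polys)
  finally have "?C \<in> local_ideal x0"
    using D0 fh cl(1,2) by (intro local_ideal_cancel[of "\<lambda>y. frame_det y ^ Suc n" x0 ?C] P.Q_power frame_det_polys P.Q_diff P.Q_mult) auto
  then obtain u where u: "u \<in> adhm_polys" "u x0 \<noteq> 0" "\<And>y. u y \<noteq> 0 \<Longrightarrow> ?C \<in> local_ideal y"
    by (rule local_ideal_spread) blast
  define v where "v y = w y * (u y * (frame_det y * den f h y))" for y
  have v: "v \<in> adhm_polys" "v x0 \<noteq> 0"
    using w u den0 D0 unfolding v_def[abs_def] by (auto intro!: P.Q_mult frame_det_polys cl)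
  define N' where "N' = {y \<in> fj_data. v y \<noteq> 0}"
  have N': "y \<in> orbit_preimage U" "y \<in> chart_open h" "s y = frac_section f h y" if "y \<in> N'" for y
  proof -
    have y: "y \<in> fj_data" "w y \<noteq> 0" "u y \<noteq> 0" "frame_det y \<noteq> 0" "den f h y \<noteq> 0"
      using that by (auto simp: N'_def v_def)
    then have yN: "y \<in> N" using w(3) by blast
    then show "y \<in> orbit_preimage U" using N(3) by blast
    show yV: "y \<in> chart_open h" using y cl(5) by (auto simp: chart_open_def)
    have pair': "frac_pair y (num f h) (den f h)" using cl y by (simp add: frac_pair_def)
    have "adhm_frac y f h = adhm_frac y (num f h) (den f h)"
      using u(3)[OF y(3)] by (simp add: adhm_frac_eq_iff[OF pair[OF yN] pair'])
    then show "s y = frac_section f h y" using N(5)[OF yN] yV by (simp add: frac_section_def)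
  qed
  let ?W = "gl_orbit ` N'"
  have preW: "\<exists>g. invertible g \<and> gl_act g y \<in> N'" if y: "y \<in> orbit_preimage ?W" for y
  proof -
    obtain z where "z \<in> N'" "gl_orbit z = gl_orbit y" using y unfolding orbit_preimage_def by auto
    then show ?thesis unfolding gl_orbit_eq_iff by auto
  qed
  have "openin fj_topology (orbit_preimage ?W)"
  proof (rule openin_neighbourhoods)
    show "orbit_preimage ?W \<subseteq> fj_data" by (auto simp: orbit_preimage_def)
    fix y assume "y \<in> orbit_preimage ?W"
    then obtain g where g: "invertible g" "gl_act g y \<in> N'" using preW by blast
    show "\<exists>h\<in>adhm_polys. h y \<noteq> 0 \<and> {z \<in> fj_data. h z \<noteq> 0} \<subseteq> orbit_preimage ?W"
    proof (intro bexI[of _ "\<lambda>z. v (gl_act g z)"] conjI polys_gl_act v subsetI)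
      show "v (gl_act g y) \<noteq> 0" using g by (simp add: N'_def)
      fix z assume "z \<in> {z \<in> fj_data. v (gl_act g z) \<noteq> 0}"
      then have z: "z \<in> fj_data" "gl_act g z \<in> N'" using fj_data_gl_act[OF g(1)] by (auto simp: N'_def)
      then have "gl_orbit z \<in> ?W" using gl_orbit_gl_act[OF g(1), of z] by (metis imageI)
      then show "z \<in> orbit_preimage ?W" using z(1) by (simp add: orbit_preimage_def)
    qed
  qed
  then have W: "openin moduli_topology ?W" unfolding openin_moduli_topology by (auto simp: N'_def)
  have "germ moduli p0 U s = slice_germ f h" unfolding slice_germ_def
  proof (rule germ_eqI[OF W])
    show "p0 \<in> ?W" using v x0 by (simp add: N'_def)
    show "?W \<subseteq> U \<inter> gl_orbit ` chart_open h"
      using N'(1,2) by (auto simp: orbit_preimage_def)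
    fix y assume "y \<in> orbit_preimage ?W"
    then obtain g where g: "invertible g" "gl_act g y \<in> N'" using preW by blast
    have "y \<in> fj_data" using \<open>y \<in> orbit_preimage ?W\<close> by (simp add: orbit_preimage_def)
    then have yU: "y \<in> orbit_preimage U"
      using N'(1)[OF g(2)] gl_orbit_gl_act[OF g(1), of y] by (simp add: orbit_preimage_def)
    have yV: "y \<in> chart_open h" using N'(2)[OF g(2)] chart_open_gl_act[OF g(1)] by simp
    show "s y = frac_section f h y"
      using inv[OF yU g(1)] frac_section_invariant[OF fh g(1) yV] N'(3)[OF g(2)] by simp
  qed
  then show thesis using that fh hx0 by blast
qed

lemma stalk_elem:
  assumes "a \<in> carrier (stalk moduli p0)"
  obtains f h where "f \<in> adhm_polys" "h \<in> adhm_polys" "h x0 \<noteq> 0" "a = slice_germ f h"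
proof -
  obtain U s where "openin moduli_topology U" "p0 \<in> U" "s \<in> carrier (moduli_sections U)" "a = germ moduli p0 U s"
    using assms by (auto simp: stalk_def)
  then show thesis using germ_is_slice_germ[of U s] that by metis
qed

end

section \<open>Embedding dimension and Krull dimension of the stalk\<close>

definition line_poly :: "('k \<Rightarrow> 'x) \<Rightarrow> ('x \<Rightarrow> 'k::field) \<Rightarrow> 'k poly" where
  "line_poly l f = (SOME p. \<forall>t. poly p t = f (l t))"

lemma line_poly_eqI:
  fixes p :: "'k::alg_closed_field poly"
  assumes "\<And>t. poly p t = f (l t)" shows "line_poly l f = p"
proof -
  have "\<forall>t. poly (line_poly l f) t = f (l t)"
    unfolding line_poly_def by (rule someI[of _ p]) (simp add: assms)
  then have "line_poly l f - p = 0"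
    by (intro poly_eq_0_of_infinite[of 1]) (simp_all add: assms)
  then show ?thesis by simp
qed

text \<open>
  The functions in \<open>C\<close> have a dual family of lines through the base point, contained in the slice and
  in the zero locus of the moment map: moving along one line changes just one of the functions.
\<close>
locale tangent_chart = slice_chart iota x0
  for iota :: "'v::finite \<Rightarrow> 'w::finite" and x0 :: "('k::alg_closed_field, 'v, 'w) adhm" +
  fixes C :: "(('k, 'v, 'w) adhm \<Rightarrow> 'k) set" and l :: "(('k, 'v, 'w) adhm \<Rightarrow> 'k) \<Rightarrow> 'k \<Rightarrow> ('k, 'v, 'w) adhm"
  assumes C: "finite C" "C \<subseteq> adhm_polys"
    and l0: "\<And>z. z \<in> C \<Longrightarrow> l z 0 = x0"
    and l_moment: "\<And>z t. z \<in> C \<Longrightarrow> adhm_moment (l z t) = 0"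
    and l_frame: "\<And>z t. z \<in> C \<Longrightarrow> frame iota (l z t) = mat 1"
    and l_poly: "\<And>z f. z \<in> C \<Longrightarrow> f \<in> adhm_polys \<Longrightarrow> (\<lambda>t. f (l z t)) \<in> poly_funs"
    and l_dual: "\<And>z t. z \<in> C \<Longrightarrow> z (l z t) = z x0 + t"
      "\<And>z z' t. z \<in> C \<Longrightarrow> z' \<in> C \<Longrightarrow> z' \<noteq> z \<Longrightarrow> z' (l z t) = z' x0"
begin

abbreviation R where "R \<equiv> stalk moduli p0"

lemma poly_line_poly: "z \<in> C \<Longrightarrow> f \<in> adhm_polys \<Longrightarrow> poly (line_poly (l z) f) t = f (l z t)"
proof -
  assume "z \<in> C" "f \<in> adhm_polys"
  then obtain p where p: "\<And>t. poly p t = f (l z t)"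
    using l_poly[of z f] unfolding poly_funs_def by (auto simp: fun_eq_iff)
  then show ?thesis using line_poly_eqI[of p f "l z"] by simp
qed

definition deriv_along where "deriv_along z f = Polynomial.coeff (line_poly (l z) f) 1"

lemma coeff_line_poly_0: "z \<in> C \<Longrightarrow> f \<in> adhm_polys \<Longrightarrow> Polynomial.coeff (line_poly (l z) f) 0 = f x0"
  using poly_line_poly[of z f 0] l0[of z] by (simp add: poly_0_coeff_0)

lemma deriv_add:
  assumes "z \<in> C" "f \<in> adhm_polys" "g \<in> adhm_polys"
  shows "deriv_along z (\<lambda>x. f x + g x) = deriv_along z f + deriv_along z g"
proof -
  have "line_poly (l z) (\<lambda>x. f x + g x) = line_poly (l z) f + line_poly (l z) g"
    by (rule line_poly_eqI) (simp add: poly_line_poly assms)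
  then show ?thesis by (simp add: deriv_along_def)
qed

lemma deriv_mult:
  assumes "z \<in> C" "f \<in> adhm_polys" "g \<in> adhm_polys"
  shows "deriv_along z (\<lambda>x. f x * g x) = f x0 * deriv_along z g + deriv_along z f * g x0"
proof -
  have "line_poly (l z) (\<lambda>x. f x * g x) = line_poly (l z) f * line_poly (l z) g"
    by (rule line_poly_eqI) (simp add: poly_line_poly assms)
  then show ?thesis using coeff_line_poly_0 assms by (simp add: deriv_along_def Polynomial.coeff_mult)
qed

text \<open>
  All ideals of the stalk that are needed consist of the fractions with numerator in an ideal of
  polynomials.
\<close>
definition numerator_ideal where
  "numerator_ideal N = {slice_germ f h | f h. f \<in> N \<and> h \<in> adhm_polys \<and> h x0 \<noteq> 0}"

lemma numerator_ideal:
  assumes ring: "cring R" and N: "ideal_of_polys N"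
  shows "ideal (numerator_ideal N) R"
proof -
  interpret cring R by (rule ring)
  note NP = ideal_of_polysD(1)[OF N]
  have carr: "numerator_ideal N \<subseteq> carrier R"
    unfolding numerator_ideal_def using NP slice_germ_carrier by blast
  have mult: "x \<otimes>\<^bsub>R\<^esub> a \<in> numerator_ideal N" if "a \<in> numerator_ideal N" "x \<in> carrier R" for a x
  proof -
    obtain f h where a: "f \<in> N" "h \<in> adhm_polys" "h x0 \<noteq> 0" "a = slice_germ f h"
      using \<open>a \<in> _\<close> unfolding numerator_ideal_def by blast
    obtain g k where x: "g \<in> adhm_polys" "k \<in> adhm_polys" "k x0 \<noteq> 0" "x = slice_germ g k"
      by (rule stalk_elem[OF \<open>x \<in> _\<close>])
    have "x \<otimes>\<^bsub>R\<^esub> a = slice_germ (\<lambda>y. g y * f y) (\<lambda>y. k y * h y)"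
      unfolding a(4) x(4) using a x NP by (intro slice_germ_mult) auto
    moreover have "(\<lambda>y. g y * f y) \<in> N" by (rule ideal_of_polysD(4)[OF N x(1) a(1)])
    moreover have "(\<lambda>y. k y * h y) \<in> adhm_polys" by (rule P.Q_mult[OF x(2) a(2)])
    moreover have "k x0 * h x0 \<noteq> 0" using a x by simp
    ultimately show ?thesis unfolding numerator_ideal_def by blast
  qed
  have add: "a \<oplus>\<^bsub>R\<^esub> b \<in> numerator_ideal N" if "a \<in> numerator_ideal N" "b \<in> numerator_ideal N" for a b
  proof -
    obtain f h where a: "f \<in> N" "h \<in> adhm_polys" "h x0 \<noteq> 0" "a = slice_germ f h"
      using \<open>a \<in> _\<close> unfolding numerator_ideal_def by blast
    obtain g k where b: "g \<in> N" "k \<in> adhm_polys" "k x0 \<noteq> 0" "b = slice_germ g k"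
      using \<open>b \<in> _\<close> unfolding numerator_ideal_def by blast
    have "a \<oplus>\<^bsub>R\<^esub> b = slice_germ (\<lambda>y. f y * k y + g y * h y) (\<lambda>y. h y * k y)"
      unfolding a(4) b(4) using a b NP by (intro slice_germ_add) auto
    moreover have "(\<lambda>y. f y * k y + g y * h y) \<in> N"
      by (intro ideal_of_polysD(3)[OF N] ideal_of_polysD(5)[OF N] a b)
    moreover have "(\<lambda>y. h y * k y) \<in> adhm_polys" by (rule P.Q_mult[OF a(2) b(2)])
    moreover have "h x0 * k x0 \<noteq> 0" using a b by simp
    ultimately show ?thesis unfolding numerator_ideal_def by blast
  qed
  show ?thesis
  proof (rule idealI)
    show "ring R" by (rule ring_axioms)
    show "subgroup (numerator_ideal N) (add_monoid R)"
    proof (rule subgroup.intro)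
      show "\<one>\<^bsub>add_monoid R\<^esub> \<in> numerator_ideal N"
        using ideal_of_polysD(2)[OF N] P.Q_const[of 1] unfolding numerator_ideal_def
        by (simp add: slice_germ_zero) (rule exI[of _ "\<lambda>x. 0"], rule exI[of _ "\<lambda>x. 1"], simp)
      show "inv\<^bsub>add_monoid R\<^esub> a \<in> numerator_ideal N" if "a \<in> numerator_ideal N" for a
      proof -
        have aR: "a \<in> carrier R" using that carr by blast
        have "(\<ominus>\<^bsub>R\<^esub> \<one>\<^bsub>R\<^esub>) \<otimes>\<^bsub>R\<^esub> a \<in> numerator_ideal N" by (rule mult[OF that]) simp
        also have "(\<ominus>\<^bsub>R\<^esub> \<one>\<^bsub>R\<^esub>) \<otimes>\<^bsub>R\<^esub> a = \<ominus>\<^bsub>R\<^esub> a" using aR by (simp add: l_minus)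
        finally show ?thesis unfolding a_inv_def .
      qed
    qed (use carr add in auto)
  next
    fix a x assume ax: "a \<in> numerator_ideal N" "x \<in> carrier R"
    show "x \<otimes>\<^bsub>R\<^esub> a \<in> numerator_ideal N" by (rule mult[OF ax])
    then show "a \<otimes>\<^bsub>R\<^esub> x \<in> numerator_ideal N" using ax carr m_comm[of a x] by auto
  qed
qed

abbreviation point_ideal where "point_ideal \<equiv> {f \<in> adhm_polys. f x0 = 0}"

lemma point_ideal: "ideal_of_polys point_ideal"
  unfolding ideal_of_polys_def by (auto simp: P.Q_const P.Q_add P.Q_mult)

lemma slice_germ_unit:
  assumes "f \<in> adhm_polys" "f x0 \<noteq> 0" "h \<in> adhm_polys" "h x0 \<noteq> 0"
  shows "slice_germ h f \<otimes>\<^bsub>R\<^esub> slice_germ f h = \<one>\<^bsub>R\<^esub>"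
proof -
  have "slice_germ h f \<otimes>\<^bsub>R\<^esub> slice_germ f h = slice_germ (\<lambda>x. h x * f x) (\<lambda>x. f x * h x)"
    using assms by (intro slice_germ_mult) auto
  also have "\<dots> = slice_germ (\<lambda>x. 1) (\<lambda>x. 1)"
    by (rule slice_germ_eqI[where u = "\<lambda>x. 1" and e = "\<lambda>x. 0"])
      (use assms ideal_of_polysD(2)[OF adhm_ideal] in \<open>auto intro!: P.Q_mult P.Q_const\<close>)
  finally show ?thesis by (simp add: slice_germ_one)
qed

lemma maximal_point_ideal:
  assumes ring: "cring R" shows "maximalideal (numerator_ideal point_ideal) R"
proof (rule maximalidealI)
  interpret cring R by (rule ring)
  show "ideal (numerator_ideal point_ideal) R" by (rule numerator_ideal[OF ring point_ideal])
  have "\<one>\<^bsub>R\<^esub> \<notin> numerator_ideal point_ideal"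
  proof
    assume "\<one>\<^bsub>R\<^esub> \<in> numerator_ideal point_ideal"
    then obtain f h where fh: "f \<in> adhm_polys" "f x0 = 0" "h \<in> adhm_polys" "h x0 \<noteq> 0" "slice_germ (\<lambda>x. 1) (\<lambda>x. 1) = slice_germ f h"
      unfolding numerator_ideal_def slice_germ_one by blast
    obtain u where u: "u x0 \<noteq> 0"
      "\<And>y. adhm_moment y = 0 \<Longrightarrow> frame iota y = mat 1 \<Longrightarrow> u y * (1 * h y - f y * 1) = 0"
      by (rule slice_germ_eqD[OF P.Q_const[of 1] P.Q_const[of 1] _ fh(1,3,4,5)]) (simp, blast)
    have "adhm_moment x0 = 0" using x0 by (simp add: fj_data_def)
    from u(2)[OF this frame_x0] show False using u(1) fh by simp
  qed
  then show "carrier R \<noteq> numerator_ideal point_ideal" by auto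
next
  interpret cring R by (rule ring)
  fix J assume J: "ideal J R" "numerator_ideal point_ideal \<subseteq> J" "J \<subseteq> carrier R"
  interpret J: ideal J R by (rule J(1))
  show "J = numerator_ideal point_ideal \<or> J = carrier R"
  proof (cases "J \<subseteq> numerator_ideal point_ideal")
    case False
    then obtain a where a: "a \<in> J" "a \<notin> numerator_ideal point_ideal" by blast
    have "a \<in> carrier R" using a(1) J(3) by blast
    then obtain f h where fh: "f \<in> adhm_polys" "h \<in> adhm_polys" "h x0 \<noteq> 0" "a = slice_germ f h"
      by (rule stalk_elem)
    have f0: "f x0 \<noteq> 0" using a(2) fh unfolding numerator_ideal_def by blast
    have "slice_germ h f \<otimes>\<^bsub>R\<^esub> a \<in> J" using a(1) slice_germ_carrier[OF fh(2,1) f0] by (rule J.I_l_closed)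
    then show ?thesis using slice_germ_unit[OF fh(1) f0 fh(2,3)] J.one_imp_carrier by (simp add: fh(4))
  qed (use J(2) in blast)
qed

text \<open>
  With fewer generators than tangent directions, some tangent vector is orthogonal to all generators, hence
  to the whole maximal ideal. But the maximal ideal contains the functions in \<open>C\<close>, shifted to
  vanish at the base point, and these are dual to the tangent directions.
\<close>
theorem generators_bound:
  assumes ring: "cring R" and unique: "\<exists>!m. maximalideal m R"
    and S: "S \<subseteq> carrier R" "finite S" "maximalideal (Idl\<^bsub>R\<^esub> S) R"
  shows "card C \<le> card S"
proof (rule ccontr)
  assume "\<not> card C \<le> card S"
  interpret cring R by (rule ring)
  have gen: "Idl\<^bsub>R\<^esub> S = numerator_ideal point_ideal"
    using unique S(3) maximal_point_ideal[OF ring] by blast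
  have "S \<subseteq> numerator_ideal point_ideal" using genideal_self[OF S(1)] unfolding gen .
  then have "\<forall>s\<in>S. \<exists>f. f \<in> point_ideal \<and> (\<exists>h\<in>adhm_polys. h x0 \<noteq> 0 \<and> s = slice_germ f h)"
    unfolding numerator_ideal_def by blast
  from bchoice[OF this] obtain F where F: "\<And>s. s \<in> S \<Longrightarrow> F s \<in> point_ideal"
      "\<And>s. s \<in> S \<Longrightarrow> \<exists>h\<in>adhm_polys. h x0 \<noteq> 0 \<and> s = slice_germ (F s) h" by blast
  obtain c where c: "\<exists>z\<in>C. c z \<noteq> 0" "\<forall>s\<in>S. (\<Sum>z\<in>C. c z * deriv_along z (F s)) = 0"
    using nontrivial_linear_relation[OF S(2) C(1), of "\<lambda>z s. deriv_along z (F s)"] \<open>\<not> card C \<le> card S\<close>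
    by auto
  define N where "N = {f \<in> point_ideal. (\<Sum>z\<in>C. c z * deriv_along z f) = 0}"
  have N: "ideal_of_polys N"
    unfolding ideal_of_polys_def
  proof (intro conjI ballI)
    show "N \<subseteq> adhm_polys" unfolding N_def by blast
    have "line_poly (l z) (\<lambda>x. 0) = 0" for z by (rule line_poly_eqI) simp
    then show "(\<lambda>x. 0) \<in> N" unfolding N_def by (simp add: P.Q_const deriv_along_def)
  next
    fix f g :: "('k, 'v, 'w) adhm \<Rightarrow> 'k" assume "f \<in> N" "g \<in> N"
    then show "(\<lambda>x. f x + g x) \<in> N"
      unfolding N_def by (simp add: P.Q_add deriv_add distrib_left sum.distrib)
  next
    fix f g :: "('k, 'v, 'w) adhm \<Rightarrow> 'k" assume f: "f \<in> adhm_polys" and g: "g \<in> N"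
    have "c z * deriv_along z (\<lambda>x. f x * g x) = f x0 * (c z * deriv_along z g)" if "z \<in> C" for z
      using f g that unfolding N_def by (simp add: deriv_mult)
    then have "(\<Sum>z\<in>C. c z * deriv_along z (\<lambda>x. f x * g x)) = f x0 * (\<Sum>z\<in>C. c z * deriv_along z g)"
      unfolding sum_distrib_left by (rule sum.cong[OF refl])
    then show "(\<lambda>x. f x * g x) \<in> N" using f g unfolding N_def by (simp add: P.Q_mult)
  qed
  have "S \<subseteq> numerator_ideal N"
  proof
    fix s assume s: "s \<in> S"
    then have "F s \<in> N" using F(1) c(2) unfolding N_def by blast
    then show "s \<in> numerator_ideal N" using F(2)[OF s] unfolding numerator_ideal_def by blast
  qed
  then have sub: "numerator_ideal point_ideal \<subseteq> numerator_ideal N"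
    unfolding gen[symmetric] by (rule genideal_minimal[OF numerator_ideal[OF ring N]])
  have "c z = 0" if z: "z \<in> C" for z
  proof -
    have zP: "z \<in> adhm_polys" using z C by blast
    let ?z = "\<lambda>x. z x - z x0"
    have zP': "?z \<in> adhm_polys" by (intro P.Q_diff zP P.Q_const)
    then have "slice_germ ?z (\<lambda>x. 1) \<in> numerator_ideal point_ideal"
      unfolding numerator_ideal_def
      by - (rule CollectI, rule exI[of _ ?z], rule exI[of _ "\<lambda>x. 1"], simp add: P.Q_const)
    then obtain f h where fh: "f \<in> N" "h \<in> adhm_polys" "h x0 \<noteq> 0" "slice_germ ?z (\<lambda>x. 1) = slice_germ f h"
      using sub unfolding numerator_ideal_def by blast
    have fP: "f \<in> adhm_polys" using fh(1) unfolding N_def by blast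
    obtain u where u: "u \<in> adhm_polys" "u x0 \<noteq> 0"
      "\<And>y. adhm_moment y = 0 \<Longrightarrow> frame iota y = mat 1 \<Longrightarrow> u y * (?z y * h y - f y * 1) = 0"
      by (rule slice_germ_eqD[OF zP' P.Q_const[of 1] _ fP fh(2,3,4)]) (simp, blast)
    have "deriv_along z' f = (if z' = z then h x0 else 0)" if z': "z' \<in> C" for z'
    proof -
      let ?p = "line_poly (l z')"
      let ?q = "if z' = z then [:0, 1:] else 0 :: 'k poly"
      have q: "poly ?q t = ?z (l z' t)" for t
        using l_dual(1)[OF z, of t] l_dual(2)[OF z' z, of t] by auto
      have "poly (?p u * (?q * ?p h - ?p f)) t = 0" for t
        unfolding poly_mult poly_diff q poly_line_poly[OF z' u(1)] poly_line_poly[OF z' fh(2)]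
          poly_line_poly[OF z' fP]
        using u(3)[OF l_moment[OF z'] l_frame[OF z'], of t] by simp
      then have "?p u * (?q * ?p h - ?p f) = 0"
        by (intro poly_eq_0_of_infinite[of 1]) simp_all
      moreover have "?p u \<noteq> 0" using coeff_line_poly_0[OF z' u(1)] u(2) by auto
      ultimately have "?p f = ?q * ?p h" by simp
      then show ?thesis using coeff_line_poly_0[OF z' fh(2)]
        by (auto simp: deriv_along_def)
    qed
    then have "(\<Sum>z'\<in>C. c z' * deriv_along z' f) = (\<Sum>z'\<in>C. if z' = z then c z' * h x0 else 0)"
      by (intro sum.cong) auto
    also have "\<dots> = c z * h x0" using z C(1) by simp
    finally show ?thesis using fh(1,3) unfolding N_def by simp
  qed
  then show False using c(1) by blast
qed

definition pull where "pull P = {f \<in> adhm_polys. slice_germ f (\<lambda>x. 1) \<in> P}"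

lemma slice_germ_one_den: "f \<in> adhm_polys \<Longrightarrow> slice_germ f (\<lambda>x. 1) \<in> carrier R"
  by (intro slice_germ_carrier P.Q_const) simp_all

lemma slice_germ_one_add: "f \<in> adhm_polys \<Longrightarrow> g \<in> adhm_polys \<Longrightarrow>
    slice_germ f (\<lambda>x. 1) \<oplus>\<^bsub>R\<^esub> slice_germ g (\<lambda>x. 1) = slice_germ (\<lambda>x. f x + g x) (\<lambda>x. 1)"
  using slice_germ_add[of f "\<lambda>x. 1" g "\<lambda>x. 1"] P.Q_const[of 1] by simp

lemma slice_germ_one_mult: "f \<in> adhm_polys \<Longrightarrow> g \<in> adhm_polys \<Longrightarrow>
    slice_germ f (\<lambda>x. 1) \<otimes>\<^bsub>R\<^esub> slice_germ g (\<lambda>x. 1) = slice_germ (\<lambda>x. f x * g x) (\<lambda>x. 1)"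
  using slice_germ_mult[of f "\<lambda>x. 1" g "\<lambda>x. 1"] P.Q_const[of 1] by simp

context
  fixes P assumes P: "primeideal P R"
begin

interpretation primeideal P R by (rule P)

lemma zero_in_prime: "\<zero>\<^bsub>R\<^esub> \<in> P"
  by (rule additive_subgroup.zero_closed[OF is_additive_subgroup])

lemma one_not_in_prime: "\<one>\<^bsub>R\<^esub> \<notin> P"
  using I_notcarr one_imp_carrier by auto

lemma pull_prime: "prime_in adhm_polys (pull P)"
  unfolding prime_in_def pull_def
proof (intro conjI ballI impI)
  show "(\<lambda>x. 0) \<in> {f \<in> adhm_polys. slice_germ f (\<lambda>x. 1) \<in> P}"
    using zero_in_prime by (simp add: P.Q_const slice_germ_zero)
  show "(\<lambda>x. 1) \<notin> {f \<in> adhm_polys. slice_germ f (\<lambda>x. 1) \<in> P}"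
    using one_not_in_prime by (simp add: slice_germ_one)
next
  fix f g :: "('k, 'v, 'w) adhm \<Rightarrow> 'k" assume "f \<in> {f \<in> adhm_polys. slice_germ f (\<lambda>x. 1) \<in> P}" "g \<in> {f \<in> adhm_polys. slice_germ f (\<lambda>x. 1) \<in> P}"
  then show "(\<lambda>x. f x + g x) \<in> {f \<in> adhm_polys. slice_germ f (\<lambda>x. 1) \<in> P}"
    using a_closed by (auto simp: P.Q_add simp flip: slice_germ_one_add)
next
  fix f g :: "('k, 'v, 'w) adhm \<Rightarrow> 'k" assume "f \<in> adhm_polys" "g \<in> {f \<in> adhm_polys. slice_germ f (\<lambda>x. 1) \<in> P}"
  then show "(\<lambda>x. f x * g x) \<in> {f \<in> adhm_polys. slice_germ f (\<lambda>x. 1) \<in> P}"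
    using I_l_closed slice_germ_one_den by (auto simp: P.Q_mult simp flip: slice_germ_one_mult)
next
  fix f g :: "('k, 'v, 'w) adhm \<Rightarrow> 'k" assume "f \<in> adhm_polys" "g \<in> adhm_polys" "(\<lambda>x. f x * g x) \<in> {f \<in> adhm_polys. slice_germ f (\<lambda>x. 1) \<in> P}"
  then show "f \<in> {f \<in> adhm_polys. slice_germ f (\<lambda>x. 1) \<in> P} \<or> g \<in> {f \<in> adhm_polys. slice_germ f (\<lambda>x. 1) \<in> P}"
    using I_prime[OF slice_germ_one_den slice_germ_one_den, of f g] by (auto simp: slice_germ_one_mult)
qed blast

lemma pull_mem:
  assumes "f \<in> adhm_polys" "e \<in> adhm_ideal" "\<And>y. frame iota y = mat 1 \<Longrightarrow> f y = e y"
  shows "f \<in> pull P"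
proof -
  have "slice_germ f (\<lambda>x. 1) = slice_germ (\<lambda>x. 0) (\<lambda>x. 1)"
    by (rule slice_germ_eqI[where u = "\<lambda>x. 1" and e = e]) (use assms in \<open>auto intro: P.Q_const\<close>)
  then show ?thesis using assms(1) zero_in_prime by (simp add: pull_def slice_germ_zero)
qed

lemma pull_vanishes: "f \<in> pull P \<Longrightarrow> f x0 = 0"
proof (rule ccontr)
  assume f: "f \<in> pull P" "f x0 \<noteq> 0"
  then have fP: "f \<in> adhm_polys" "slice_germ f (\<lambda>x. 1) \<in> P" by (auto simp: pull_def)
  have "slice_germ (\<lambda>x. 1) f \<otimes>\<^bsub>R\<^esub> slice_germ f (\<lambda>x. 1) \<in> P"
    using fP f(2) by (intro I_l_closed slice_germ_carrier P.Q_const)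
  then show False using slice_germ_unit[OF fP(1) f(2) P.Q_const[of 1]] one_not_in_prime by simp
qed

text \<open>
  Denominators do not vanish at the base point, so they are units of the stalk; a prime of the stalk is
  therefore known from the polynomials that it contains.
\<close>
lemma pull_denominator:
  assumes "f \<in> adhm_polys" "h \<in> adhm_polys" "h x0 \<noteq> 0"
  shows "slice_germ f h \<in> P \<longleftrightarrow> f \<in> pull P"
proof -
  have "slice_germ h (\<lambda>x. 1) \<otimes>\<^bsub>R\<^esub> slice_germ f h = slice_germ (\<lambda>x. h x * f x) (\<lambda>x. 1 * h x)"
    using assms by (intro slice_germ_mult P.Q_const) auto
  also have "\<dots> = slice_germ f (\<lambda>x. 1)"
    by (rule slice_germ_eqI[where u = "\<lambda>x. 1" and e = "\<lambda>x. 0"])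
      (use assms ideal_of_polysD(2)[OF adhm_ideal] in \<open>auto intro!: P.Q_mult P.Q_const\<close>)
  finally have eq: "slice_germ h (\<lambda>x. 1) \<otimes>\<^bsub>R\<^esub> slice_germ f h = slice_germ f (\<lambda>x. 1)" .
  have carr: "slice_germ h (\<lambda>x. 1) \<in> carrier R" "slice_germ f h \<in> carrier R"
    using assms by (auto intro!: slice_germ_carrier P.Q_const)
  have "h \<notin> pull P" using pull_vanishes assms(3) by blast
  then have "slice_germ h (\<lambda>x. 1) \<notin> P" using assms(2) by (simp add: pull_def)
  then show ?thesis using I_l_closed[OF _ carr(1), of "slice_germ f h"] I_prime[OF carr] assms(1) eq
    by (auto simp: pull_def)
qed

end

text \<open>
  The primes that define irreducible closed subsets of the slice through the base point.
\<close>
definition slice_prime where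
  "slice_prime P \<longleftrightarrow> prime_in adhm_polys P \<and> adhm_ideal \<subseteq> P \<and>
     (\<forall>a b. (\<lambda>x. frame iota x $ a $ b - mat 1 $ a $ b) \<in> P) \<and> (\<forall>f\<in>P. f x0 = 0)"

definition coordinate_system where
  "coordinate_system Z P \<longleftrightarrow> finite Z \<and> Z \<subseteq> adhm_polys \<and>
     (\<forall>f\<in>adhm_polys. \<exists>q\<in>alg Z - P. \<exists>g\<in>alg Z. (\<lambda>x. q x * f x - g x) \<in> P)"

theorem prime_chain_bound_stalk:
  assumes ring: "cring R"
    and rat: "\<And>P. slice_prime P \<Longrightarrow> \<exists>Z. coordinate_system Z P \<and> card Z < N"
    and P: "\<forall>i\<le>n. primeideal (P i) R" "\<forall>i<n. P i \<subset> P (Suc i)"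
  shows "n < N"
proof -
  have P0: "primeideal (P 0) R" using P by simp
  have "adhm_ideal \<subseteq> pull (P 0)"
    using pull_mem[OF P0 ideal_of_polysD(1)[OF adhm_ideal]] by (intro subsetI) simp
  moreover have "(\<lambda>x. frame iota x $ a $ b - mat 1 $ a $ b) \<in> pull (P 0)" for a b
    by (rule pull_mem[OF P0 _ ideal_of_polysD(2)[OF adhm_ideal]])
      (intro P.Q_diff frame_polys P.Q_const, simp)
  ultimately have "slice_prime (pull (P 0))"
    unfolding slice_prime_def using pull_prime[OF P0] pull_vanishes[OF P0] by simp
  from rat[OF this] obtain Z where "coordinate_system Z (pull (P 0))" and card: "card Z < N"
    by (elim exE conjE)
  then have Z: "finite Z" "Z \<subseteq> adhm_polys"
      "\<And>f. f \<in> adhm_polys \<Longrightarrow> \<exists>q\<in>alg Z - pull (P 0). \<exists>g\<in>alg Z. (\<lambda>x. q x * f x - g x) \<in> pull (P 0)"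
    unfolding coordinate_system_def by simp_all
  have "n \<le> card Z"
  proof (rule P.prime_chain_bound[where P = "\<lambda>i. pull (P i)"])
    show "prime_in adhm_polys (pull (P i))" if "i \<le> n" for i using P that by (intro pull_prime) auto
    show "pull (P i) \<subset> pull (P (Suc i))" if i: "i < n" for i
    proof -
      have Pi: "primeideal (P i) R" "primeideal (P (Suc i)) R" "P i \<subset> P (Suc i)" using P i by auto
      obtain a where a: "a \<in> P (Suc i)" "a \<notin> P i" using Pi(3) by blast
      have "a \<in> carrier R"
        using additive_subgroup.a_Hcarr[OF ideal.axioms(1)[OF primeideal.axioms(1)[OF Pi(2)]] a(1)] .
      then obtain f h where fh: "f \<in> adhm_polys" "h \<in> adhm_polys" "h x0 \<noteq> 0" "a = slice_germ f h"
        by (rule stalk_elem)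
      have "f \<in> pull (P (Suc i))" "f \<notin> pull (P i)"
        using a pull_denominator[OF Pi(2) fh(1-3)] pull_denominator[OF Pi(1) fh(1-3)] fh(4) by auto
      moreover have "pull (P i) \<subseteq> pull (P (Suc i))" using Pi(3) by (auto simp: pull_def)
      ultimately show ?thesis by blast
    qed
  qed (use Z in simp_all)
  then show ?thesis using card by simp
qed

theorem stalk_not_regular:
  assumes "C \<noteq> {}"
    and rat: "\<And>P. slice_prime P \<Longrightarrow> \<exists>Z. coordinate_system Z P \<and> card Z < card C"
  shows "\<not> regular_local_ring R"
proof
  assume reg: "regular_local_ring R"
  then have ring: "cring R" by (simp add: regular_local_ring_def)
  obtain S where S: "S \<subseteq> carrier R" "finite S" "enat (card S) = krull_dim R" "maximalideal (Idl\<^bsub>R\<^esub> S) R"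
    using reg unfolding regular_local_ring_def by blast
  have "card C \<le> card S"
    using generators_bound[OF ring _ S(1,2,4)] reg by (simp add: regular_local_ring_def)
  have "krull_dim R \<le> enat (card C - 1)"
    unfolding krull_dim_def
  proof (rule Sup_least)
    fix d assume "d \<in> {enat n | n. \<exists>P. (\<forall>i\<le>n. primeideal (P i) R) \<and> (\<forall>i<n. P i \<subset> P (Suc i))}"
    then obtain n P where d: "d = enat n" and P: "\<forall>i\<le>n. primeideal (P i) R" "\<forall>i<n. P i \<subset> P (Suc i)"
      by blast
    have "n < card C" by (rule prime_chain_bound_stalk[OF ring _ P]) (rule rat)
    then show "d \<le> enat (card C - 1)" by (simp add: d)
  qed
  have "card C > 0" using assms(1) C(1) by (simp add: card_gt_0_iff)
  have "enat (card S) \<le> enat (card C - 1)" using \<open>krull_dim R \<le> _\<close> unfolding S(3) .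
  then show False using \<open>card C \<le> card S\<close> \<open>card C > 0\<close> by simp
qed

end

section \<open>The ADHM equation as a linear system for the last component\<close>

context function_algebra begin

text \<open>
  The members of \<open>Q\<close> that become rational functions of \<open>Z\<close> modulo the prime \<open>P\<close>.
\<close>
definition rational_over where
  "rational_over P Z = {f \<in> Q. \<exists>q\<in>alg Z - P. \<exists>g\<in>alg Z. (\<lambda>x. q x * f x - g x) \<in> P}"

lemma rationalI: "f \<in> Q \<Longrightarrow> q \<in> alg Z \<Longrightarrow> q \<notin> P \<Longrightarrow> g \<in> alg Z \<Longrightarrow> (\<lambda>x. q x * f x - g x) \<in> P \<Longrightarrow> f \<in> rational_over P Z"
  unfolding rational_over_def by blast

lemma rationalE:
  assumes "f \<in> rational_over P Z"
  obtains q g where "f \<in> Q" "q \<in> alg Z" "q \<notin> P" "g \<in> alg Z" "(\<lambda>x. q x * f x - g x) \<in> P"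
  using assms unfolding rational_over_def by blast

context
  fixes P Z assumes P: "prime_in Q P" and Z: "Z \<subseteq> Q"
begin

lemma algQ: "f \<in> alg Z \<Longrightarrow> f \<in> Q"
  using alg_subset[OF Q Z] by blast

lemma alg_rational: "f \<in> alg Z \<Longrightarrow> f \<in> rational_over P Z"
  using prime_inD(2,3)[OF P] by (intro rationalI[of f "\<lambda>x. 1" Z P f] algQ alg.const) simp_all

lemma prime_rational: "f \<in> P \<Longrightarrow> f \<in> rational_over P Z"
  using prime_inD(1,3)[OF P] by (intro rationalI[of f "\<lambda>x. 1" Z P "\<lambda>x. 0"] alg.const) auto

lemma prime_mult_notin: "f \<in> Q \<Longrightarrow> g \<in> Q \<Longrightarrow> f \<notin> P \<Longrightarrow> g \<notin> P \<Longrightarrow> (\<lambda>x. f x * g x) \<notin> P"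
  using prime_inD(6)[OF P] by blast

lemma rational_subalgebra: "subalgebra (rational_over P Z)"
  unfolding subalgebra_def
proof (intro conjI ballI allI)
  show "(\<lambda>x. a) \<in> rational_over P Z" for a by (rule alg_rational[OF alg.const])
next
  fix f f' assume in_rat: "f \<in> rational_over P Z" "f' \<in> rational_over P Z"
  obtain q g where f: "f \<in> Q" "q \<in> alg Z" "q \<notin> P" "g \<in> alg Z" "(\<lambda>x. q x * f x - g x) \<in> P"
    by (rule rationalE[OF in_rat(1)])
  obtain q' g' where f': "f' \<in> Q" "q' \<in> alg Z" "q' \<notin> P" "g' \<in> alg Z" "(\<lambda>x. q' x * f' x - g' x) \<in> P"
    by (rule rationalE[OF in_rat(2)])
  have nP: "(\<lambda>x. q x * q' x) \<notin> P" by (rule prime_mult_notin[OF algQ[OF f(2)] algQ[OF f'(2)] f(3) f'(3)])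
  have "(\<lambda>x. q' x * (q x * f x - g x) + q x * (q' x * f' x - g' x)) \<in> P"
    by (intro prime_inD(4)[OF P] prime_inD(5)[OF P _ f(5)] prime_inD(5)[OF P _ f'(5)] algQ f(2) f'(2))
  then have "(\<lambda>x. (q x * q' x) * (f x + f' x) - (q' x * g x + q x * g' x)) \<in> P" by (simp add: algebra_simps)
  with alg.add[OF alg.mult[OF f'(2) f(4)] alg.mult[OF f(2) f'(4)]]
  show "(\<lambda>x. f x + f' x) \<in> rational_over P Z"
    by (rule rationalI[OF Q_add[OF f(1) f'(1)] alg.mult[OF f(2) f'(2)] nP])
  have "(\<lambda>x. (q' x * f' x) * (q x * f x - g x) + g x * (q' x * f' x - g' x)) \<in> P"
    by (intro prime_inD(4)[OF P] prime_inD(5)[OF P _ f(5)] prime_inD(5)[OF P _ f'(5)] Q_mult algQ f(2,4) f'(1,2))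
  then have "(\<lambda>x. (q x * q' x) * (f x * f' x) - g x * g' x) \<in> P" by (simp add: algebra_simps)
  with alg.mult[OF f(4) f'(4)] show "(\<lambda>x. f x * f' x) \<in> rational_over P Z"
    by (rule rationalI[OF Q_mult[OF f(1) f'(1)] alg.mult[OF f(2) f'(2)] nP])
qed

lemma rational_divide:
  assumes f: "f \<in> Q" and q: "q \<in> rational_over P Z" "q \<notin> P" and g: "g \<in> rational_over P Z"
    and eq: "(\<lambda>x. q x * f x - g x) \<in> P"
  shows "f \<in> rational_over P Z"
proof -
  obtain a b where a: "q \<in> Q" "a \<in> alg Z" "a \<notin> P" "b \<in> alg Z" "(\<lambda>x. a x * q x - b x) \<in> P"
    by (rule rationalE[OF q(1)])
  obtain a' b' where a': "g \<in> Q" "a' \<in> alg Z" "a' \<notin> P" "b' \<in> alg Z" "(\<lambda>x. a' x * g x - b' x) \<in> P"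
    by (rule rationalE[OF g])
  have "b \<notin> P"
  proof
    assume "b \<in> P"
    then have "(\<lambda>x. (a x * q x - b x) + b x) \<in> P" using a(5) by (intro prime_inD(4)[OF P])
    then show False using prime_mult_notin[OF algQ[OF a(2)] a(1) a(3) q(2)] by simp
  qed
  then have nP: "(\<lambda>x. b x * a' x) \<notin> P" by (intro prime_mult_notin algQ a(4) a'(2,3))
  have "(\<lambda>x. (a x * a' x) * (q x * f x - g x) + (a x * (a' x * g x - b' x) - (a' x * f x) * (a x * q x - b x))) \<in> P"
    by (intro prime_inD(4)[OF P] prime_diff[OF P] prime_inD(5)[OF P _ eq] prime_inD(5)[OF P _ a(5)]
        prime_inD(5)[OF P _ a'(5)] Q_mult algQ a(2) a'(2) f)
  then have "(\<lambda>x. (b x * a' x) * f x - a x * b' x) \<in> P" by (simp add: algebra_simps)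
  with alg.mult[OF a(2) a'(4)] show ?thesis by (rule rationalI[OF f alg.mult[OF a(4) a'(2)] nP])
qed

end

end

lemma (in function_algebra) Q_matrix_vector:
  assumes "\<And>a b. (\<lambda>x. M x $ a $ b) \<in> Q" "\<And>b. (\<lambda>x. y x $ b) \<in> Q"
  shows "(\<lambda>x. ((M x :: 'k^'n^'m) *v y x) $ a) \<in> Q"
  unfolding matrix_vector_mult_def vec_lambda_beta by (intro Q_intros assms)

lemma ideal_matrix_vector:
  assumes J: "ideal_of_polys J" and "\<And>a b. (\<lambda>x. M x $ a $ b) \<in> adhm_polys" "\<And>b. (\<lambda>x. y x $ b) \<in> J"
  shows "(\<lambda>x. ((M x :: 'k::field^'n^'m) *v y x) $ a) \<in> J"
  unfolding matrix_vector_mult_def vec_lambda_beta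
  by (intro ideal_of_polys_sum[OF J] ideal_of_polysD(4)[OF J] assms(2,3))

lemma sum_UNIV_sum_type:
  fixes f :: "'a::finite + 'b::finite \<Rightarrow> 'c::comm_monoid_add"
  shows "sum f UNIV = (\<Sum>a\<in>UNIV. f (Inl a)) + (\<Sum>b\<in>UNIV. f (Inr b))"
proof -
  have "sum f (UNIV <+> UNIV) = (\<Sum>a\<in>UNIV. f (Inl a)) + (\<Sum>b\<in>UNIV. f (Inr b))"
    by (subst sum.Plus) auto
  then show ?thesis by (simp only: UNIV_Plus_UNIV)
qed

text \<open>
  The matrix of \<open>W \<otimes> H\<^sup>0(O(1)) \<rightarrow> V \<otimes> H\<^sup>0(O(2))\<close> induced by \<open>i\<close>. Rows are grouped by the monomials
  \<open>z\<^sub>0\<^sup>2\<close>, \<open>z\<^sub>0 z\<^sub>1\<close>, \<open>z\<^sub>1\<^sup>2\<close>, columns by \<open>z\<^sub>0\<close>, \<open>z\<^sub>1\<close>.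
\<close>
definition toeplitz :: "('k::field, 'v::finite, 'w::finite) adhm \<Rightarrow> 'k^('w + 'w)^('v + 'v + 'v)" where
  "toeplitz x = (\<chi> \<rho> \<kappa>. case \<rho> of
     Inl a \<Rightarrow> (case \<kappa> of Inl w \<Rightarrow> fst (adhm_i x) $ a $ w | Inr w \<Rightarrow> 0)
   | Inr (Inl a) \<Rightarrow> (case \<kappa> of Inl w \<Rightarrow> snd (adhm_i x) $ a $ w | Inr w \<Rightarrow> fst (adhm_i x) $ a $ w)
   | Inr (Inr a) \<Rightarrow> (case \<kappa> of Inl w \<Rightarrow> 0 | Inr w \<Rightarrow> snd (adhm_i x) $ a $ w))"

definition stack3 :: "'k^'v^'v \<Rightarrow> 'k^'v^'v \<Rightarrow> 'k^'v^'v \<Rightarrow> 'v::finite \<Rightarrow> 'k^('v + 'v + 'v)" where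
  "stack3 A B C l = (\<chi> \<rho>. case \<rho> of Inl a \<Rightarrow> A $ a $ l | Inr (Inl a) \<Rightarrow> B $ a $ l | Inr (Inr a) \<Rightarrow> C $ a $ l)"

definition j_column :: "('k::field, 'v::finite, 'w::finite) adhm \<Rightarrow> 'v \<Rightarrow> 'k^('w + 'w)" where
  "j_column x l = (\<chi> \<kappa>. case \<kappa> of Inl w \<Rightarrow> fst (adhm_j x) $ w $ l | Inr w \<Rightarrow> snd (adhm_j x) $ w $ l)"

definition moment_column :: "('k::field, 'v::finite, 'w::finite) adhm \<Rightarrow> 'v \<Rightarrow> 'k^('v + 'v + 'v)" where
  "moment_column x = stack3 (fst (adhm_moment x)) (fst (snd (adhm_moment x))) (snd (snd (adhm_moment x)))"

definition bracket :: "('k::field^'v^'v) \<times> ('k^'v^'v) \<Rightarrow> ('k^'v^'v) \<times> ('k^'v^'v) \<Rightarrow> 'v::finite \<Rightarrow> 'k^('v + 'v + 'v)" where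
  "bracket B1 B2 = stack3 (fst B1 ** fst B2 - fst B2 ** fst B1)
     (fst B1 ** snd B2 + snd B1 ** fst B2 - (fst B2 ** snd B1 + snd B2 ** fst B1))
     (snd B1 ** snd B2 - snd B2 ** snd B1)"

lemma toeplitz_apply:
  "(toeplitz x *v y) $ Inl a = (\<Sum>w\<in>UNIV. fst (adhm_i x) $ a $ w * y $ Inl w)"
  "(toeplitz x *v y) $ Inr (Inl a) =
    (\<Sum>w\<in>UNIV. snd (adhm_i x) $ a $ w * y $ Inl w) + (\<Sum>w\<in>UNIV. fst (adhm_i x) $ a $ w * y $ Inr w)"
  "(toeplitz x *v y) $ Inr (Inr a) = (\<Sum>w\<in>UNIV. snd (adhm_i x) $ a $ w * y $ Inr w)"
  by (simp_all add: toeplitz_def matrix_vector_mult_def sum_UNIV_sum_type)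

lemma vec3_eqI:
  fixes y z :: "'k^('v::finite + 'v + 'v)"
  assumes "\<And>a. y $ Inl a = z $ Inl a" "\<And>a. y $ Inr (Inl a) = z $ Inr (Inl a)" "\<And>a. y $ Inr (Inr a) = z $ Inr (Inr a)"
  shows "y = z"
  unfolding vec_eq_iff
proof
  fix \<rho> :: "'v + 'v + 'v"
  consider a where "\<rho> = Inl a" | a where "\<rho> = Inr (Inl a)" | a where "\<rho> = Inr (Inr a)"
    by (metis sum.exhaust)
  then show "y $ \<rho> = z $ \<rho>" by cases (simp_all add: assms)
qed

text \<open>
  The moment map is linear in \<open>j\<close>, one column at a time.
\<close>
lemma moment_column_eq:
  "moment_column x l = bracket (adhm_B1 x) (adhm_B2 x) l + toeplitz x *v j_column x l"
  by (rule vec3_eqI)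
    (simp_all add: moment_column_def bracket_def stack3_def toeplitz_apply j_column_def adhm_moment_simps,
      simp_all add: matrix_matrix_mult_def add_ac)

lemma sum3_cases:
  assumes "\<And>a. P (Inl a)" "\<And>a. P (Inr (Inl a))" "\<And>a. P (Inr (Inr a))"
  shows "P (\<rho> :: 'v + 'v + 'v)"
  using assms by (metis sum.exhaust)

lemma (in function_algebra) Q_stack3:
  assumes "\<And>a. (\<lambda>x. A x $ a $ l) \<in> Q" "\<And>a. (\<lambda>x. B x $ a $ l) \<in> Q" "\<And>a. (\<lambda>x. C x $ a $ l) \<in> Q"
  shows "(\<lambda>x. stack3 (A x) (B x) (C x) l $ \<rho>) \<in> Q"
  by (rule sum3_cases[where P = "\<lambda>\<rho>. (\<lambda>x. stack3 (A x) (B x) (C x) l $ \<rho>) \<in> Q"]) (simp_all add: stack3_def assms)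

lemma (in function_algebra) Q_bracket:
  assumes "\<And>a b. (\<lambda>x. fst (B1 x) $ a $ b) \<in> Q" "\<And>a b. (\<lambda>x. snd (B1 x) $ a $ b) \<in> Q"
    "\<And>a b. (\<lambda>x. fst (B2 x) $ a $ b) \<in> Q" "\<And>a b. (\<lambda>x. snd (B2 x) $ a $ b) \<in> Q"
  shows "(\<lambda>x. bracket (B1 x) (B2 x) l $ \<rho>) \<in> Q"
  unfolding bracket_def
  by (rule Q_stack3; unfold vector_minus_component vector_add_component; intro Q_diff Q_add Q_matrix_mult assms)

lemma (in function_algebra) Q_toeplitz:
  assumes "\<And>a b. (\<lambda>x. fst (adhm_i (T x)) $ a $ b) \<in> Q" "\<And>a b. (\<lambda>x. snd (adhm_i (T x)) $ a $ b) \<in> Q"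
  shows "(\<lambda>x. toeplitz (T x) $ \<rho> $ \<kappa>) \<in> Q"
  by (rule sum3_cases[where P = "\<lambda>\<rho>. (\<lambda>x. toeplitz (T x) $ \<rho> $ \<kappa>) \<in> Q"]; cases \<kappa>)
    (simp_all add: toeplitz_def assms Q_const)

lemma moment_column_ideal: "(\<lambda>x. moment_column x l $ \<rho>) \<in> adhm_ideal"
proof -
  have mem: "(\<lambda>x. fst (adhm_moment x) $ a $ b) \<in> adhm_ideal"
    "(\<lambda>x. fst (snd (adhm_moment x)) $ a $ b) \<in> adhm_ideal"
    "(\<lambda>x. snd (snd (adhm_moment x)) $ a $ b) \<in> adhm_ideal" for a b
    using moment_entries_ideal unfolding moment_entries_def by auto
  show ?thesis
    by (rule sum3_cases[where P = "\<lambda>\<rho>. (\<lambda>x. moment_column x l $ \<rho>) \<in> adhm_ideal"])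
      (simp_all add: moment_column_def stack3_def mem)
qed

text \<open>
  A diagonal entry of the first matrix enters a different column of the commutator only through the left
  factor, hence linearly and in row \<open>k\<close> alone.
\<close>
lemma bracket_split:
  fixes A0 :: "'k::field^'v^'v"
  assumes "l \<noteq> k"
  shows "bracket (A0, A1) (B0, B1) l =
    bracket (\<chi> a b. if a = k \<and> b = k then 0 else A0 $ a $ b, A1) (B0, B1) l +
      (A0 $ k $ k) *s (B0 $ k $ l *s axis (Inl k) 1 + B1 $ k $ l *s axis (Inr (Inl k)) 1)"
proof -
  let ?A = "\<chi> a b. if a = k \<and> b = k then 0 else A0 $ a $ b"
  have left: "(A0 ** B) $ a $ l = (?A ** B) $ a $ l + (if a = k then A0 $ k $ k * B $ k $ l else 0)" for B :: "'k^'v^'v" and a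
  proof -
    have "(A0 ** B) $ a $ l = (\<Sum>b\<in>UNIV. ?A $ a $ b * B $ b $ l + (if b = k then if a = k then A0 $ k $ k * B $ k $ l else 0 else 0))"
      unfolding matrix_matrix_mult_def vec_lambda_beta by (intro sum.cong refl) auto
    then show ?thesis by (simp add: sum.distrib matrix_matrix_mult_def)
  qed
  have right: "(B ** A0) $ a $ l = (B ** ?A) $ a $ l" for B :: "'k^'v^'v" and a
    unfolding matrix_matrix_mult_def vec_lambda_beta using assms by (intro sum.cong refl) auto
  show ?thesis
    by (rule vec3_eqI) (simp_all add: bracket_def stack3_def left right axis_def)
qed

definition cramer_det :: "'k^('v + 'v + 'v)^('w + 'w) \<Rightarrow> ('k::field, 'v::finite, 'w::finite) adhm \<Rightarrow> 'k" where
  "cramer_det L x = det (L ** toeplitz x)"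

text \<open>
  With \<open>L\<close> a left inverse of the Toeplitz matrix at the base point, \<open>cramer_vec L x y / cramer_det L x\<close> is the
  solution of \<open>toeplitz x *v z = y\<close> whenever a solution exists and the determinant is nonzero.
\<close>
definition cramer_vec :: "'k^('v + 'v + 'v)^('w + 'w) \<Rightarrow> ('k::field, 'v::finite, 'w::finite) adhm \<Rightarrow>
    'k^('v + 'v + 'v) \<Rightarrow> 'k^('w + 'w)" where
  "cramer_vec L x y = adjugate (L ** toeplitz x) *v (L *v y)"

text \<open>
  A functional on right-hand sides that kills the image of the Toeplitz matrix: the functional \<open>u\<close>, made
  orthogonal to the image by Cramer's rule and multiplied by the determinant. Its coefficients are polynomials
  in \<open>i\<close>, and at a point where \<open>u\<close> itself kills the image it is a multiple of \<open>u\<close>.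
\<close>
definition compat :: "'k^('v + 'v + 'v)^('w + 'w) \<Rightarrow> 'k^('v + 'v + 'v) \<Rightarrow> ('k::field, 'v::finite, 'w::finite) adhm \<Rightarrow>
    'k^('v + 'v + 'v) \<Rightarrow> 'k" where
  "compat L u x y = cramer_det L x * (\<Sum>\<rho>\<in>UNIV. u $ \<rho> * y $ \<rho>) -
     (\<Sum>\<kappa>\<in>UNIV. (u v* toeplitz x) $ \<kappa> * cramer_vec L x y $ \<kappa>)"

lemma cramer_vec_toeplitz:
  assumes "cramer_det L x \<noteq> 0"
  shows "cramer_vec L x (toeplitz x *v y) = cramer_det L x *s y"
proof -
  let ?N = "L ** toeplitz x"
  have inv: "invertible ?N" using assms by (simp add: cramer_det_def invertible_det_nz)
  have "cramer_vec L x (toeplitz x *v y) = adjugate ?N *v (?N *v y)"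
    by (simp add: cramer_vec_def matrix_vector_mul_assoc)
  also have "\<dots> = det ?N *s (matrix_inv ?N *v (?N *v y))"
    using det_mult_matrix_inv[of ?N] assms unfolding cramer_det_def
    by (simp add: vec_eq_iff matrix_vector_mult_def sum_distrib_left flip: mult.assoc)
  finally show ?thesis by (simp add: matrix_vector_mul_assoc matrix_inv_cancel[OF inv] cramer_det_def)
qed

lemma compat_toeplitz:
  assumes "cramer_det L x \<noteq> 0" shows "compat L u x (toeplitz x *v y) = 0"
proof -
  have "(\<Sum>\<rho>\<in>UNIV. u $ \<rho> * (toeplitz x *v y) $ \<rho>) = (\<Sum>\<kappa>\<in>UNIV. (u v* toeplitz x) $ \<kappa> * y $ \<kappa>)"
    unfolding matrix_vector_mult_def vector_matrix_mult_def vec_lambda_beta sum_distrib_left sum_distrib_right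
    by (subst sum.swap) (simp add: mult_ac)
  then show ?thesis
    by (simp add: compat_def cramer_vec_toeplitz[OF assms] sum_distrib_left mult_ac)
qed

lemma cramer_vec_add: "cramer_vec L x (y + z) = cramer_vec L x y + cramer_vec L x z"
  by (simp add: cramer_vec_def matrix_vector_right_distrib)

lemma cramer_vec_scale: "cramer_vec L x (a *s y) = a *s cramer_vec L x y"
  by (simp add: cramer_vec_def vector_scalar_commute)

lemma compat_add: "compat L u x (y + z) = compat L u x y + compat L u x z"
  by (simp add: compat_def cramer_vec_add distrib_left sum.distrib algebra_simps)

lemma compat_scale: "compat L u x (a *s y) = a * compat L u x y"
  by (simp add: compat_def cramer_vec_scale sum_distrib_left right_diff_distrib mult_ac)

lemma (in function_algebra) Q_cramer:
  assumes i: "\<And>a b. (\<lambda>x. fst (adhm_i (T x)) $ a $ b) \<in> Q" "\<And>a b. (\<lambda>x. snd (adhm_i (T x)) $ a $ b) \<in> Q"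
    and y: "\<And>\<rho>. (\<lambda>x. y x $ \<rho>) \<in> Q"
  shows "(\<lambda>x. cramer_det L (T x)) \<in> Q" "(\<lambda>x. cramer_vec L (T x) (y x) $ \<kappa>) \<in> Q" "(\<lambda>x. compat L u (T x) (y x)) \<in> Q"
proof -
  note M = Q_toeplitz[OF i]
  show det: "(\<lambda>x. cramer_det L (T x)) \<in> Q"
    unfolding cramer_det_def by (intro Q_det Q_matrix_mult M Q_const)
  have vec: "(\<lambda>x. cramer_vec L (T x) (y x) $ \<kappa>) \<in> Q" for \<kappa>
    unfolding cramer_vec_def by (intro Q_matrix_vector Q_adjugate Q_matrix_mult M Q_const y)
  then show "(\<lambda>x. cramer_vec L (T x) (y x) $ \<kappa>) \<in> Q" .
  show "(\<lambda>x. compat L u (T x) (y x)) \<in> Q"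
    unfolding compat_def vector_matrix_mult_def vec_lambda_beta
    by (intro Q_diff Q_mult Q_sum det vec y M Q_const)
qed

lemma ideal_cramer:
  assumes J: "ideal_of_polys J" and y: "\<And>\<rho>. (\<lambda>x. y x $ \<rho>) \<in> J"
  shows "(\<lambda>x. cramer_vec L x (y x) $ \<kappa>) \<in> J" "(\<lambda>x. compat L u x (y x)) \<in> J"
proof -
  note M = P.Q_toeplitz[OF coords_polys(5,6)]
  have vec: "(\<lambda>x. cramer_vec L x (y x) $ \<kappa>) \<in> J" for \<kappa>
    unfolding cramer_vec_def
    by (intro ideal_matrix_vector[OF J] P.Q_adjugate P.Q_matrix_mult M P.Q_const y)
  then show "(\<lambda>x. cramer_vec L x (y x) $ \<kappa>) \<in> J" .
  have det: "(\<lambda>x. cramer_det L x) \<in> adhm_polys"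
    unfolding cramer_det_def by (intro P.Q_det P.Q_matrix_mult M P.Q_const)
  have "(\<lambda>x. \<Sum>\<rho>\<in>UNIV. u $ \<rho> * y x $ \<rho>) \<in> J"
    by (intro ideal_of_polys_sum[OF J] ideal_of_polysD(4)[OF J _ y] P.Q_const)
  moreover have "(\<lambda>x. \<Sum>\<kappa>\<in>UNIV. (u v* toeplitz x) $ \<kappa> * cramer_vec L x (y x) $ \<kappa>) \<in> J"
    unfolding vector_matrix_mult_def vec_lambda_beta
    by (intro ideal_of_polys_sum[OF J] ideal_of_polysD(4)[OF J _ vec] P.Q_sum P.Q_mult M P.Q_const)
  ultimately show "(\<lambda>x. compat L u x (y x)) \<in> J"
    unfolding compat_def by (intro ideal_of_polys_diff[OF J] ideal_of_polysD(4)[OF J det])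
qed

section \<open>The Kronecker base point and its tangent directions\<close>

definition line_pair :: "('k::field^'b^'a) \<times> ('k^'b^'a) \<Rightarrow> ('k^'b^'a) \<times> ('k^'b^'a) \<Rightarrow> 'k \<Rightarrow> ('k^'b^'a) \<times> ('k^'b^'a)" where
  "line_pair M N t = ((\<chi> a b. fst M $ a $ b + t * fst N $ a $ b), (\<chi> a b. snd M $ a $ b + t * snd N $ a $ b))"

definition shift :: "('k::field, 'v::finite, 'w::finite) adhm \<Rightarrow> ('k, 'v, 'w) adhm \<Rightarrow> 'k \<Rightarrow> ('k, 'v, 'w) adhm" where
  "shift x d t = \<lparr> adhm_B1 = line_pair (adhm_B1 x) (adhm_B1 d) t, adhm_B2 = line_pair (adhm_B2 x) (adhm_B2 d) t,
     adhm_i = line_pair (adhm_i x) (adhm_i d) t, adhm_j = line_pair (adhm_j x) (adhm_j d) t \<rparr>"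

lemma coord_shift: "\<phi> \<in> adhm_coords \<Longrightarrow> \<phi> (shift x d t) = \<phi> x + t * \<phi> d"
  unfolding adhm_coords_def by (auto simp: shift_def line_pair_def)

lemma polys_shift: "f \<in> adhm_polys \<Longrightarrow> (\<lambda>t. f (shift x d t)) \<in> poly_funs"
proof (erule polys_compose[OF _ poly_funs_subalgebra])
  fix \<phi> :: "('a, 'b, 'c) adhm \<Rightarrow> 'a" assume "\<phi> \<in> adhm_coords"
  then show "(\<lambda>t. \<phi> (shift x d t)) \<in> poly_funs"
    by (simp add: coord_shift L.Q_add L.Q_mult L.Q_const poly_funs_id)
qed

lemma shift_0: "shift x d 0 = x"
  by (simp add: shift_def line_pair_def)

text \<open>
  Numberings of the two bases. In these terms \<open>iota\<close> is the inclusion of the first \<open>c\<close> columns, and \<open>tau\<close> is the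
  same inclusion shifted by \<open>s = r - c\<close>.
\<close>
locale kronecker =
  fixes vv :: "'v::finite \<Rightarrow> nat" and ww :: "'w::finite \<Rightarrow> nat" and s :: nat
  assumes vv: "bij_betw vv UNIV {..<CARD('v)}" and ww: "bij_betw ww UNIV {..<CARD('w)}"
    and s: "CARD('w) = CARD('v) + s" "0 < s" "2 * s < CARD('v)"
begin

definition iota :: "'v \<Rightarrow> 'w" where "iota a = (SOME b. ww b = vv a)"
definition tau :: "'v \<Rightarrow> 'w" where "tau a = (SOME b. ww b = vv a + s)"

lemma vv_less: "vv a < CARD('v)" using vv by (auto simp: bij_betw_def)
lemma ww_less: "ww b < CARD('w)" using ww by (auto simp: bij_betw_def)

lemma vv_inj: "vv a = vv b \<longleftrightarrow> a = b" and ww_inj: "ww d = ww e \<longleftrightarrow> d = e"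
  using vv ww by (auto simp: bij_betw_def inj_on_def)

lemma vv_surj: "n < CARD('v) \<Longrightarrow> \<exists>a. vv a = n" and ww_surj: "m < CARD('w) \<Longrightarrow> \<exists>b. ww b = m"
  using vv ww unfolding bij_betw_def by (metis imageE lessThan_iff)+

lemma ww_iota: "ww (iota a) = vv a"
  unfolding iota_def by (rule someI_ex, rule ww_surj) (use vv_less[of a] s in simp)

lemma ww_tau: "ww (tau a) = vv a + s"
  unfolding tau_def by (rule someI_ex, rule ww_surj) (use vv_less[of a] s in simp)

definition base :: "('k::alg_closed_field, 'v, 'w) adhm" where
  "base = \<lparr> adhm_B1 = (0, 0), adhm_B2 = (0, 0),
     adhm_i = ((\<chi> a b. if b = iota a then 1 else 0), (\<chi> a b. if b = tau a then 1 else 0)), adhm_j = (0, 0) \<rparr>"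

text \<open>
  Back substitution from the last index downwards; the shift \<open>s\<close> is positive, so later unknowns are known.
\<close>
lemma base_solve_nat:
  fixes v :: "nat \<Rightarrow> 'k::field"
  assumes "p0 \<noteq> 0"
  shows "\<exists>u. \<forall>k. c - n \<le> k \<and> k < c \<longrightarrow> p0 * u k + p1 * u (k + s) = v k"
proof (induction n)
  case (Suc n)
  then obtain u where u: "\<forall>k. c - n \<le> k \<and> k < c \<longrightarrow> p0 * u k + p1 * u (k + s) = v k" by blast
  show ?case
  proof (cases "n < c")
    case True
    define m where "m = c - Suc n"
    define u' where "u' = u(m := (v m - p1 * u (m + s)) / p0)"
    have "p0 * u' k + p1 * u' (k + s) = v k" if "c - Suc n \<le> k \<and> k < c" for k
    proof (cases "k = m")
      case True
      then show ?thesis using s(2) assms by (simp add: u'_def field_simps)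
    next
      case False
      then have "c - n \<le> k" "k + s \<noteq> m" using that \<open>n < c\<close> by (auto simp: m_def)
      then show ?thesis using u that False by (simp add: u'_def)
    qed
    then show ?thesis by blast
  next
    case False
    then have "c - Suc n = c - n" by simp
    then show ?thesis using u by auto
  qed
qed auto

lemma base_surjective:
  fixes p :: "'k::alg_closed_field \<times> 'k"
  assumes "p \<noteq> (0, 0)"
  shows "\<exists>w. sec_eval p (adhm_i base) *v w = v"
proof -
  define vn where "vn n = v $ (SOME a. vv a = n)" for n
  have vn: "vn (vv a) = v $ a" for a unfolding vn_def by (simp add: vv_inj)
  have "\<exists>u. \<forall>k < CARD('v). fst p * u k + snd p * u (k + s) = vn k"
  proof (cases "fst p = 0")
    case False
    from base_solve_nat[OF this, of "CARD('v)" "CARD('v)" "snd p" vn] show ?thesis by simp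
  next
    case True
    then have "snd p \<noteq> 0" using assms by (cases p) auto
    then show ?thesis using True by (intro exI[of _ "\<lambda>k. vn (k - s) / snd p"]) simp
  qed
  then obtain u where u: "\<And>k. k < CARD('v) \<Longrightarrow> fst p * u k + snd p * u (k + s) = vn k" by blast
  have "(sec_eval p (adhm_i base) *v (\<chi> b. u (ww b))) $ a = v $ a" for a
  proof -
    have "(sec_eval p (adhm_i base) *v (\<chi> b. u (ww b))) $ a =
        (\<Sum>b\<in>UNIV. (if b = iota a then fst p * u (ww b) else 0) + (if b = tau a then snd p * u (ww b) else 0))"
      unfolding sec_eval_def matrix_vector_mult_def vec_lambda_beta base_def adhm.simps fst_conv snd_conv
      by (intro sum.cong refl) (auto simp: distrib_right)
    also have "\<dots> = fst p * u (vv a) + snd p * u (vv a + s)"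
      by (simp add: sum.distrib ww_iota ww_tau)
    finally show ?thesis using u[OF vv_less[of a]] vn by simp
  qed
  then show ?thesis by (intro exI[of _ "\<chi> b. u (ww b)"]) (simp add: vec_eq_iff)
qed

lemma base_fj_data: "(base :: ('k::alg_closed_field, 'v, 'w) adhm) \<in> fj_data"
proof -
  have "adhm_moment (base :: ('k, 'v, 'w) adhm) = 0"
    by (simp add: moment_zero_iff adhm_moment_simps base_def)
  moreover have "fj_stable (base :: ('k, 'v, 'w) adhm)"
    unfolding fj_stable_def
  proof (intro allI impI notI, elim exE conjE)
    fix p S assume p: "p \<noteq> (0 :: 'k, 0 :: 'k)" "S \<noteq> UNIV"
      "range (\<lambda>w. sec_eval p (adhm_i (base :: ('k, 'v, 'w) adhm)) *v w) \<subseteq> S"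
    have "v \<in> S" for v
    proof -
      obtain w where "sec_eval p (adhm_i base) *v w = v" using base_surjective[OF p(1)] by blast
      then show ?thesis using p(3) by blast
    qed
    then show False using p(2) by blast
  qed
  ultimately show ?thesis by (simp add: fj_data_def)
qed

lemma base_frame: "frame iota base = mat 1"
  by (auto simp: frame_def base_def vec_eq_iff mat_def ww_iota vv_inj simp flip: ww_inj)

text \<open>
  All entries of \<open>B\<close> and \<open>i\<close> outside the frame. These are the tangent coordinates at the base point.
\<close>
definition free_coords :: "(('k::alg_closed_field, 'v, 'w) adhm \<Rightarrow> 'k) set" where
  "free_coords = (\<Union>a b. {\<lambda>x. fst (adhm_B1 x) $ a $ b, \<lambda>x. snd (adhm_B1 x) $ a $ b,
       \<lambda>x. fst (adhm_B2 x) $ a $ b, \<lambda>x. snd (adhm_B2 x) $ a $ b}) \<union>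
     (\<Union>a. \<Union>b\<in>- range iota. {\<lambda>x. fst (adhm_i x) $ a $ b}) \<union>
     (\<Union>a b. {\<lambda>x. snd (adhm_i x) $ a $ b})"

lemma free_coords_mem:
  "(\<lambda>x. fst (adhm_B1 x) $ a $ b) \<in> free_coords" "(\<lambda>x. snd (adhm_B1 x) $ a $ b) \<in> free_coords"
  "(\<lambda>x. fst (adhm_B2 x) $ a $ b) \<in> free_coords" "(\<lambda>x. snd (adhm_B2 x) $ a $ b) \<in> free_coords"
  unfolding free_coords_def
  by (rule UnI1, rule UnI1, rule UN_I[where a = a, OF UNIV_I], rule UN_I[where a = b, OF UNIV_I], simp)+

lemma free_coords_mem_i:
  "(\<lambda>x. snd (adhm_i x) $ a $ b) \<in> free_coords"
  "b \<notin> range iota \<Longrightarrow> (\<lambda>x. fst (adhm_i x) $ a $ b) \<in> free_coords"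
  unfolding free_coords_def
   apply (rule UnI2, rule UN_I[where a = a, OF UNIV_I], rule UN_I[where a = b, OF UNIV_I], simp)
  apply (rule UnI1, rule UnI2, rule UN_I[where a = a, OF UNIV_I], rule UN_I[where a = b], simp_all)
  done

lemma finite_free_coords: "finite free_coords"
  unfolding free_coords_def by simp

lemma free_coords_coords: "free_coords \<subseteq> adhm_coords"
  unfolding free_coords_def adhm_coords_def by blast

definition matrix_unit :: "'a \<Rightarrow> 'b \<Rightarrow> 'k::field^'b::finite^'a::finite" where
  "matrix_unit a b = (\<chi> a' b'. if a' = a \<and> b' = b then 1 else 0)"

text \<open>
  A direction with \<open>j = 0\<close> in which only one of \<open>B\<^sub>1\<close>, \<open>B\<^sub>2\<close> moves: the quadratic moment map then vanishes on
  the whole line and not only to first order.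
\<close>
definition good_direction where
  "good_direction z d \<longleftrightarrow> adhm_j d = (0, 0) \<and> (adhm_B1 d = (0, 0) \<or> adhm_B2 d = (0, 0)) \<and>
     (\<forall>a b. fst (adhm_i d) $ a $ iota b = 0) \<and> z d = 1 \<and> (\<forall>z'\<in>free_coords. z' \<noteq> z \<longrightarrow> z' d = 0)"

lemma good_direction_exists:
  fixes z :: "('k::alg_closed_field, 'v, 'w) adhm \<Rightarrow> 'k"
  assumes "z \<in> free_coords" shows "\<exists>d. good_direction z d"
proof -
  consider (b10) a b where "z = (\<lambda>x. fst (adhm_B1 x) $ a $ b)" | (b11) a b where "z = (\<lambda>x. snd (adhm_B1 x) $ a $ b)"
    | (b20) a b where "z = (\<lambda>x. fst (adhm_B2 x) $ a $ b)" | (b21) a b where "z = (\<lambda>x. snd (adhm_B2 x) $ a $ b)"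
    | (i0) a b where "z = (\<lambda>x. fst (adhm_i x) $ a $ b)" "b \<notin> range iota" | (i1) a b where "z = (\<lambda>x. snd (adhm_i x) $ a $ b)"
    using assms unfolding free_coords_def by blast
  then show ?thesis
  proof cases
    case (b10 a b)
    have "good_direction z \<lparr>adhm_B1 = (matrix_unit a b, 0), adhm_B2 = (0, 0), adhm_i = (0, 0), adhm_j = (0, 0)\<rparr>"
      unfolding good_direction_def b10 free_coords_def by (auto simp: matrix_unit_def)
    then show ?thesis by blast
  next
    case (b11 a b)
    have "good_direction z \<lparr>adhm_B1 = (0, matrix_unit a b), adhm_B2 = (0, 0), adhm_i = (0, 0), adhm_j = (0, 0)\<rparr>"
      unfolding good_direction_def b11 free_coords_def by (auto simp: matrix_unit_def)
    then show ?thesis by blast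
  next
    case (b20 a b)
    have "good_direction z \<lparr>adhm_B1 = (0, 0), adhm_B2 = (matrix_unit a b, 0), adhm_i = (0, 0), adhm_j = (0, 0)\<rparr>"
      unfolding good_direction_def b20 free_coords_def by (auto simp: matrix_unit_def)
    then show ?thesis by blast
  next
    case (b21 a b)
    have "good_direction z \<lparr>adhm_B1 = (0, 0), adhm_B2 = (0, matrix_unit a b), adhm_i = (0, 0), adhm_j = (0, 0)\<rparr>"
      unfolding good_direction_def b21 free_coords_def by (auto simp: matrix_unit_def)
    then show ?thesis by blast
  next
    case (i0 a b)
    have "good_direction z \<lparr>adhm_B1 = (0, 0), adhm_B2 = (0, 0), adhm_i = (matrix_unit a b, 0), adhm_j = (0, 0)\<rparr>"
      using i0(2) unfolding good_direction_def i0(1) free_coords_def by (auto simp: matrix_unit_def)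
    then show ?thesis by blast
  next
    case (i1 a b)
    have "good_direction z \<lparr>adhm_B1 = (0, 0), adhm_B2 = (0, 0), adhm_i = (0, matrix_unit a b), adhm_j = (0, 0)\<rparr>"
      unfolding good_direction_def i1 free_coords_def by (auto simp: matrix_unit_def)
    then show ?thesis by blast
  qed
qed

definition tangent_line :: "(('k::alg_closed_field, 'v, 'w) adhm \<Rightarrow> 'k) \<Rightarrow> 'k \<Rightarrow> ('k, 'v, 'w) adhm" where
  "tangent_line z = shift base (SOME d. good_direction z d)"

lemma base_tangent_chart:
  "tangent_chart iota (base :: ('k::alg_closed_field, 'v, 'w) adhm) free_coords tangent_line"
proof
  show "(base :: ('k, 'v, 'w) adhm) \<in> fj_data" by (rule base_fj_data)
  show "frame iota (base :: ('k, 'v, 'w) adhm) = mat 1" by (rule base_frame)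
  show "finite (free_coords :: (('k, 'v, 'w) adhm \<Rightarrow> 'k) set)" by (rule finite_free_coords)
  show "(free_coords :: (('k, 'v, 'w) adhm \<Rightarrow> 'k) set) \<subseteq> adhm_polys"
    using free_coords_coords adhm_polys.coord by blast
next
  fix z :: "('k, 'v, 'w) adhm \<Rightarrow> 'k" and t assume z: "z \<in> free_coords"
  define d where "d = (SOME d. good_direction z d)"
  have d: "good_direction z d" unfolding d_def by (rule someI_ex[OF good_direction_exists[OF z]])
  note d' = d[unfolded good_direction_def]
  have line: "tangent_line z t = shift base d t" for t unfolding tangent_line_def d_def ..
  show "tangent_line z 0 = base" unfolding line by (rule shift_0)
  show "adhm_moment (tangent_line z t) = 0"
    using d' unfolding line
    by (auto simp: moment_zero_iff adhm_moment_simps shift_def line_pair_def base_def zero_vec_def[symmetric])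
  show "frame iota (tangent_line z t) = mat 1"
    using d' base_frame unfolding line by (simp add: frame_def shift_def line_pair_def vec_eq_iff)
  show "(\<lambda>t. f (tangent_line z t)) \<in> poly_funs" if "f \<in> adhm_polys" for f
    unfolding line by (rule polys_shift[OF that])
  show "z (tangent_line z t) = z base + t"
    using d' z free_coords_coords coord_shift[of z base d t] unfolding line by auto
  show "z' (tangent_line z t) = z' base" if "z' \<in> free_coords" "z' \<noteq> z" for z'
    using d' that free_coords_coords coord_shift[of z' base d t] unfolding line by auto
qed

lemma base_i: "fst (adhm_i base) $ a $ b = (if b = iota a then 1 else 0)"
  "snd (adhm_i base) $ a $ b = (if b = tau a then 1 else 0)"
  by (simp_all add: base_def)

lemma toeplitz_base_apply:
  "(toeplitz base *v y) $ Inl a = y $ Inl (iota a)"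
  "(toeplitz base *v y) $ Inr (Inl a) = y $ Inl (tau a) + y $ Inr (iota a)"
  "(toeplitz base *v y) $ Inr (Inr a) = y $ Inr (tau a)"
  by (simp_all add: toeplitz_apply base_i mult_delta_left)

text \<open>
  The middle row block links the two halves of \<open>y\<close>. It suffices because \<open>2 s < c\<close>: an index below \<open>s\<close> stays in
  the range of \<open>iota\<close> after a shift by \<open>s\<close>.
\<close>
lemma toeplitz_base_kernel:
  assumes "toeplitz (base :: ('k::alg_closed_field, 'v, 'w) adhm) *v y = 0" shows "y = 0"
proof -
  have y: "y $ Inl (iota a) = 0" "y $ Inl (tau a) + y $ Inr (iota a) = 0" "y $ Inr (tau a) = 0" for a
    using assms toeplitz_base_apply[of y a] by simp_all
  have low: "\<exists>a. w = iota a \<and> vv a = ww w" if w: "ww w < CARD('v)" for w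
  proof -
    obtain a where "vv a = ww w" using vv_surj[OF w] by blast
    then show ?thesis by (intro exI[of _ a]) (simp add: ww_iota flip: ww_inj)
  qed
  have high: "\<exists>a. w = tau a \<and> vv a + s = ww w" if w: "s \<le> ww w" for w
  proof -
    have "ww w - s < CARD('v)" using ww_less[of w] s(1) w by linarith
    then obtain a where "vv a = ww w - s" using vv_surj by blast
    then show ?thesis using w by (intro exI[of _ a]) (simp add: ww_tau flip: ww_inj)
  qed
  have right: "y $ Inr w = 0" for w
  proof (cases "s \<le> ww w")
    case True
    then show ?thesis using high[OF True] y(3) by auto
  next
    case False
    then have "ww w < CARD('v)" using s(3) by simp
    then obtain a where a: "w = iota a" "vv a = ww w" using low by blast
    have "ww (tau a) < CARD('v)" using False a(2) s(3) by (simp add: ww_tau)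
    then obtain a' where "tau a = iota a'" using low by blast
    then have "y $ Inl (tau a) = 0" using y(1) by simp
    then show ?thesis using y(2)[of a] a(1) by simp
  qed
  have left: "y $ Inl w = 0" for w
  proof (cases "ww w < CARD('v)")
    case True
    then show ?thesis using low[OF True] y(1) by auto
  next
    case False
    then have "s \<le> ww w" using s(3) by simp
    then obtain a where "w = tau a" using high by blast
    then show ?thesis using y(2)[of a] right by simp
  qed
  have "y $ \<kappa> = 0" for \<kappa> using left right by (cases \<kappa>) auto
  then show ?thesis by (simp add: vec_eq_iff)
qed

text \<open>
  Rows \<open>2 s\<close>, \<open>s\<close> and \<open>0\<close> of the three blocks have alternating sum zero, since their unit entries sit in the
  same columns.
  Such rows exist because \<open>2 s < c\<close>.
\<close>
lemma toeplitz_base_cokernel: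
  assumes "vv k0 = 2 * s" "vv k1 = s" "vv k2 = 0"
  shows "(axis (Inl k0) 1 - axis (Inr (Inl k1)) 1 + axis (Inr (Inr k2)) 1) v*
    toeplitz (base :: ('k::alg_closed_field, 'v, 'w) adhm) = 0"
proof -
  have "iota k0 = tau k1" "iota k1 = tau k2" using assms by (simp_all add: ww_iota ww_tau flip: ww_inj)
  moreover have "((axis (Inl k0) 1 - axis (Inr (Inl k1)) 1 + axis (Inr (Inr k2)) 1) v* M) $ \<kappa> =
      M $ Inl k0 $ \<kappa> - M $ Inr (Inl k1) $ \<kappa> + M $ Inr (Inr k2) $ \<kappa>"
    for M :: "'k^('w + 'w)^('v + 'v + 'v)" and \<kappa>
    by (simp add: vector_matrix_mult_def axis_def algebra_simps sum.distrib sum_subtractf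
        if_distrib[of "\<lambda>x. _ * x"] sum.delta cong: if_cong)
  ultimately have "((axis (Inl k0) 1 - axis (Inr (Inl k1)) 1 + axis (Inr (Inr k2)) 1) v*
    toeplitz (base :: ('k, 'v, 'w) adhm)) $ \<kappa> = 0" for \<kappa>
    by (cases \<kappa>) (simp_all add: toeplitz_def base_i)
  then show ?thesis by (simp add: vec_eq_iff)
qed

end

section \<open>Loss of a coordinate modulo primes through the base point\<close>

context kronecker begin

context
  fixes P :: "(('k::alg_closed_field, 'v, 'w) adhm \<Rightarrow> 'k) set" and L :: "'k^('v + 'v + 'v)^('w + 'w)"
  assumes slice_prime: "tangent_chart.slice_prime iota base P"
    and L: "L ** toeplitz (base :: ('k, 'v, 'w) adhm) = mat 1"
begin

lemma prime: "prime_in adhm_polys P" and ideal: "adhm_ideal \<subseteq> P"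
  and slice: "(\<lambda>x. frame iota x $ a $ b - mat 1 $ a $ b) \<in> P" and vanish: "f \<in> P \<Longrightarrow> f base = 0"
  using slice_prime unfolding tangent_chart.slice_prime_def[OF base_tangent_chart] by simp_all

lemma det_notin: "cramer_det L \<notin> P"
proof
  assume "cramer_det L \<in> P"
  then show False using vanish[of "cramer_det L"] by (simp add: cramer_det_def L)
qed

text \<open>
  The determinant does not vanish at the base point, so it can be cancelled modulo the prime. Identities
  obtained from Cramer's rule are thus needed only where the determinant is nonzero.
\<close>
lemma off_det:
  assumes f: "f \<in> adhm_polys" "\<And>x. cramer_det L x \<noteq> 0 \<Longrightarrow> f x = 0" shows "f \<in> P"
proof -
  have "(\<lambda>x. cramer_det L x * f x) = (\<lambda>x. 0)" using f(2) by (auto simp: fun_eq_iff)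
  then have "(\<lambda>x. cramer_det L x * f x) \<in> P" using prime_inD(2)[OF prime] by simp
  moreover have "cramer_det L \<in> adhm_polys" by (rule P.Q_cramer(1)[OF coords_polys(5,6) P.Q_const])
  ultimately show ?thesis
    using prime_inD(6)[OF prime _ f(1)] det_notin by blast
qed

lemma moment_column_polys: "(\<lambda>x. moment_column x m $ \<rho>) \<in> adhm_polys"
  by (rule ideal_of_polysD(1)[OF adhm_ideal moment_column_ideal])

lemma bracket_polys: "(\<lambda>x. bracket (adhm_B1 x) (adhm_B2 x) m $ \<rho>) \<in> adhm_polys"
  by (rule P.Q_bracket; rule coords_polys)

lemma j_column_polys: "(\<lambda>x. j_column x m $ \<kappa>) \<in> adhm_polys"
  by (cases \<kappa>) (simp_all add: j_column_def coords_polys)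

lemma compat_in_prime: "(\<lambda>x. compat L u x (bracket (adhm_B1 x) (adhm_B2 x) l)) \<in> P"
proof -
  have "(\<lambda>x. compat L u x (bracket (adhm_B1 x) (adhm_B2 x) l) - compat L u x (moment_column x l)) \<in> P"
  proof (rule off_det)
    show "(\<lambda>x. compat L u x (bracket (adhm_B1 x) (adhm_B2 x) l) - compat L u x (moment_column x l)) \<in> adhm_polys"
      by (rule P.Q_diff; rule P.Q_cramer(3)[OF coords_polys(5,6)]; rule bracket_polys moment_column_polys)
  qed (simp add: moment_column_eq compat_add compat_toeplitz)
  moreover have "(\<lambda>x. compat L u x (moment_column x l)) \<in> P"
    by (rule subsetD[OF ideal]) (rule ideal_cramer(2)[OF adhm_ideal moment_column_ideal])
  ultimately have "(\<lambda>x. (compat L u x (bracket (adhm_B1 x) (adhm_B2 x) l) - compat L u x (moment_column x l)) +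
      compat L u x (moment_column x l)) \<in> P"
    by (rule prime_inD(4)[OF prime])
  then show ?thesis by simp
qed

lemma j_column_in_prime:
  "(\<lambda>x. cramer_det L x * j_column x m $ \<kappa> + cramer_vec L x (bracket (adhm_B1 x) (adhm_B2 x) m) $ \<kappa>) \<in> P"
proof -
  let ?f = "\<lambda>x. cramer_det L x * j_column x m $ \<kappa> + cramer_vec L x (bracket (adhm_B1 x) (adhm_B2 x) m) $ \<kappa>"
  have "(\<lambda>x. ?f x - cramer_vec L x (moment_column x m) $ \<kappa>) \<in> P"
  proof (rule off_det)
    show "(\<lambda>x. ?f x - cramer_vec L x (moment_column x m) $ \<kappa>) \<in> adhm_polys"
      by (intro P.Q_diff P.Q_add P.Q_mult P.Q_cramer(1)[OF coords_polys(5,6) P.Q_const]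
          P.Q_cramer(2)[OF coords_polys(5,6)] bracket_polys moment_column_polys j_column_polys)
  qed (simp add: moment_column_eq cramer_vec_add cramer_vec_toeplitz)
  moreover have "(\<lambda>x. cramer_vec L x (moment_column x m) $ \<kappa>) \<in> P"
    by (rule subsetD[OF ideal]) (rule ideal_cramer(1)[OF adhm_ideal moment_column_ideal])
  ultimately have "(\<lambda>x. (?f x - cramer_vec L x (moment_column x m) $ \<kappa>) + cramer_vec L x (moment_column x m) $ \<kappa>) \<in> P"
    by (rule prime_inD(4)[OF prime])
  then show ?thesis by simp
qed

context
  fixes Z :: "(('k, 'v, 'w) adhm \<Rightarrow> 'k) set" assumes Z: "Z \<subseteq> adhm_polys"
begin

interpretation K: function_algebra "P.rational_over P Z"
  by standard (rule P.rational_subalgebra[OF prime Z])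

text \<open>
  The entries in the frame are constant modulo the prime.
\<close>
lemma i_rational:
  assumes "\<And>a b. b \<notin> range iota \<Longrightarrow> (\<lambda>x. fst (adhm_i x) $ a $ b) \<in> P.rational_over P Z"
  shows "(\<lambda>x. fst (adhm_i x) $ a $ b) \<in> P.rational_over P Z"
proof (cases "b \<in> range iota")
  case True
  then obtain a' where b: "b = iota a'" by blast
  have "(\<lambda>x. (frame iota x $ a $ a' - mat 1 $ a $ a') + mat 1 $ a $ a') \<in> P.rational_over P Z"
    by (rule K.Q_add[OF P.prime_rational[OF prime Z slice] K.Q_const])
  then show ?thesis by (simp add: frame_def b)
qed (rule assms)

text \<open>
  Cramer's rule expresses the entries of \<open>j\<close> through those of \<open>B\<close> and \<open>i\<close> modulo the prime.
\<close>
lemma all_rational: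
  assumes free: "free_coords \<subseteq> P.rational_over P Z" and f: "f \<in> adhm_polys"
  shows "f \<in> P.rational_over P Z"
proof -
  have B: "(\<lambda>x. fst (adhm_B1 x) $ a $ b) \<in> P.rational_over P Z" "(\<lambda>x. snd (adhm_B1 x) $ a $ b) \<in> P.rational_over P Z"
    "(\<lambda>x. fst (adhm_B2 x) $ a $ b) \<in> P.rational_over P Z" "(\<lambda>x. snd (adhm_B2 x) $ a $ b) \<in> P.rational_over P Z" for a b
    by (rule subsetD[OF free], rule free_coords_mem)+
  have i1: "(\<lambda>x. snd (adhm_i x) $ a $ b) \<in> P.rational_over P Z" for a b
    by (rule subsetD[OF free], rule free_coords_mem_i)
  have i0: "(\<lambda>x. fst (adhm_i x) $ a $ b) \<in> P.rational_over P Z" for a b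
    by (rule i_rational, rule subsetD[OF free], erule free_coords_mem_i)
  have br: "(\<lambda>x. bracket (adhm_B1 x) (adhm_B2 x) m $ \<rho>) \<in> P.rational_over P Z" for m \<rho>
    by (rule K.Q_bracket; rule B)
  have j: "(\<lambda>x. j_column x m $ \<kappa>) \<in> P.rational_over P Z" for m \<kappa>
  proof (rule P.rational_divide[OF prime Z j_column_polys _ det_notin])
    show "cramer_det L \<in> P.rational_over P Z" by (rule K.Q_cramer(1)[OF i0 i1 K.Q_const])
    show "(\<lambda>x. - cramer_vec L x (bracket (adhm_B1 x) (adhm_B2 x) m) $ \<kappa>) \<in> P.rational_over P Z"
      by (rule K.Q_uminus[OF K.Q_cramer(2)[OF i0 i1 br]])
    show "(\<lambda>x. cramer_det L x * j_column x m $ \<kappa> - - cramer_vec L x (bracket (adhm_B1 x) (adhm_B2 x) m) $ \<kappa>) \<in> P"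
      using j_column_in_prime by simp
  qed
  have j': "(\<lambda>x. fst (adhm_j x) $ w $ m) \<in> P.rational_over P Z" "(\<lambda>x. snd (adhm_j x) $ w $ m) \<in> P.rational_over P Z" for w m
    using j[of m "Inl w"] j[of m "Inr w"] by (simp_all add: j_column_def)
  show ?thesis
  proof (rule polys_compose[where T = "\<lambda>y. y", OF f K.Q])
    fix \<phi> :: "('k, 'v, 'w) adhm \<Rightarrow> 'k" assume "\<phi> \<in> adhm_coords"
    then show "\<phi> \<in> P.rational_over P Z"
      by (rule coords_compose[where T = "\<lambda>y. y"]) (rule B i0 i1 j')+
  qed
qed

text \<open>
  The compatibility relation is linear in this entry, with the coefficient that is assumed to be
  nonzero modulo the prime.
\<close>
lemma B1_entry_rational:
  assumes l: "l \<noteq> k"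
    and free: "free_coords - {\<lambda>x. fst (adhm_B1 x) $ k $ k} \<subseteq> P.rational_over P Z"
    and q: "(\<lambda>x. fst (adhm_B2 x) $ k $ l * compat L u x (axis (Inl k) 1) +
      snd (adhm_B2 x) $ k $ l * compat L u x (axis (Inr (Inl k)) 1)) \<notin> P" (is "?q \<notin> P")
  shows "(\<lambda>x. fst (adhm_B1 x) $ k $ k) \<in> P.rational_over P Z"
proof -
  let ?y = "\<lambda>x :: ('k, 'v, 'w) adhm. fst (adhm_B1 x) $ k $ k"
  let ?B1 = "\<lambda>x :: ('k, 'v, 'w) adhm. ((\<chi> a b. if a = k \<and> b = k then 0 else fst (adhm_B1 x) $ a $ b), snd (adhm_B1 x))"
  let ?d = "\<lparr>adhm_B1 = (matrix_unit k k, 0), adhm_B2 = (0, 0), adhm_i = (0, 0), adhm_j = (0, 0)\<rparr> :: ('k, 'v, 'w) adhm"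
  have other: "z \<in> P.rational_over P Z" if "z \<in> free_coords" "z ?d \<noteq> ?y ?d" for z
    using that by (intro subsetD[OF free]) auto
  have B10: "(\<lambda>x. fst (adhm_B1 x) $ a $ b) \<in> P.rational_over P Z" if "\<not> (a = k \<and> b = k)" for a b
    by (rule other)
      (use that in \<open>auto simp: free_coords_mem matrix_unit_def\<close>)
  have B: "(\<lambda>x. snd (adhm_B1 x) $ a $ b) \<in> P.rational_over P Z"
    "(\<lambda>x. fst (adhm_B2 x) $ a $ b) \<in> P.rational_over P Z" "(\<lambda>x. snd (adhm_B2 x) $ a $ b) \<in> P.rational_over P Z"
    "(\<lambda>x. snd (adhm_i x) $ a $ c) \<in> P.rational_over P Z" for a b c
    by (rule other,
        rule free_coords_mem free_coords_mem_i, simp add: matrix_unit_def)+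
  have i0: "(\<lambda>x. fst (adhm_i x) $ a $ c) \<in> P.rational_over P Z" for a c
    by (rule i_rational,
        rule other,
        erule free_coords_mem_i, simp add: matrix_unit_def)
  have br: "(\<lambda>x. bracket (?B1 x) (adhm_B2 x) l $ \<rho>) \<in> P.rational_over P Z" for \<rho>
  proof (rule K.Q_bracket)
    show "(\<lambda>x. fst (?B1 x) $ a $ b) \<in> P.rational_over P Z" for a b
      using B10[of a b] K.Q_const[of 0] by (cases "a = k \<and> b = k") auto
  qed (simp_all add: B)
  note compat = K.Q_cramer(3)[OF i0 B(4), of _ L u]
  show ?thesis
  proof (rule P.rational_divide[OF prime Z coords_polys(1) _ q])
    show "?q \<in> P.rational_over P Z"
      by (rule K.Q_add; rule K.Q_mult; rule B compat[OF K.Q_const])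
    show "(\<lambda>x. - compat L u x (bracket (?B1 x) (adhm_B2 x) l)) \<in> P.rational_over P Z"
      by (rule K.Q_uminus[OF compat[OF br]])
    have "bracket (adhm_B1 x) (adhm_B2 x) l = bracket (?B1 x) (adhm_B2 x) l + ?y x *s
        (fst (adhm_B2 x) $ k $ l *s axis (Inl k) 1 + snd (adhm_B2 x) $ k $ l *s axis (Inr (Inl k)) 1)" for x :: "('k, 'v, 'w) adhm"
      using bracket_split[OF l, of "fst (adhm_B1 x)" "snd (adhm_B1 x)" "fst (adhm_B2 x)" "snd (adhm_B2 x)"] by simp
    note split = this
    have "compat L u x (bracket (adhm_B1 x) (adhm_B2 x) l) = ?q x * ?y x - - compat L u x (bracket (?B1 x) (adhm_B2 x) l)" for x
      unfolding split[of x] compat_add compat_scale by (simp only: mult.commute minus_minus add.commute diff_minus_eq_add)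
    then show "(\<lambda>x. ?q x * ?y x - - compat L u x (bracket (?B1 x) (adhm_B2 x) l)) \<in> P"
      using compat_in_prime[of u l] by simp
  qed
qed

text \<open>
  If that coefficient vanishes modulo the prime, this is itself a relation, linear in an entry of the
  second matrix.
\<close>
lemma B2_entry_rational:
  assumes free: "free_coords - {\<lambda>x. fst (adhm_B2 x) $ k $ l} \<subseteq> P.rational_over P Z"
    and q: "(\<lambda>x. fst (adhm_B2 x) $ k $ l * compat L u x (axis (Inl k) 1) +
      snd (adhm_B2 x) $ k $ l * compat L u x (axis (Inr (Inl k)) 1)) \<in> P"
    and e: "(\<lambda>x. compat L u x (axis (Inl k) 1)) \<notin> P"
  shows "(\<lambda>x. fst (adhm_B2 x) $ k $ l) \<in> P.rational_over P Z"
proof -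
  let ?y = "\<lambda>x :: ('k, 'v, 'w) adhm. fst (adhm_B2 x) $ k $ l"
  let ?d = "\<lparr>adhm_B1 = (0, 0), adhm_B2 = (matrix_unit k l, 0), adhm_i = (0, 0), adhm_j = (0, 0)\<rparr> :: ('k, 'v, 'w) adhm"
  have other: "z \<in> P.rational_over P Z" if "z \<in> free_coords" "z ?d \<noteq> ?y ?d" for z
    using that by (intro subsetD[OF free]) auto
  have B: "(\<lambda>x. snd (adhm_B2 x) $ a $ b) \<in> P.rational_over P Z"
    "(\<lambda>x. snd (adhm_i x) $ a $ c) \<in> P.rational_over P Z" for a b c
    by (rule other, rule free_coords_mem free_coords_mem_i, simp add: matrix_unit_def)+
  have i0: "(\<lambda>x. fst (adhm_i x) $ a $ c) \<in> P.rational_over P Z" for a c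
    by (rule i_rational, rule other, erule free_coords_mem_i, simp add: matrix_unit_def)
  note compat = K.Q_cramer(3)[OF i0 B(2) K.Q_const, of L u]
  show ?thesis
  proof (rule P.rational_divide[OF prime Z coords_polys(3) compat e])
    show "(\<lambda>x. - (snd (adhm_B2 x) $ k $ l * compat L u x (axis (Inr (Inl k)) 1))) \<in> P.rational_over P Z"
      by (rule K.Q_uminus[OF K.Q_mult[OF B(1) compat]])
    show "(\<lambda>x. compat L u x (axis (Inl k) 1) * ?y x - - (snd (adhm_B2 x) $ k $ l * compat L u x (axis (Inr (Inl k)) 1))) \<in> P"
      using q by (simp add: mult.commute)
  qed
qed

end

end

text \<open>
  One of the two eliminations applies: the coefficient of the entry of \<open>B\<^sub>2\<close> has value \<open>1\<close> at the base point and
  is therefore nonzero modulo every prime through it.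
\<close>
lemma coordinate_system_exists:
  fixes P :: "(('k::alg_closed_field, 'v, 'w) adhm \<Rightarrow> 'k) set"
  assumes "tangent_chart.slice_prime iota base P"
  shows "\<exists>Z. tangent_chart.coordinate_system Z P \<and> card Z < card (free_coords :: (('k, 'v, 'w) adhm \<Rightarrow> 'k) set)"
proof -
  interpret T: tangent_chart iota "base :: ('k, 'v, 'w) adhm" free_coords tangent_line
    by (rule base_tangent_chart)
  obtain k where k: "vv k = 2 * s" using vv_surj s(3) by blast
  obtain k1 where k1: "vv k1 = s" using vv_surj[of s] s by auto
  obtain l where l: "vv l = 0" using vv_surj[of 0] s by auto
  have lk: "l \<noteq> k" using k l s(2) by auto
  define u :: "'k^('v + 'v + 'v)" where "u = axis (Inl k) 1 - axis (Inr (Inl k1)) 1 + axis (Inr (Inr l)) 1"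
  have u: "u v* toeplitz base = 0" unfolding u_def by (rule toeplitz_base_cokernel[OF k k1 l])
  obtain L :: "'k^('v + 'v + 'v)^('w + 'w)" where L: "L ** toeplitz base = mat 1"
    using matrix_left_invertible_ker[of "toeplitz (base :: ('k, 'v, 'w) adhm)"] toeplitz_base_kernel by metis
  have "compat L u base (axis (Inl k) 1) = 1"
  proof -
    have "(\<Sum>\<rho>\<in>UNIV. u $ \<rho> * axis (Inl k) 1 $ \<rho>) = (\<Sum>\<rho>\<in>UNIV. if \<rho> = Inl k then u $ \<rho> else 0)"
      by (rule sum.cong) (auto simp: axis_def)
    also have "\<dots> = 1" by (simp add: u_def axis_def)
    finally show ?thesis by (simp add: compat_def u cramer_det_def L)
  qed
  then have e: "(\<lambda>x. compat L u x (axis (Inl k) 1)) \<notin> P"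
    using vanish[OF assms L, of "\<lambda>x. compat L u x (axis (Inl k) 1)"] by auto
  note prime = prime[OF assms L]
  have "\<exists>y\<in>free_coords. y \<in> P.rational_over P (free_coords - {y})"
  proof (cases "(\<lambda>x. fst (adhm_B2 x) $ k $ l * compat L u x (axis (Inl k) 1) +
      snd (adhm_B2 x) $ k $ l * compat L u x (axis (Inr (Inl k)) 1)) \<in> P")
    case False
    let ?y = "\<lambda>x :: ('k, 'v, 'w) adhm. fst (adhm_B1 x) $ k $ k"
    have sub: "free_coords - {?y} \<subseteq> adhm_polys" using T.C(2) by blast
    have "?y \<in> P.rational_over P (free_coords - {?y})"
      by (rule B1_entry_rational[OF assms L sub lk _ False]) (rule subsetI, rule P.alg_rational[OF prime sub alg.gen])
    then show ?thesis by (rule bexI[OF _ free_coords_mem(1)])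
  next
    case True
    let ?y = "\<lambda>x :: ('k, 'v, 'w) adhm. fst (adhm_B2 x) $ k $ l"
    have sub: "free_coords - {?y} \<subseteq> adhm_polys" using T.C(2) by blast
    have "?y \<in> P.rational_over P (free_coords - {?y})"
      by (rule B2_entry_rational[OF assms L sub _ True e]) (rule subsetI, rule P.alg_rational[OF prime sub alg.gen])
    then show ?thesis by (rule bexI[OF _ free_coords_mem(3)])
  qed
  then obtain y where y: "y \<in> free_coords" "y \<in> P.rational_over P (free_coords - {y})" by blast
  let ?Z = "free_coords - {y}"
  have sub: "?Z \<subseteq> adhm_polys" using T.C(2) by blast
  have "free_coords \<subseteq> P.rational_over P ?Z"
    using y(2) P.alg_rational[OF prime sub alg.gen] by blast
  from all_rational[OF assms L sub this]
  have "T.coordinate_system ?Z P"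
    unfolding T.coordinate_system_def P.rational_over_def using T.C(1) sub by blast
  moreover have "card ?Z < card (free_coords :: (('k, 'v, 'w) adhm \<Rightarrow> 'k) set)"
    by (rule card_Diff1_less[OF T.C(1) y(1)])
  ultimately show ?thesis by blast
qed

end

theorem mainTheorem7:
  fixes r c :: nat
  assumes "r > 0" and "c > 0"
    and "c < r" and "real r < 3 * real c / 2"
    and "CARD('v::finite) = c" and "CARD('w::finite) = r"
  shows "singular (framed_instanton_moduli :: ('k::alg_closed_field, 'v, 'w) moduli_space) \<or>
         reducible (framed_instanton_moduli :: ('k, 'v, 'w) moduli_space)"
proof -
  obtain vv :: "'v \<Rightarrow> nat" where vv: "bij_betw vv UNIV {..<CARD('v)}"
    using ex_bij_betw_finite_nat[of "UNIV :: 'v set"] by (auto simp: lessThan_atLeast0)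
  obtain ww :: "'w \<Rightarrow> nat" where ww: "bij_betw ww UNIV {..<CARD('w)}"
    using ex_bij_betw_finite_nat[of "UNIV :: 'w set"] by (auto simp: lessThan_atLeast0)
  have "2 * r < 3 * c" using assms(4) by linarith
  then interpret kronecker vv ww "r - c"
    using vv ww assms by unfold_locales auto
  interpret T: tangent_chart iota "base :: ('k, 'v, 'w) adhm" free_coords tangent_line
    by (rule base_tangent_chart)
  have "\<not> regular_local_ring (stalk moduli (gl_orbit (base :: ('k, 'v, 'w) adhm)))"
  proof (rule T.stalk_not_regular[OF _ coordinate_system_exists])
    show "(free_coords :: (('k, 'v, 'w) adhm \<Rightarrow> 'k) set) \<noteq> {}" using free_coords_mem(1) by blast
  qed
  moreover have "gl_orbit base \<in> topspace (top_of (moduli :: ('k, 'v, 'w) moduli_space))"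
    using openin_subset[OF T.openin_orbits_chart_open[OF P.Q_const[of 1]]] T.x0_chart_open[of "\<lambda>x. 1"] by auto
  ultimately show ?thesis unfolding singular_def by blast
qed

end
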